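(* Let $(X,\omega_0)$ be a compact connected Kähler manifold, let $K>0$ and $0<\alpha\le 1$. There exists $C>0$, depending only on $(X,\omega_0)$, $K$ and $\alpha$, with the following property. Let $\omega_\varphi=\omega_0+\sqrt{-1}\,\partial\bar\partial\varphi$ be a Kähler metric on $X$ (with $\varphi$ a smooth real function) such that $$|\varphi(p)-\varphi(q)|\le K d_0(p,q)^\alpha\qquad\text{for all }p,q\in X.$$ Then for every $\varepsilon\in(0,1/4]$ and every $p,q\in X$ there are curves $\gamma,\eta:[0,1]\to X$ joining $p$ to $q$ such that 1. $d_0(p,q)\le \ell_0(\gamma)\le C d_0(p,q)$, 2. $d_0(\gamma(t),\eta(t))<\varepsilon$ for all $t\in[0,1]$, and $$\ell_\varphi(\eta)\le\frac{C}{\varepsilon}\,\ell_0(\gamma)^{\alpha/2},$$ and hence $$d_\varphi(p,q)\le \ell_\varphi(\eta)\le \frac{C}{\varepsilon}\, d_0(p,q)^{\alpha/2}.$$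
   Context: $d_0$ and $\ell_0$ denote the Riemannian distance and the length of (piecewise smooth) curves with respect to $\omega_0$; $d_\varphi$ and $\ell_\varphi$ denote those with respect to $\omega_\varphi$. Curves are piecewise smooth. As usual, the constant $C$ may be taken the same in all the inequalities. *)

theory Defs
  imports "HOL-Analysis.Analysis"
begin

section \<open>Smooth maps\<close>

text \<open>Class C^k on an open set, by recursion on directional derivatives; in finite dimension this
  is the usual notion.\<close>

fun C_k_on :: "nat \<Rightarrow> 'a::euclidean_space set \<Rightarrow> ('a \<Rightarrow> 'b::real_normed_vector) \<Rightarrow> bool" where
  "C_k_on 0 S f \<longleftrightarrow> continuous_on S f"
| "C_k_on (Suc k) S f \<longleftrightarrow>
     (\<forall>x\<in>S. f differentiable at x) \<and> (\<forall>v. C_k_on k S (\<lambda>x. frechet_derivative f (at x) v))"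

text \<open>On an arbitrary set (for instance a closed interval), smooth means that there are local
  smooth extensions to open sets.\<close>

definition smooth_on :: "'a::euclidean_space set \<Rightarrow> ('a \<Rightarrow> 'b::real_normed_vector) \<Rightarrow> bool" where
  "smooth_on S f \<longleftrightarrow>
     (\<forall>x\<in>S. \<exists>U F. open U \<and> x \<in> U \<and> (\<forall>k. C_k_on k U F) \<and> (\<forall>y\<in>S \<inter> U. F y = f y))"


section \<open>Complex manifolds\<close>

type_synonym ('a, 'n) chart = "'a set \<times> ('a \<Rightarrow> complex ^ 'n)"

definition cinv :: "('a, 'n) chart \<Rightarrow> complex ^ 'n \<Rightarrow> 'a" where
  "cinv c = inv_into (fst c) (snd c)"

definition cimage :: "('a, 'n) chart \<Rightarrow> (complex ^ 'n) set" where
  "cimage c = snd c ` fst c"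

definition transition :: "('a, 'n) chart \<Rightarrow> ('a, 'n) chart \<Rightarrow> complex ^ 'n \<Rightarrow> complex ^ 'n" where
  "transition c c' = snd c' \<circ> cinv c"

text \<open>Holomorphic maps of several variables on an open set: smooth maps whose differential is
  complex linear. (Smoothness of complex differentiable maps would be automatic.)\<close>

definition holomorphic_map_on ::
    "(complex ^ 'n::finite) set \<Rightarrow> (complex ^ 'n \<Rightarrow> complex ^ 'n) \<Rightarrow> bool" where
  "holomorphic_map_on S f \<longleftrightarrow> smooth_on S f \<and>
     (\<forall>z\<in>S. \<forall>a v. frechet_derivative f (at z) (a *s v) = a *s frechet_derivative f (at z) v)"

definition is_chart :: "'a topology \<Rightarrow> ('a, 'n::finite) chart \<Rightarrow> bool" where
  "is_chart X c \<longleftrightarrow> openin X (fst c) \<and> open (cimage c) \<and>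
     homeomorphic_map (subtopology X (fst c)) (top_of_set (cimage c)) (snd c)"

definition complex_manifold :: "'a topology \<Rightarrow> ('a, 'n::finite) chart set \<Rightarrow> bool" where
  "complex_manifold X A \<longleftrightarrow>
     Hausdorff_space X \<and> second_countable X \<and>
     (\<forall>c\<in>A. is_chart X c) \<and> (\<Union>c\<in>A. fst c) = topspace X \<and>
     (\<forall>c\<in>A. \<forall>c'\<in>A. holomorphic_map_on (snd c ` (fst c \<inter> fst c')) (transition c c'))"

definition smooth_function :: "('a, 'n::finite) chart set \<Rightarrow> ('a \<Rightarrow> real) \<Rightarrow> bool" where
  "smooth_function A \<phi> \<longleftrightarrow> (\<forall>c\<in>A. smooth_on (cimage c) (\<phi> \<circ> cinv c))"


section \<open>Kaehler forms\<close>

text \<open>A real 2-form on a manifold is given by its representatives in the charts: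
  \<open>\<omega> c z u v\<close> is the value on the tangent vectors with coordinates \<open>u\<close>, \<open>v\<close> in the chart \<open>c\<close>, at the
  point with coordinates \<open>z\<close>. The representatives are related by pullback along the transition maps.
  Only the values for \<open>z\<close> in the image of the chart are meaningful.\<close>

type_synonym ('a, 'n) two_form =
  "('a, 'n) chart \<Rightarrow> complex ^ 'n \<Rightarrow> complex ^ 'n \<Rightarrow> complex ^ 'n \<Rightarrow> real"

definition smooth_two_form :: "('a, 'n::finite) chart set \<Rightarrow> ('a, 'n) two_form \<Rightarrow> bool" where
  "smooth_two_form A \<omega> \<longleftrightarrow>
     (\<forall>c\<in>A. \<forall>z\<in>cimage c. bilinear (\<omega> c z) \<and> (\<forall>v. \<omega> c z v v = 0)) \<and>
     (\<forall>c\<in>A. \<forall>u v. smooth_on (cimage c) (\<lambda>z. \<omega> c z u v)) \<and>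
     (\<forall>c\<in>A. \<forall>c'\<in>A. \<forall>p\<in>fst c \<inter> fst c'. \<forall>u v.
        \<omega> c (snd c p) u v =
        \<omega> c' (snd c' p) (frechet_derivative (transition c c') (at (snd c p)) u)
                        (frechet_derivative (transition c c') (at (snd c p)) v))"

text \<open>Exterior derivative of a 2-form on an open subset of \<open>\<complex>\<^sup>n\<close>, evaluated on constant vector
  fields.\<close>

definition ext_deriv2 ::
    "(complex ^ 'n::finite \<Rightarrow> complex ^ 'n \<Rightarrow> complex ^ 'n \<Rightarrow> real)
      \<Rightarrow> complex ^ 'n \<Rightarrow> complex ^ 'n \<Rightarrow> complex ^ 'n \<Rightarrow> complex ^ 'n \<Rightarrow> real" where
  "ext_deriv2 \<beta> z u v w =
     frechet_derivative (\<lambda>y. \<beta> y v w) (at z) u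
   + frechet_derivative (\<lambda>y. \<beta> y w u) (at z) v
   + frechet_derivative (\<lambda>y. \<beta> y u v) (at z) w"

text \<open>A Kaehler form is a closed positive real (1,1)-form; a real 2-form is of type (1,1) iff it is
  invariant under the complex structure, here \<open>(*s) \<i>\<close>.\<close>

definition kahler_form :: "('a, 'n::finite) chart set \<Rightarrow> ('a, 'n) two_form \<Rightarrow> bool" where
  "kahler_form A \<omega> \<longleftrightarrow> smooth_two_form A \<omega> \<and>
     (\<forall>c\<in>A. \<forall>z\<in>cimage c.
        (\<forall>u v. \<omega> c z (\<i> *s u) (\<i> *s v) = \<omega> c z u v) \<and>
        (\<forall>v. v \<noteq> 0 \<longrightarrow> \<omega> c z v (\<i> *s v) > 0) \<and>
        (\<forall>u v w. ext_deriv2 (\<omega> c) z u v w = 0))"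

text \<open>The Wirtinger operators: one half of \<open>\<partial>/\<partial>x\<^sub>j - \<i> \<partial>/\<partial>y\<^sub>j\<close> and of \<open>\<partial>/\<partial>x\<^sub>j + \<i> \<partial>/\<partial>y\<^sub>j\<close>.\<close>

definition d_z :: "'n::finite \<Rightarrow> (complex ^ 'n \<Rightarrow> complex) \<Rightarrow> complex ^ 'n \<Rightarrow> complex" where
  "d_z j h z = (frechet_derivative h (at z) (axis j 1)
                - \<i> * frechet_derivative h (at z) (axis j \<i>)) / 2"

definition d_zbar :: "'n::finite \<Rightarrow> (complex ^ 'n \<Rightarrow> complex) \<Rightarrow> complex ^ 'n \<Rightarrow> complex" where
  "d_zbar j h z = (frechet_derivative h (at z) (axis j 1)
                   + \<i> * frechet_derivative h (at z) (axis j \<i>)) / 2"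

text \<open>The form sqrt(-1) ddbar h, that is, sqrt(-1) times the sum over j, k of the mixed derivatives
  of h times the wedge product of \<open>dz\<^sub>j\<close> and the conjugate of \<open>dz\<^sub>k\<close>. For real h the complex number below
  is real, and \<open>Re\<close> only changes its type.\<close>

definition i_ddbar ::
    "(complex ^ 'n::finite \<Rightarrow> real) \<Rightarrow> complex ^ 'n \<Rightarrow> complex ^ 'n \<Rightarrow> complex ^ 'n \<Rightarrow> real" where
  "i_ddbar h z u v =
     Re (\<i> * (\<Sum>j\<in>UNIV. \<Sum>k\<in>UNIV. d_z j (d_zbar k (\<lambda>w. complex_of_real (h w))) z
                              * (u $ j * cnj (v $ k) - v $ j * cnj (u $ k))))"

definition kahler_deform ::
    "('a, 'n::finite) two_form \<Rightarrow> ('a \<Rightarrow> real) \<Rightarrow> ('a, 'n) two_form" where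
  "kahler_deform \<omega> \<phi> = (\<lambda>c z u v. \<omega> c z u v + i_ddbar (\<phi> \<circ> cinv c) z u v)"


section \<open>Curves, lengths, and distances\<close>

definition smooth_curve_on ::
    "('a, 'n::finite) chart set \<Rightarrow> real set \<Rightarrow> (real \<Rightarrow> 'a) \<Rightarrow> bool" where
  "smooth_curve_on A S \<gamma> \<longleftrightarrow>
     (\<forall>t\<in>S. \<exists>c\<in>A. \<gamma> t \<in> fst c \<and> smooth_on {s\<in>S. \<gamma> s \<in> fst c} (snd c \<circ> \<gamma>))"

definition piecewise_smooth_curve ::
    "'a topology \<Rightarrow> ('a, 'n::finite) chart set \<Rightarrow> (real \<Rightarrow> 'a) \<Rightarrow> bool" where
  "piecewise_smooth_curve X A \<gamma> \<longleftrightarrow> pathin X \<gamma> \<and>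
     (\<exists>m (s :: nat \<Rightarrow> real). s 0 = 0 \<and> s m = 1 \<and>
        (\<forall>i<m. s i < s (Suc i) \<and> smooth_curve_on A {s i..s (Suc i)} \<gamma>))"

definition curve_joins ::
    "'a topology \<Rightarrow> ('a, 'n::finite) chart set \<Rightarrow> 'a \<Rightarrow> 'a \<Rightarrow> (real \<Rightarrow> 'a) \<Rightarrow> bool" where
  "curve_joins X A p q \<gamma> \<longleftrightarrow> piecewise_smooth_curve X A \<gamma> \<and> \<gamma> 0 = p \<and> \<gamma> 1 = q"

text \<open>The Riemannian metric of a Kaehler form has squared norm \<open>\<omega>(v, Jv)\<close>. For a 2-form the speed
  does not depend on the chosen chart at points of differentiability; the finitely many break points
  do not contribute to the length.\<close>

definition speed ::
    "('a, 'n::finite) chart set \<Rightarrow> ('a, 'n) two_form \<Rightarrow> (real \<Rightarrow> 'a) \<Rightarrow> real \<Rightarrow> real" where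
  "speed A \<omega> \<gamma> t =
     (let c = (SOME c. c \<in> A \<and> \<gamma> t \<in> fst c);
          v = vector_derivative (snd c \<circ> \<gamma>) (at t)
      in sqrt (\<omega> c (snd c (\<gamma> t)) v (\<i> *s v)))"

definition curve_length ::
    "('a, 'n::finite) chart set \<Rightarrow> ('a, 'n) two_form \<Rightarrow> (real \<Rightarrow> 'a) \<Rightarrow> real" where
  "curve_length A \<omega> \<gamma> = integral {0..1} (speed A \<omega> \<gamma>)"

definition riem_dist ::
    "'a topology \<Rightarrow> ('a, 'n::finite) chart set \<Rightarrow> ('a, 'n) two_form \<Rightarrow> 'a \<Rightarrow> 'a \<Rightarrow> real" where
  "riem_dist X A \<omega> p q = (INF \<gamma> \<in> {\<gamma>. curve_joins X A p q \<gamma>}. curve_length A \<omega> \<gamma>)"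

end

theory Submission
  imports Defs
begin

text \<open>Let p and q = p + v be close, in a common chart. Along the complex line p + s v the squared speed of
  \<open>\<omega>\<^sub>\<phi>\<close> in the direction v is h(s) = \<open>\<omega>\<^sub>0\<close>(v, Jv) + (1/2) Laplacian of \<open>\<phi>\<close>(p + s v), and h is
  nonnegative. Integrating by parts twice against a weight living on a box of size T next to s = 0 bounds the
  integral of h over a smaller box at distance T/2 from 0 by a multiple of the oscillation of \<open>\<phi>\<close>, hence by a
  multiple of \<open>T\<^sup>\<alpha>\<close>. Summing over dyadic T, the average over y in [-1/2, 1/2] of the
  \<open>\<omega>\<^sub>\<phi>\<close>-length of the segment from p to the apex m = p + (1/2 + i y/2) v is at most of order
  \<open>|v|\<^bsup>\<alpha>/2\<^esup>\<close>; the same holds for the segment from m to q. So some polygon p, m, q is short.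
  For arbitrary p and q, let \<open>\<gamma>\<close> be a curve with \<open>\<ell>\<^sub>0(\<gamma>)\<close> at most twice the distance, cut it into
  \<open>O(1/\<epsilon>)\<close> arcs of equal length, small compared with \<open>\<epsilon>\<close>, and replace every arc by such a polygon.\<close>

section \<open>Averaging over a cone in the plane\<close>

text \<open>The obstacle is that the Hoelder bound controls \<open>\<omega>\<^sub>\<phi>\<close>
  only on average: the second derivatives of \<phi> have no pointwise bound, and a single segment is
  a null set in its complex line. Positivity turns the oscillation of \<phi> into an L1 bound of h
  on plane boxes, and rays sweeping out a cone turn that bound into one for lengths. The rays are
  parametrized by slope y instead of height t; since dx dy = dx dt / x, the slab at distance T
  carries weighted energy of order T^\<alpha> / T. Cauchy-Schwarz on a slab of width of order T then
  yields T^(\<alpha>/2): here the exponent is halved, and \<alpha> > 0 makes the sum converge at the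
  vertex. Both end points of the polygon are prescribed, so two cones are needed; rays of slope y
  from p and -y from q meet in one apex, and averaging the sum of the two sides finds an apex that
  is good for both. The factor 1/\<epsilon> merely counts arcs. Chart radii and metric bounds come
  from \<open>\<omega>\<^sub>0\<close> alone, which keeps the constant independent of
  \<phi>.\<close>

lemma by_parts_twice:
  fixes f f' f'' w w' w'' :: "real \<Rightarrow> real"
  assumes "a \<le> b"
    and f: "\<And>x. x \<in> {a..b} \<Longrightarrow> (f has_real_derivative f' x) (at x)"
    and f': "\<And>x. x \<in> {a..b} \<Longrightarrow> (f' has_real_derivative f'' x) (at x)"
    and w: "\<And>x. x \<in> {a..b} \<Longrightarrow> (w has_real_derivative w' x) (at x)"
    and w': "\<And>x. x \<in> {a..b} \<Longrightarrow> (w' has_real_derivative w'' x) (at x)"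
    and zero: "w a = 0" "w b = 0" "w' a = 0" "w' b = 0"
    and int: "(\<lambda>x. f'' x * w x) integrable_on {a..b}"
  shows "integral {a..b} (\<lambda>x. f'' x * w x) = integral {a..b} (\<lambda>x. f x * w'' x)"
proof -
  \<comment> \<open>f' w - f w' is a primitive of this difference, and its boundary values vanish
    with w and w'. The fundamental theorem also supplies the integrability of f w''.\<close>
  have "((\<lambda>x. f'' x * w x - f x * w'' x) has_integral
      (f' b * w b - f b * w' b) - (f' a * w a - f a * w' a)) {a..b}"
  proof (rule fundamental_theorem_of_calculus[OF \<open>a \<le> b\<close>])
    fix x assume x: "x \<in> {a..b}"
    have "((\<lambda>x. f' x * w x - f x * w' x) has_real_derivative
        (f' x * w' x + f'' x * w x) - (f x * w'' x + f' x * w' x)) (at x within {a..b})"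
      by (intro DERIV_diff DERIV_mult' has_field_derivative_at_within[OF f[OF x]]
          has_field_derivative_at_within[OF f'[OF x]] has_field_derivative_at_within[OF w[OF x]]
          has_field_derivative_at_within[OF w'[OF x]])
    then show "((\<lambda>x. f' x * w x - f x * w' x) has_vector_derivative f'' x * w x - f x * w'' x) (at x within {a..b})"
      by (simp add: has_real_derivative_iff_has_vector_derivative)
  qed
  then have "((\<lambda>x. f'' x * w x - f x * w'' x) has_integral 0) {a..b}"
    by (simp add: zero)
  from has_integral_diff[OF integrable_integral[OF int] this]
  show ?thesis
    by (auto dest: integral_unique)
qed

text \<open>The weight has size T^8, its second derivatives have size T^6, and the box has area 4
  T^2; division by T^8 leaves M T^2 + B up to constants. Nonnegativity of h allows the weighted
  integral to be restricted to the inner box, where the weight is bounded below.\<close>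

lemma box_energy:
  fixes u ux uxx ut utt h :: "real \<Rightarrow> real \<Rightarrow> real" and T M B :: real
  assumes T: "0 < T"
    and ux: "\<And>x t. x \<in> {0..2*T} \<Longrightarrow> t \<in> {-T..T} \<Longrightarrow> ((\<lambda>x. u x t) has_real_derivative ux x t) (at x)"
    and uxx: "\<And>x t. x \<in> {0..2*T} \<Longrightarrow> t \<in> {-T..T} \<Longrightarrow> ((\<lambda>x. ux x t) has_real_derivative uxx x t) (at x)"
    and ut: "\<And>x t. x \<in> {0..2*T} \<Longrightarrow> t \<in> {-T..T} \<Longrightarrow> ((\<lambda>t. u x t) has_real_derivative ut x t) (at t)"
    and utt: "\<And>x t. x \<in> {0..2*T} \<Longrightarrow> t \<in> {-T..T} \<Longrightarrow> ((\<lambda>t. ut x t) has_real_derivative utt x t) (at t)"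
    and cont: "continuous_on ({0..2*T} \<times> {-T..T}) (\<lambda>(x,t). u x t)"
      "continuous_on ({0..2*T} \<times> {-T..T}) (\<lambda>(x,t). uxx x t)"
      "continuous_on ({0..2*T} \<times> {-T..T}) (\<lambda>(x,t). utt x t)"
      "continuous_on ({0..2*T} \<times> {-T..T}) (\<lambda>(x,t). h x t)"
    and h0: "\<And>x t. x \<in> {0..2*T} \<Longrightarrow> t \<in> {-T..T} \<Longrightarrow> 0 \<le> h x t"
    and hM: "\<And>x t. x \<in> {0..2*T} \<Longrightarrow> t \<in> {-T..T} \<Longrightarrow> h x t \<le> M + (uxx x t + utt x t) / 2"
    and uB: "\<And>x t. x \<in> {0..2*T} \<Longrightarrow> t \<in> {-T..T} \<Longrightarrow> \<bar>u x t\<bar> \<le> B"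
    and M: "0 \<le> M"
  shows "integral {T/2..T} (\<lambda>x. integral {-T/2..T/2} (\<lambda>t. h x t)) \<le> 32 * M * T\<^sup>2 + 320 * B"
proof -
  \<comment> \<open>The weight a(x) b(t) vanishes to second order on the boundary of the box, so that no boundary terms
    appear.\<close>
  define a where "a x = (2*T*x - x\<^sup>2)\<^sup>2" for x :: real
  define a' where "a' x = 2 * (2*T*x - x\<^sup>2) * (2*T - 2*x)" for x :: real
  define a'' where "a'' x = 2 * (2*T - 2*x)\<^sup>2 - 4 * (2*T*x - x\<^sup>2)" for x :: real
  define b where "b t = (T\<^sup>2 - t\<^sup>2)\<^sup>2" for t :: real
  define b' where "b' t = - 4 * t * (T\<^sup>2 - t\<^sup>2)" for t :: real
  define b'' where "b'' t = 8 * t\<^sup>2 - 4 * (T\<^sup>2 - t\<^sup>2)" for t :: real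
  have da: "(a has_real_derivative a' x) (at x)" "(a' has_real_derivative a'' x) (at x)" for x
    unfolding a_def a'_def a''_def
    by (auto intro!: derivative_eq_intros simp: power2_eq_square algebra_simps)
  have db: "(b has_real_derivative b' x) (at x)" "(b' has_real_derivative b'' x) (at x)" for x
    unfolding b_def b'_def b''_def
    by (auto intro!: derivative_eq_intros simp: power2_eq_square algebra_simps)
  have zero: "a 0 = 0" "a (2*T) = 0" "a' 0 = 0" "a' (2*T) = 0" "b T = 0" "b (-T) = 0" "b' T = 0" "b' (-T) = 0"
    by (auto simp: a_def a'_def b_def b'_def power2_eq_square)
  define Q where "Q = cbox (0,-T) (2*T,T)"
  define Q' where "Q' = cbox (T/2,-T/2) (T,T/2)"
  have Q: "Q = {0..2*T} \<times> {-T..T}" and Q': "Q' = {T/2..T} \<times> {-T/2..T/2}"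
    by (auto simp: Q_def Q'_def cbox_Pair_eq)
  have QQ: "Q' \<subseteq> Q" using T by (auto simp: Q Q')
  have ca: "continuous_on S a" "continuous_on S a''" "continuous_on S b" "continuous_on S b''" for S
    unfolding a_def a''_def b_def b''_def by (intro continuous_intros)+
  have ca2: "continuous_on S (\<lambda>p. a (fst p))" "continuous_on S (\<lambda>p. a'' (fst p))"
     "continuous_on S (\<lambda>p. b (snd p))" "continuous_on S (\<lambda>p. b'' (snd p))" for S :: "(real \<times> real) set"
    unfolding a_def a''_def b_def b''_def by (intro continuous_intros)+
  note cQ = cont[folded Q, unfolded case_prod_beta]
  note ci = continuous_intros cQ ca2
  have integ: "f integrable_on Q" if "continuous_on Q f" for f :: "real \<times> real \<Rightarrow> real"
    using that unfolding Q_def by (rule integrable_continuous)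
  have integ': "f integrable_on Q'" if "continuous_on Q f" for f :: "real \<times> real \<Rightarrow> real"
    using continuous_on_subset[OF that QQ] unfolding Q'_def by (rule integrable_continuous)
  have T8: "T^4 * T^4 = T^8" "T\<^sup>2 * T^4 = T^6" "T^4 * T\<^sup>2 = T^6" "T^8 * T\<^sup>2 = T^10" "T^6 * T\<^sup>2 = T^8"
    by (simp_all flip: power_add)
  have swap: "integral {0..2*T} (\<lambda>x. integral {-T..T} (\<lambda>t. f x t)) = integral {-T..T} (\<lambda>t. integral {0..2*T} (\<lambda>x. f x t))"
    if "continuous_on Q (\<lambda>p. f (fst p) (snd p))" for f :: "real \<Rightarrow> real \<Rightarrow> real"
    using integral_swap_continuous[of 0 "-T" "2*T" T f] that by (simp add: Q_def case_prod_beta)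
  \<comment> \<open>The iterated integral has t innermost, so Fubini is applied before and after the
    integration by parts in x. For \<open>I2\<close> the order is already right.\<close>
  have I1: "integral Q (\<lambda>p. uxx (fst p) (snd p) * (a (fst p) * b (snd p)))
     = integral Q (\<lambda>p. u (fst p) (snd p) * (a'' (fst p) * b (snd p)))" (is "?L = ?R")
  proof -
    have "?L = integral {0..2*T} (\<lambda>x. integral {-T..T} (\<lambda>t. uxx x t * (a x * b t)))"
      unfolding Q_def by (subst integral_prod_continuous) (auto simp: Q_def[symmetric] intro!: ci)
    also have "\<dots> = integral {-T..T} (\<lambda>t. integral {0..2*T} (\<lambda>x. uxx x t * (a x * b t)))"
      by (intro swap ci)
    also have "\<dots> = integral {-T..T} (\<lambda>t. integral {0..2*T} (\<lambda>x. u x t * (a'' x * b t)))"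
    proof (rule integral_cong)
      fix t assume t: "t \<in> {-T..T}"
      have "continuous_on {0..2*T} (\<lambda>x. (\<lambda>p. uxx (fst p) (snd p)) (x, t))"
        by (rule continuous_on_compose2[OF cQ(2)]) (use t in \<open>auto simp: Q intro!: continuous_intros\<close>)
      then have "(\<lambda>x. uxx x t * a x) integrable_on {0..2*T}"
        by (intro integrable_continuous_interval continuous_intros ca) auto
      then have "integral {0..2*T} (\<lambda>x. uxx x t * a x) = integral {0..2*T} (\<lambda>x. u x t * a'' x)"
        using T ux uxx da t by (intro by_parts_twice[where f' = "\<lambda>x. ux x t" and w' = a']) (auto simp: zero)
      then show "integral {0..2*T} (\<lambda>x. uxx x t * (a x * b t)) = integral {0..2*T} (\<lambda>x. u x t * (a'' x * b t))"
        by (simp add: mult.assoc[symmetric])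
    qed
    also have "\<dots> = integral {0..2*T} (\<lambda>x. integral {-T..T} (\<lambda>t. u x t * (a'' x * b t)))"
      by (intro swap[symmetric] ci)
    also have "\<dots> = ?R"
      unfolding Q_def by (subst integral_prod_continuous) (auto simp: Q_def[symmetric] intro!: ci)
    finally show ?thesis .
  qed
  have I2: "integral Q (\<lambda>p. utt (fst p) (snd p) * (a (fst p) * b (snd p)))
     = integral Q (\<lambda>p. u (fst p) (snd p) * (a (fst p) * b'' (snd p)))" (is "?L = ?R")
  proof -
    have "?L = integral {0..2*T} (\<lambda>x. integral {-T..T} (\<lambda>t. utt x t * (a x * b t)))"
      unfolding Q_def by (subst integral_prod_continuous) (auto simp: Q_def[symmetric] intro!: ci)
    also have "\<dots> = integral {0..2*T} (\<lambda>x. integral {-T..T} (\<lambda>t. u x t * (a x * b'' t)))"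
    proof (rule integral_cong)
      fix x assume x: "x \<in> {0..2*T}"
      have "continuous_on {-T..T} (\<lambda>t. (\<lambda>p. utt (fst p) (snd p)) (x, t))"
        by (rule continuous_on_compose2[OF cQ(3)]) (use x in \<open>auto simp: Q intro!: continuous_intros\<close>)
      then have "(\<lambda>t. utt x t * b t) integrable_on {-T..T}"
        by (intro integrable_continuous_interval continuous_intros ca) auto
      then have "integral {-T..T} (\<lambda>t. utt x t * b t) = integral {-T..T} (\<lambda>t. u x t * b'' t)"
        using T ut utt db x by (intro by_parts_twice[where f' = "\<lambda>t. ut x t" and w' = b']) (auto simp: zero)
      then show "integral {-T..T} (\<lambda>t. utt x t * (a x * b t)) = integral {-T..T} (\<lambda>t. u x t * (a x * b'' t))"
        by (simp add: mult.left_commute)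
    qed
    also have "\<dots> = ?R"
      unfolding Q_def by (subst integral_prod_continuous) (auto simp: Q_def[symmetric] intro!: ci)
    finally show ?thesis .
  qed
  have a0: "0 \<le> a x" "0 \<le> b x" for x by (auto simp: a_def b_def)
  have x1: "0 \<le> 2*T*x - x\<^sup>2" "2*T*x - x\<^sup>2 \<le> T\<^sup>2" if "x \<in> {0..2*T}" for x
    using that mult_nonneg_nonneg[of x "2*T-x"] zero_le_power2[of "T-x"]
    by (auto simp: power2_eq_square algebra_simps)
  have t1: "0 \<le> T\<^sup>2 - t\<^sup>2" "T\<^sup>2 - t\<^sup>2 \<le> T\<^sup>2" if "t \<in> {-T..T}" for t
    using that by (auto simp: abs_le_square_iff[symmetric])
  have aT: "a x \<le> T^4" "\<bar>a'' x\<bar> \<le> 12 * T\<^sup>2" if "x \<in> {0..2*T}" for x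
  proof -
    show "a x \<le> T^4" using power_mono[OF x1(2)[OF that] x1(1)[OF that], of 2] by (simp add: a_def)
    have "(2*T-2*x)\<^sup>2 \<le> (2*T)\<^sup>2" using that by (intro abs_le_square_iff[THEN iffD1]) auto
    then have "(2*T-2*x)\<^sup>2 \<le> 4 * T\<^sup>2" by (simp add: power_mult_distrib)
    moreover have "0 \<le> (2*T-2*x)\<^sup>2" by simp
    moreover have "\<bar>2 * P - 4 * Z\<bar> \<le> 12 * S" if "P \<le> 4 * S" "0 \<le> P" "0 \<le> Z" "Z \<le> S" for P Z S :: real
      using that by linarith
    ultimately show "\<bar>a'' x\<bar> \<le> 12 * T\<^sup>2" using x1[OF that] unfolding a''_def by blast
  qed
  have bT: "b t \<le> T^4" "\<bar>b'' t\<bar> \<le> 8 * T\<^sup>2" if "t \<in> {-T..T}" for t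
  proof -
    show "b t \<le> T^4" using power_mono[OF t1(2)[OF that] t1(1)[OF that], of 2] by (simp add: b_def)
    show "\<bar>b'' t\<bar> \<le> 8 * T\<^sup>2" using t1[OF that] 
      unfolding b''_def by (intro abs_leI) (simp_all add: add_increasing2 neg_le_iff_le order_trans[OF _ zero_le_power2])
  qed
  have B: "0 \<le> B" using uB[of 0 0] T by auto
  let ?W = "\<lambda>p. a (fst p) * b (snd p)"
  let ?h = "\<lambda>p. h (fst p) (snd p)"
  \<comment> \<open>On the inner box a is at least (T^2/2)^2 and b at least (3 T^2/4)^2; the product
    of 1/4 and 9/16 is 9/64.\<close>
  have "9/64 * T^8 * integral Q' ?h = integral Q' (\<lambda>p. 9/64 * T^8 * ?h p)"
    by simp
  also have "\<dots> \<le> integral Q' (\<lambda>p. ?h p * ?W p)"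
  proof (rule integral_le)
    show "(\<lambda>p. 9/64 * T^8 * ?h p) integrable_on Q'" "(\<lambda>p. ?h p * ?W p) integrable_on Q'"
      by (intro integ' ci)+
    fix p assume p: "p \<in> Q'"
    then obtain x t where pp: "p = (x,t)" "x \<in> {T/2..T}" "t \<in> {-T/2..T/2}" by (auto simp: Q')
    have "(T/2) * T \<le> x * (2*T - x)" using pp T by (intro mult_mono) auto
    then have "T\<^sup>2/2 \<le> 2*T*x - x\<^sup>2" by (simp add: power2_eq_square algebra_simps)
    from power_mono[OF this, of 2] have a1: "T^4/4 \<le> a x" by (simp add: a_def power_divide)
    have "t\<^sup>2 \<le> (T/2)\<^sup>2" using pp T by (intro abs_le_square_iff[THEN iffD1]) auto
    then have "3/4 * T\<^sup>2 \<le> T\<^sup>2 - t\<^sup>2" by (simp add: power_divide)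
    from power_mono[OF this, of 2] have b1: "9/16 * T^4 \<le> b t"
      by (simp add: b_def power_divide power_mult_distrib)
    have "(T^4/4) * (9/16 * T^4) \<le> a x * b t" using a1 b1 T by (intro mult_mono) (auto simp: a0)
    moreover have "(T^4/4) * (9/16 * T^4) = 9/64 * T^8" unfolding T8(1)[symmetric] by (simp only: mult_ac times_divide_eq_left times_divide_eq_right)
    ultimately have "9/64 * T^8 \<le> a x * b t" by (simp only:)
    moreover have "0 \<le> h x t" using h0 pp T by auto
    ultimately show "9/64 * T^8 * ?h p \<le> ?h p * ?W p"
      using mult_left_mono[of "9/64 * T^8" "a x * b t" "h x t"] by (simp add: pp mult_ac)
  qed
  also have "\<dots> \<le> integral Q (\<lambda>p. ?h p * ?W p)"
  proof (rule integral_subset_le[OF QQ])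
    show "(\<lambda>p. ?h p * ?W p) integrable_on Q'" by (intro integ' ci)
    show "(\<lambda>p. ?h p * ?W p) integrable_on Q" by (intro integ ci)
  qed (auto simp: Q intro!: mult_nonneg_nonneg h0 a0)
  also have "\<dots> \<le> integral Q (\<lambda>p. M * ?W p + 1/2 * (uxx (fst p) (snd p) * ?W p) + 1/2 * (utt (fst p) (snd p) * ?W p))"
  proof (rule integral_le)
    fix p assume "p \<in> Q"
    then have "?h p * ?W p \<le> (M + (uxx (fst p) (snd p) + utt (fst p) (snd p)) / 2) * ?W p"
      by (intro mult_right_mono hM mult_nonneg_nonneg a0) (auto simp: Q)
    then show "?h p * ?W p \<le> M * ?W p + 1/2 * (uxx (fst p) (snd p) * ?W p) + 1/2 * (utt (fst p) (snd p) * ?W p)"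
      by (simp add: algebra_simps add_divide_distrib)
  qed (intro integ ci)+
  also have "\<dots> = integral Q (\<lambda>p. M * ?W p) + 1/2 * integral Q (\<lambda>p. uxx (fst p) (snd p) * ?W p)
      + 1/2 * integral Q (\<lambda>p. utt (fst p) (snd p) * ?W p)"
    by (subst integral_add integral_mult_right; (intro integ ci)?)+ simp
  also have "\<dots> = integral Q (\<lambda>p. M * ?W p + 1/2 * (u (fst p) (snd p) * (a'' (fst p) * b (snd p)))
      + 1/2 * (u (fst p) (snd p) * (a (fst p) * b'' (snd p))))"
    unfolding I1 I2
    by (subst integral_add integral_mult_right; (intro integ ci)?)+ simp
  \<comment> \<open>The second derivatives of the weight are at most 12 T^6 and 8 T^6; half of their
    sum gives the 10.\<close>
  also have "\<dots> \<le> integral Q (\<lambda>p. M * T^8 + 10 * B * T^6)"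
  proof (rule integral_le)
    fix p assume "p \<in> Q"
    then obtain x t where pp: "p = (x,t)" "x \<in> {0..2*T}" "t \<in> {-T..T}" by (auto simp: Q)
    have "a x * b t \<le> T^4 * T^4" using aT bT a0 pp by (intro mult_mono) auto
    then have 1: "a x * b t \<le> T^8" unfolding T8 .
    have "\<bar>a'' x\<bar> * b t \<le> (12*T\<^sup>2) * T^4" using aT bT a0 pp by (intro mult_mono) auto
    then have 2: "\<bar>a'' x * b t\<bar> \<le> 12 * T^6" using a0[of t] by (simp only: abs_mult abs_of_nonneg mult.assoc T8)
    have "a x * \<bar>b'' t\<bar> \<le> T^4 * (8*T\<^sup>2)" using aT bT a0 pp by (intro mult_mono) auto
    then have 3: "\<bar>a x * b'' t\<bar> \<le> 8 * T^6" using a0[of x] by (simp only: abs_mult abs_of_nonneg mult.left_commute[of "T^4"] T8)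
    have "\<bar>a'' x * b t + a x * b'' t\<bar> \<le> 20 * T^6"
      using 2 3 abs_triangle_ineq[of "a'' x * b t" "a x * b'' t"] by linarith
    then have "\<bar>u x t\<bar> * \<bar>a'' x * b t + a x * b'' t\<bar> \<le> B * (20 * T^6)"
      using uB pp B by (intro mult_mono) auto
    then have "u x t * (a'' x * b t + a x * b'' t) \<le> 20 * B * T^6"
      unfolding abs_mult[symmetric] by linarith
    moreover have "M * (a x * b t) \<le> M * T^8"
      by (rule mult_left_mono[OF 1 M])
    ultimately show "M * ?W p + 1/2 * (u (fst p) (snd p) * (a'' (fst p) * b (snd p)))
      + 1/2 * (u (fst p) (snd p) * (a (fst p) * b'' (snd p))) \<le> M * T^8 + 10 * B * T^6"
      unfolding pp fst_conv snd_conv by (simp add: algebra_simps)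
  qed (intro integ ci)+
  also have "\<dots> = (4 * T\<^sup>2) * (M * T^8 + 10 * B * T^6)"
    using T unfolding Q_def by (simp add: content_Pair power2_eq_square)
  also have "\<dots> = T^8 * (4 * M * T\<^sup>2 + 40 * B)"
    unfolding T8(5)[symmetric] by (simp only: algebra_simps)
  finally have "9/64 * T^8 * integral Q' ?h \<le> T^8 * (4 * M * T\<^sup>2 + 40 * B)" .
  then have "T^8 * (9/64 * integral Q' ?h) \<le> T^8 * (4 * M * T\<^sup>2 + 40 * B)"
    by (simp only: mult_ac)
  then have "9/64 * integral Q' ?h \<le> 4 * M * T\<^sup>2 + 40 * B"
    using T by (subst (asm) mult_le_cancel_left_pos) auto
  then have "integral Q' ?h \<le> 64/9 * (4 * M * T\<^sup>2 + 40 * B)"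
    by (simp add: field_simps)
  \<comment> \<open>Rounding 64/9 up to 8 produces the 32 and 320 of the statement.\<close>
  also have "\<dots> \<le> 8 * (4 * M * T\<^sup>2 + 40 * B)"
    using M B by (intro mult_right_mono add_nonneg_nonneg) auto
  finally have "integral Q' ?h \<le> 32 * M * T\<^sup>2 + 320 * B" by simp
  moreover have "integral Q' ?h = integral {T/2..T} (\<lambda>x. integral {-T/2..T/2} (\<lambda>t. h x t))"
  proof -
    have "continuous_on Q' ?h" by (rule continuous_on_subset[OF _ QQ], intro ci)
    then show ?thesis unfolding Q'_def by (subst integral_prod_continuous) auto
  qed
  ultimately show ?thesis by simp
qed

text \<open>The substitution t = x y, which passes from slopes to heights on the slice of the cone
  at abscissa x.\<close>

lemma integral_stretch_symmetric:
  fixes f :: "real \<Rightarrow> real"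
  assumes "0 < x" and "f integrable_on {-(x*c)..x*c}"
  shows "integral {-c..c} (\<lambda>y. f (x * y)) = integral {-(x*c)..x*c} f / x"
proof -
  have "((\<lambda>y. f (x * y + 0)) has_integral (1/\<bar>x\<bar>^DIM(real)) *\<^sub>R integral {-(x*c)..x*c} f)
     ((\<lambda>y. (1/x) *\<^sub>R y + -((1/x) *\<^sub>R 0)) ` cbox (-(x*c)) (x*c))"
    using has_integral_affinity[of f "integral {-(x*c)..x*c} f" "-(x*c)" "x*c" x 0] assms
    by (simp add: integrable_integral)
  moreover have "(\<lambda>y. (1/x) *\<^sub>R y + -((1/x) *\<^sub>R 0)) ` cbox (-(x*c)) (x*c) = {-c..c}"
    using assms image_divide_atLeastAtMost[of x "-(x*c)" "x*c"] by simp
  ultimately show ?thesis using assms by (simp add: integral_unique)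
qed

text \<open>The geometric series of ratio 2^(-\<alpha>/2) over the dyadic slabs, times the constant
  1001 of a single slab.\<close>

definition cone_const :: "real \<Rightarrow> real" where
  "cone_const \<alpha> = 1001 / (1 - (1/2) powr (\<alpha>/2))"

lemma cone_const_pos: "0 < \<alpha> \<Longrightarrow> 0 < cone_const \<alpha>"
  unfolding cone_const_def using powr_less_mono2[of "\<alpha>/2" "1/2" 1] by simp

text \<open>AM-GM with a free parameter: the right-hand side is linear in a, so it can be
  integrated, and l can be adapted to the size of the integral.\<close>

lemma sqrt_le_linear:
  fixes a l :: real
  assumes "0 \<le> a" "0 < l"
  shows "sqrt a \<le> l/2 + a / (2*l)"
proof -
  have "0 \<le> (sqrt a - l)\<^sup>2" by simp
  then have "2 * l * sqrt a \<le> l\<^sup>2 + a" using assms by (simp add: power2_diff algebra_simps)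
  then show ?thesis using assms by (simp add: field_simps power2_eq_square)
qed

text \<open>At distance T from the vertex the cone lies in the inner box of
  \<open>box_energy\<close>, whose energy is of order M T^\<alpha>. The rays stop at x = 1/2
  although u lives up to x = 1, because the box of size T = 1/2 reaches 2 T = 1. A single M bounds
  both the background term and the Hoelder constant.\<close>

lemma cone_average:
  fixes u ux uxx ut utt h :: "real \<Rightarrow> real \<Rightarrow> real" and \<alpha> M :: real
  defines "Q \<equiv> {0..1} \<times> {-1/2..1/2}"
  assumes ux: "\<And>x t. x \<in> {0..1} \<Longrightarrow> t \<in> {-1/2..1/2} \<Longrightarrow> ((\<lambda>x. u x t) has_real_derivative ux x t) (at x)"
    and uxx: "\<And>x t. x \<in> {0..1} \<Longrightarrow> t \<in> {-1/2..1/2} \<Longrightarrow> ((\<lambda>x. ux x t) has_real_derivative uxx x t) (at x)"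
    and ut: "\<And>x t. x \<in> {0..1} \<Longrightarrow> t \<in> {-1/2..1/2} \<Longrightarrow> ((\<lambda>t. u x t) has_real_derivative ut x t) (at t)"
    and utt: "\<And>x t. x \<in> {0..1} \<Longrightarrow> t \<in> {-1/2..1/2} \<Longrightarrow> ((\<lambda>t. ut x t) has_real_derivative utt x t) (at t)"
    and cont: "continuous_on Q (\<lambda>(x,t). u x t)" "continuous_on Q (\<lambda>(x,t). uxx x t)"
      "continuous_on Q (\<lambda>(x,t). utt x t)" "continuous_on Q (\<lambda>(x,t). h x t)"
    and h0: "\<And>x t. x \<in> {0..1} \<Longrightarrow> t \<in> {-1/2..1/2} \<Longrightarrow> 0 \<le> h x t"
    and hM: "\<And>x t. x \<in> {0..1} \<Longrightarrow> t \<in> {-1/2..1/2} \<Longrightarrow> h x t \<le> M + (uxx x t + utt x t) / 2"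
    and holder: "\<And>x t. x \<in> {0..1} \<Longrightarrow> t \<in> {-1/2..1/2} \<Longrightarrow> \<bar>u x t - u 0 0\<bar> \<le> M * (x + \<bar>t\<bar>) powr \<alpha>"
    and M: "0 < M" and \<alpha>: "0 < \<alpha>" "\<alpha> \<le> 1"
  shows "integral {-1/2..1/2} (\<lambda>y. integral {0..1/2} (\<lambda>x. sqrt (h x (x * y)))) \<le> cone_const \<alpha> * sqrt M"
proof -
  have ch: "continuous_on S (\<lambda>p. h (f p) (g p))" 
    if "continuous_on S f" "continuous_on S g" "\<And>p. p \<in> S \<Longrightarrow> f p \<in> {0..1} \<and> g p \<in> {-1/2..1/2}"
    for S :: "'s::topological_space set" and f g
    using continuous_on_compose2[OF cont(4)[unfolded case_prod_beta], of S "\<lambda>p. (f p, g p)"] that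
    by (fastforce simp: Q_def intro!: continuous_intros)
  have xy: "x * y \<in> {-1/2..1/2}" if "x \<in> {0..1}" "y \<in> {-1/2..1/2}" for x y :: real
  proof -
    have "\<bar>x * y\<bar> \<le> 1 * (1/2)" unfolding abs_mult using that by (intro mult_mono) auto
    then show ?thesis by auto
  qed
  \<comment> \<open>Subtracting u 0 0 changes no derivative and makes the Hoelder bound a bound of
    the size. On the box x + |t| is at most 3 T, and 3^\<alpha> is at most 3; together 32 + 320 * 3
    is below 1000.\<close>
  have scale: "integral {T/2..T} (\<lambda>x. integral {-T/2..T/2} (\<lambda>t. h x t)) \<le> 1000 * M * T powr \<alpha>"
    if T: "0 < T" "T \<le> 1/2" for T
  proof -
    have sub: "{0..2*T} \<times> {-T..T} \<subseteq> Q" using T by (auto simp: Q_def)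
    have "integral {T/2..T} (\<lambda>x. integral {-T/2..T/2} (\<lambda>t. h x t)) \<le> 32 * M * T\<^sup>2 + 320 * (3 * M * T powr \<alpha>)"
    proof (rule box_energy[where u = "\<lambda>x t. u x t - u 0 0" and ux = ux and uxx = uxx and ut = ut and utt = utt])
      fix x t assume xt: "x \<in> {0..2*T}" "t \<in> {-T..T}"
      then have xt': "x \<in> {0..1}" "t \<in> {-1/2..1/2}" using T by auto
      show "((\<lambda>x. u x t - u 0 0) has_real_derivative ux x t) (at x)"
        using DERIV_diff[OF ux[OF xt'] DERIV_const] by simp
      show "((\<lambda>t. u x t - u 0 0) has_real_derivative ut x t) (at t)"
        using DERIV_diff[OF ut[OF xt'] DERIV_const] by simp
      have "\<bar>u x t - u 0 0\<bar> \<le> M * (x + \<bar>t\<bar>) powr \<alpha>" by (rule holder[OF xt'])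
      also have "\<dots> \<le> M * (3 * T) powr \<alpha>" using xt T M \<alpha> by (intro mult_left_mono powr_mono2) auto
      also have "\<dots> = M * (3 powr \<alpha> * T powr \<alpha>)" using T by (simp add: powr_mult)
      also have "\<dots> \<le> M * (3 powr 1 * T powr \<alpha>)" using T \<alpha> M
        by (intro mult_left_mono mult_right_mono powr_mono) auto
      finally show "\<bar>u x t - u 0 0\<bar> \<le> 3 * M * T powr \<alpha>" by simp
    next
      show "continuous_on ({0..2*T} \<times> {-T..T}) (\<lambda>(x, t). u x t - u 0 0)"
        unfolding case_prod_beta
        by (intro continuous_on_diff continuous_on_const continuous_on_subset[OF cont(1)[unfolded case_prod_beta] sub])
    qed (use T M h0 hM uxx utt in \<open>auto intro: continuous_on_subset[OF cont(2) sub]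
          continuous_on_subset[OF cont(3) sub] continuous_on_subset[OF cont(4) sub]\<close>)
    also have "T\<^sup>2 \<le> T powr \<alpha>"
      using T \<alpha> powr_mono'[of \<alpha> 2 T] by (simp add: powr_numeral)
    then have "32 * M * T\<^sup>2 + 320 * (3 * M * T powr \<alpha>) \<le> 32 * M * T powr \<alpha> + 320 * (3 * M * T powr \<alpha>)"
      using M by simp
    also have "\<dots> \<le> 1000 * M * T powr \<alpha>" using M by (simp add: algebra_simps)
    finally show ?thesis .
  qed
  \<comment> \<open>Slopes are integrated first, because the dyadic pieces cut the x axis. Fubini
    restores the order of the statement at the end.\<close>
  define G where "G x = integral {-1/2..1/2} (\<lambda>y. sqrt (h x (x * y)))" for x
  have csq: "continuous_on ({0..1/2} \<times> {-1/2..1/2}) (\<lambda>p. sqrt (h (fst p) (fst p * snd p)))"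
    by (intro continuous_intros ch) (use xy in \<open>auto simp: mem_Times_iff\<close>)
  have cG: "continuous_on {0..1/2} G"
    unfolding G_def using integral_continuous_on_param[of "{0..1/2}" "-1/2" "1/2" "\<lambda>x y. sqrt (h x (x*y))"] csq
    by (simp add: case_prod_beta)
  have iG: "G integrable_on {a..b}" if "0 \<le> a" "b \<le> 1/2" for a b
    using that by (intro integrable_continuous_interval continuous_on_subset[OF cG]) auto
  have piece: "integral {T/2..T} G \<le> 1001 * sqrt M * T powr (\<alpha>/2)" if T: "0 < T" "T \<le> 1/2" for T
  proof -
    \<comment> \<open>The optimal parameter in the AM-GM inequality, which replaces Cauchy-Schwarz here.\<close>
    define l where "l = sqrt M * T powr (\<alpha>/2 - 1)"
    have l: "0 < l" using T M by (simp add: l_def)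
    define J where "J x = integral {-T/2..T/2} (\<lambda>t. h x t)" for x
    have "continuous_on {T/2..T} J"
    proof -
      have "continuous_on ({T/2..T} \<times> {-T/2..T/2}) (\<lambda>p. h (fst p) (snd p))"
        using T by (intro ch continuous_intros) auto
      then show ?thesis
        unfolding J_def using integral_continuous_on_param[of "{T/2..T}" "-T/2" "T/2" h]
        by (simp add: case_prod_beta)
    qed
    then have iJ: "J integrable_on {T/2..T}" by (rule integrable_continuous_interval)
    \<comment> \<open>AM-GM is integrated over y, an interval of length 1. The slice |t| <= x/2 is
      enlarged to |t| <= T/2 since h is nonnegative, and the factor 1/x from the substitution is at
      most 2/T.\<close>
    have "G x \<le> l/2 + J x / (l * T)" if x: "x \<in> {T/2..T}" for x
    proof -
      have x1: "x \<in> {0..1}" "0 < x" using x T by auto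
      have hi: "(\<lambda>t. h x t) integrable_on {a..b}" if "-1/2 \<le> a" "b \<le> 1/2" for a b
        using that x1 by (intro integrable_continuous_interval ch continuous_intros) auto
      have hi2: "(\<lambda>y. h x (x*y)) integrable_on {-1/2..1/2}"
        using xy x1 by (intro integrable_continuous_interval ch continuous_intros) auto
      have "G x \<le> integral {-1/2..1/2} (\<lambda>y. l/2 + h x (x*y) * (1/(2*l)))"
        unfolding G_def
      proof (rule integral_le)
        show "(\<lambda>y. sqrt (h x (x * y))) integrable_on {-1/2..1/2}"
          using xy x1 by (intro integrable_continuous_interval ch continuous_intros) auto
        show "(\<lambda>y. l/2 + h x (x*y) * (1/(2*l))) integrable_on {-1/2..1/2}"
          using xy x1 by (intro integrable_continuous_interval continuous_on_add continuous_on_mult ch continuous_intros) auto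
        show "sqrt (h x (x * y)) \<le> l/2 + h x (x*y) * (1/(2*l))" if "y \<in> {-1/2..1/2}" for y
          using sqrt_le_linear[OF h0[OF x1(1) xy[OF x1(1) that]] l] by simp
      qed
      also have "\<dots> = l/2 + integral {-1/2..1/2} (\<lambda>y. h x (x*y)) * (1/(2*l))"
        by (subst integral_add) (use hi2 l in auto)
      also have "integral {-1/2..1/2} (\<lambda>y. h x (x*y)) = integral {-(x*(1/2))..x*(1/2)} (h x) / x"
        using integral_stretch_symmetric[of x "h x" "1/2"] x1 hi[of "-(x*(1/2))" "x*(1/2)"] by simp
      also have "integral {-(x*(1/2))..x*(1/2)} (h x) \<le> J x"
        unfolding J_def using x T x1 by (intro integral_subset_le hi) (auto intro!: h0)
      also have "J x / x \<le> J x / (T/2)"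
        unfolding J_def using x T x1 by (intro divide_left_mono integral_nonneg hi h0) auto
      finally show ?thesis using l x1 by (simp add: divide_right_mono field_simps)
    qed
    then have "integral {T/2..T} G \<le> integral {T/2..T} (\<lambda>x. l/2 + J x * (1/(l * T)))"
      using T by (intro integral_le iG integrable_add integrable_on_mult_left iJ) auto
    also have "\<dots> = l * T / 4 + integral {T/2..T} J * (1/(l * T))"
      using T by (subst integral_add) (use iJ l in auto)
    also have "\<dots> \<le> l * T / 4 + (1000 * M * T powr \<alpha>) * (1/(l * T))"
      using scale[OF T] l T unfolding J_def by (intro add_left_mono mult_right_mono) auto
    \<comment> \<open>With this l both terms are multiples of sqrt M * T^(\<alpha>/2), with factors
      1/4 and 1000; hence the 1001.\<close>
    also have "l * T = sqrt M * T powr (\<alpha>/2)" using T by (simp add: l_def powr_diff)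
    also have "1000 * M * T powr \<alpha> = 1000 * (sqrt M * T powr (\<alpha>/2)) * (sqrt M * T powr (\<alpha>/2))"
      using M T powr_add[of T "\<alpha>/2" "\<alpha>/2"] by simp
    also have "sqrt M * T powr (\<alpha>/2) / 4 + 1000 * (sqrt M * T powr (\<alpha>/2)) * (sqrt M * T powr (\<alpha>/2)) * (1 / (sqrt M * T powr (\<alpha>/2)))
       = (1/4 + 1000) * (sqrt M * T powr (\<alpha>/2))" using M T by (simp add: field_simps)
    also have "\<dots> \<le> 1001 * (sqrt M * T powr (\<alpha>/2))" using M by (intro mult_right_mono) auto
    finally show ?thesis by simp
  qed
  define r :: real where "r = (1/2) powr (\<alpha>/2)"
  have r: "0 < r" "r < 1" using \<alpha> using powr_less_mono2[of "\<alpha>/2" "1/2" 1] by (auto simp: r_def)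
  \<comment> \<open>The slab ending at T = (1/2)^(k+1) is charged r^k instead of r^(k+1), so that
    the series starts with 1.\<close>
  have iter: "integral {0..1/2} G \<le> integral {0..(1/2)^(Suc k)} G + 1001 * sqrt M * (\<Sum>j<k. r^j)" for k
  proof (induction k)
    case (Suc k)
    define T :: real where "T = (1/2)^Suc k"
    have T: "0 < T" "T \<le> 1/2" by (auto simp: T_def power_le_one)
    have "integral {0..T} G = integral {0..T/2} G + integral {T/2..T} G"
      using T by (intro Henstock_Kurzweil_Integration.integral_combine[symmetric] iG) auto
    also have "integral {T/2..T} G \<le> 1001 * sqrt M * T powr (\<alpha>/2)" by (rule piece[OF T])
    also have "T powr (\<alpha>/2) \<le> r^k"
    proof -
      have "T powr (\<alpha>/2) \<le> ((1/2)^k) powr (\<alpha>/2)" using \<alpha> by (intro powr_mono2) (auto simp: T_def)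
      also have "\<dots> = r^k" by (simp add: r_def powr_power powr_powr mult.commute flip: powr_realpow)
      finally show ?thesis .
    qed
    finally have "integral {0..T} G \<le> integral {0..T/2} G + 1001 * sqrt M * r^k" using M by simp
    with Suc show ?case by (simp add: T_def algebra_simps)
  qed simp
  \<comment> \<open>Finitely many slabs never reach the vertex. The remainder near x = 0 tends to 0
    by continuity of the indefinite integral.\<close>
  have "continuous_on {0..1/2} (\<lambda>x. integral {0..x} G)"
    by (rule indefinite_integral_continuous_1) (rule iG, auto)
  then have "((\<lambda>x. integral {0..x} G) \<longlongrightarrow> integral {0..0} G) (at 0 within {0..1/2})"
    unfolding continuous_on_def by (rule bspec) simp
  moreover have "filterlim (\<lambda>k. (1/2::real)^Suc k) (at 0 within {0..1/2}) sequentially"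
    unfolding filterlim_at using LIMSEQ_Suc[OF LIMSEQ_power_zero[of "1/2::real"]]
    by (auto simp: power_le_one)
  ultimately have lim: "(\<lambda>k. integral {0..(1/2)^Suc k} G) \<longlonglongrightarrow> 0"
    using filterlim_compose by fastforce
  have bnd: "integral {0..1/2} G \<le> integral {0..(1/2)^(Suc k)} G + cone_const \<alpha> * sqrt M" for k
  proof -
    have "(\<Sum>j<k. r^j) \<le> 1 / (1 - r)"
      using r by (simp add: sum_gp_strict field_simps)
    then have "1001 * sqrt M * (\<Sum>j<k. r^j) \<le> 1001 * sqrt M * (1/(1-r))"
      using M by (intro mult_left_mono) auto
    then show ?thesis using iter[of k] by (simp add: cone_const_def r_def)
  qed
  have "integral {0..1/2} G \<le> 0 + cone_const \<alpha> * sqrt M"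
    by (rule LIMSEQ_le_const[OF tendsto_add[OF lim tendsto_const]]) (use bnd in auto)
  moreover have "integral {-1/2..1/2} (\<lambda>y. integral {0..1/2} (\<lambda>x. sqrt (h x (x * y)))) = integral {0..1/2} G"
    unfolding G_def using integral_swap_continuous[of 0 "-1/2" "1/2" "1/2" "\<lambda>x y. sqrt (h x (x*y))"] csq
    by (simp add: case_prod_beta cbox_Pair_eq)
  ultimately show ?thesis by simp
qed

section \<open>Smooth functions and the complex Hessian\<close>

lemma C_k_on_subset: "C_k_on k S f \<Longrightarrow> T \<subseteq> S \<Longrightarrow> C_k_on k T f"
  by (induction k arbitrary: f) (auto intro: continuous_on_subset)

lemma C_k_on_cong_open:
  assumes "open S" "\<And>x. x \<in> S \<Longrightarrow> f x = g x" "C_k_on k S f"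
  shows "C_k_on k S g"
  using assms(2,3)
proof (induction k arbitrary: f g)
  case 0
  then show ?case by (metis C_k_on.simps(1) continuous_on_cong)
next
  case (Suc k)
  have d: "(g has_derivative frechet_derivative f (at x)) (at x)" if "x \<in> S" for x
    using Suc.prems that assms(1)
    by (auto intro: has_derivative_transform_within_open simp: frechet_derivative_works)
  then have "frechet_derivative f (at x) v = frechet_derivative g (at x) v" if "x \<in> S" for x v
    using frechet_derivative_at that by metis
  then have "C_k_on k S (\<lambda>x. frechet_derivative g (at x) v)" for v
    using Suc.IH[of "\<lambda>x. frechet_derivative f (at x) v" "\<lambda>x. frechet_derivative g (at x) v"] Suc.prems by auto
  with d show ?case by (auto simp: differentiable_def)
qed

lemma C_k_on_local:
  assumes "open S" "\<And>x. x \<in> S \<Longrightarrow> \<exists>U. open U \<and> x \<in> U \<and> C_k_on k (S \<inter> U) f"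
  shows "C_k_on k S f"
  using assms(2)
proof (induction k arbitrary: f)
  case 0
  have "isCont f x" if "x \<in> S" for x
    using 0[OF that] that assms(1) continuous_on_eq_continuous_at[of "S \<inter> _"] by fastforce
  then show ?case by (simp add: continuous_at_imp_continuous_on)
next
  case (Suc k)
  have "f differentiable at x" if "x \<in> S" for x
    using Suc.prems[OF that] that by auto
  moreover have "C_k_on k S (\<lambda>x. frechet_derivative f (at x) v)" for v
  proof (rule Suc.IH)
    fix x assume "x \<in> S"
    then show "\<exists>U. open U \<and> x \<in> U \<and> C_k_on k (S \<inter> U) (\<lambda>x. frechet_derivative f (at x) v)"
      using Suc.prems[of x] by auto
  qed
  ultimately show ?case by auto
qed

text \<open>On an open set the function serves as its own local extension, so its derivatives of all
  orders become available at the points of the set.\<close>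

lemma smooth_on_open_iff:
  assumes "open S"
  shows "smooth_on S f \<longleftrightarrow> (\<forall>k. C_k_on k S f)"
proof
  assume sm: "smooth_on S f"
  show "\<forall>k. C_k_on k S f"
  proof (intro allI C_k_on_local[OF assms])
    fix k x assume "x \<in> S"
    with sm obtain U F where U: "open U" "x \<in> U" "C_k_on k U F" "\<forall>y\<in>S \<inter> U. F y = f y"
      unfolding smooth_on_def by metis
    have "C_k_on k (S \<inter> U) f"
      using U assms by (intro C_k_on_cong_open[of "S \<inter> U" F f] C_k_on_subset[OF U(3)]) auto
    with U show "\<exists>U. open U \<and> x \<in> U \<and> C_k_on k (S \<inter> U) f" by auto
  qed
next
  assume "\<forall>k. C_k_on k S f"
  with assms show "smooth_on S f" unfolding smooth_on_def by blast
qed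

lemma C_k_on_const: "C_k_on k S (\<lambda>x. c)"
  by (induction k arbitrary: c) auto

text \<open>The curves constructed below are segments in charts. Their first derivative is constant,
  which ends the recursion in \<open>C_k_on\<close>.\<close>

lemma smooth_on_affine:
  fixes a w :: "'b::real_normed_vector"
  shows "smooth_on S (\<lambda>t::real. a + t *\<^sub>R w)"
proof -
  have d: "((\<lambda>t::real. a + t *\<^sub>R w) has_derivative (\<lambda>t. t *\<^sub>R w)) (at t)" for t
    by (auto intro!: derivative_eq_intros)
  have "C_k_on k UNIV (\<lambda>t::real. a + t *\<^sub>R w)" for k
  proof (cases k)
    case 0
    then show ?thesis by (auto intro!: continuous_intros)
  next
    case (Suc j)
    have "frechet_derivative (\<lambda>t::real. a + t *\<^sub>R w) (at t) v = v *\<^sub>R w" for t v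
      using frechet_derivative_at[OF d] by metis
    then show ?thesis using Suc d by (auto simp: C_k_on_const differentiable_def)
  qed
  then show ?thesis unfolding smooth_on_def by (intro ballI exI[of _ UNIV] exI[of _ "\<lambda>t. a + t *\<^sub>R w"]) auto
qed

lemma C_k_on_cont: "C_k_on k S f \<Longrightarrow> open S \<Longrightarrow> continuous_on S f"
  by (cases k) (auto intro!: continuous_at_imp_continuous_on differentiable_imp_continuous_within)

section \<open>The complex Hessian as a Laplacian along complex lines\<close>

definition dir2 :: "('a::euclidean_space \<Rightarrow> real) \<Rightarrow> 'a \<Rightarrow> 'a \<Rightarrow> 'a \<Rightarrow> real" where
  "dir2 h z w w' = frechet_derivative (\<lambda>y. frechet_derivative h (at y) w') (at z) w"

text \<open>In the first direction this is linearity of the outer derivative. In the second,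
  linearity of the inner derivative holds on the whole open set and can therefore be
  differentiated.\<close>

lemma dir2_bilinear:
  fixes h :: "'a::euclidean_space \<Rightarrow> real"
  assumes "open S" "C_k_on 2 S h" "z \<in> S"
  shows "bilinear (dir2 h z)"
proof -
  have dh: "h differentiable at y" if "y \<in> S" for y
    using assms(2) that by (simp add: numeral_2_eq_2)
  have d2: "(\<lambda>y. frechet_derivative h (at y) w) differentiable at z" for w
    using assms(2,3) by (simp add: numeral_2_eq_2)
  note d2' = d2[unfolded frechet_derivative_works]
  have "dir2 h z w (a + b) = dir2 h z w a + dir2 h z w b" for w a b
  proof -
    have "((\<lambda>y. frechet_derivative h (at y) (a + b)) has_derivative
       (\<lambda>w. dir2 h z w a + dir2 h z w b)) (at z)"
      unfolding dir2_def
      by (rule has_derivative_transform_within_open[OF has_derivative_add[OF d2'[of a] d2'[of b]] assms(1,3)])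
         (simp only: linear_add[OF linear_frechet_derivative[OF dh]])
    from fun_cong[OF frechet_derivative_at[OF this], of w] show ?thesis by (simp add: dir2_def)
  qed
  moreover have "dir2 h z w (c *\<^sub>R a) = c *\<^sub>R dir2 h z w a" for w a c
  proof -
    have "((\<lambda>y. frechet_derivative h (at y) (c *\<^sub>R a)) has_derivative (\<lambda>w. c *\<^sub>R dir2 h z w a)) (at z)"
      unfolding dir2_def
      by (rule has_derivative_transform_within_open[OF has_derivative_scaleR_right[OF d2'[of a]] assms(1,3)])
         (simp only: linear_cmul[OF linear_frechet_derivative[OF dh]])
    from fun_cong[OF frechet_derivative_at[OF this], of w] show ?thesis by (simp add: dir2_def)
  qed
  ultimately show ?thesis
    unfolding bilinear_def using linear_frechet_derivative[OF d2] by (auto simp: dir2_def intro!: linearI)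
qed

lemma complex_vec_expand:
  fixes v :: "complex ^ 'n::finite"
  shows "v = (\<Sum>k\<in>UNIV. Re (v $ k) *\<^sub>R axis k 1 + Im (v $ k) *\<^sub>R axis k \<i>)"
proof -
  have "(\<Sum>k\<in>UNIV. (Re (v $ k) *\<^sub>R axis k 1 + Im (v $ k) *\<^sub>R axis k \<i>) $ i)
    = (\<Sum>k\<in>UNIV. if k = i then v $ i else 0)" for i
    by (intro sum.cong) (auto simp: axis_def complex_eq_iff)
  then show ?thesis by (simp add: vec_eq_iff)
qed

lemma bilinear_expand_add:
  assumes "bilinear B"
  shows "B (a *\<^sub>R x + b *\<^sub>R y) (c *\<^sub>R z + d *\<^sub>R w) =
     (a * c) *\<^sub>R B x z + (a * d) *\<^sub>R B x w + (b * c) *\<^sub>R B y z + (b * d) *\<^sub>R B y w"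
  using assms by (simp add: bilinear_ladd bilinear_radd bilinear_lmul bilinear_rmul algebra_simps)

text \<open>J replaces the coordinates (Re, Im) by (-Im, Re). Adding both quadratic expressions
  pairs the products of coordinates into real and imaginary parts of v_j times the conjugate of v_k,
  the Hermitian form in which \<open>i_ddbar\<close> is written.\<close>

lemma bilinear_plus_J:
  fixes B :: "complex ^ 'n::finite \<Rightarrow> complex ^ 'n \<Rightarrow> real" and v :: "complex ^ 'n"
  assumes B: "bilinear B"
  shows "B v v + B (\<i> *s v) (\<i> *s v) = (\<Sum>j\<in>UNIV. \<Sum>k\<in>UNIV.
     Re (v $ j * cnj (v $ k)) * (B (axis j 1) (axis k 1) + B (axis j \<i>) (axis k \<i>))
   - Im (v $ j * cnj (v $ k)) * (B (axis j 1) (axis k \<i>) - B (axis j \<i>) (axis k 1)))"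
proof -
  have "B u u = (\<Sum>j\<in>UNIV. \<Sum>k\<in>UNIV.
      B (Re (u $ j) *\<^sub>R axis j 1 + Im (u $ j) *\<^sub>R axis j \<i>) (Re (u $ k) *\<^sub>R axis k 1 + Im (u $ k) *\<^sub>R axis k \<i>))" for u
    by (subst (1 2) complex_vec_expand[of u]) (simp add: bilinear_sum[OF B] sum.cartesian_product)
  then have E: "B u u = (\<Sum>j\<in>UNIV. \<Sum>k\<in>UNIV.
      (Re (u $ j) * Re (u $ k)) * B (axis j 1) (axis k 1) + (Re (u $ j) * Im (u $ k)) * B (axis j 1) (axis k \<i>)
      + (Im (u $ j) * Re (u $ k)) * B (axis j \<i>) (axis k 1) + (Im (u $ j) * Im (u $ k)) * B (axis j \<i>) (axis k \<i>))" for u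
    by (simp only: bilinear_expand_add[OF B] real_scaleR_def)
  show ?thesis
    unfolding E[of v] E[of "\<i> *s v"] sum.distrib[symmetric]
    by (intro sum.cong refl) (simp add: algebra_simps)
qed

text \<open>The two Wirtinger operators contribute a factor 1/4 and the wedge product evaluated on v
  and J v a factor 2. What remains is half the Laplacian along the complex line spanned by
  v.\<close>

lemma i_ddbar_J:
  fixes h :: "complex ^ 'n::finite \<Rightarrow> real"
  assumes "open S" "C_k_on 2 S h" "z \<in> S"
  shows "i_ddbar h z v (\<i> *s v) = (dir2 h z v v + dir2 h z (\<i> *s v) (\<i> *s v)) / 2"
proof -
  let ?B = "dir2 h z"
  have dh: "(h has_derivative frechet_derivative h (at y)) (at y)" if "y \<in> S" for y
    using assms(2) that by (simp add: numeral_2_eq_2 frechet_derivative_works)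
  have d2: "((\<lambda>y. frechet_derivative h (at y) w) has_derivative (\<lambda>w'. ?B w' w)) (at z)" for w
    using assms(2,3) unfolding dir2_def by (simp add: numeral_2_eq_2 frechet_derivative_works)
  have zb: "d_zbar k (\<lambda>w. complex_of_real (h w)) y =
     (of_real (frechet_derivative h (at y) (axis k 1)) + \<i> * of_real (frechet_derivative h (at y) (axis k \<i>))) / 2"
    if "y \<in> S" for y k
  proof -
    have "((\<lambda>w. complex_of_real (h w)) has_derivative (\<lambda>w. of_real (frechet_derivative h (at y) w))) (at y)"
      by (rule has_derivative_of_real[OF dh[OF that]])
    from frechet_derivative_at[OF this, symmetric] show ?thesis by (simp add: d_zbar_def)
  qed
  \<comment> \<open>The formula \<open>zb\<close> holds on S only; openness of S allows it to be
    differentiated at z.\<close>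
  have "(d_zbar k (\<lambda>w. complex_of_real (h w)) has_derivative
     (\<lambda>w. (of_real (?B w (axis k 1)) + \<i> * of_real (?B w (axis k \<i>))) / 2)) (at z)" for k
  proof (rule has_derivative_transform_within_open[OF _ assms(1,3)])
    show "((\<lambda>y. (of_real (frechet_derivative h (at y) (axis k 1)) + \<i> * of_real (frechet_derivative h (at y) (axis k \<i>))) / 2) has_derivative
     (\<lambda>w. (of_real (?B w (axis k 1)) + \<i> * of_real (?B w (axis k \<i>))) / 2)) (at z)"
      by (intro bounded_linear.has_derivative[OF bounded_linear_divide] has_derivative_add has_derivative_mult_right has_derivative_of_real d2)
  qed (simp add: zb)
  note dd = frechet_derivative_at[OF this, symmetric]
  have *: "d_z j (d_zbar k (\<lambda>w. complex_of_real (h w))) z =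
     (of_real (?B (axis j 1) (axis k 1) + ?B (axis j \<i>) (axis k \<i>))
      + \<i> * of_real (?B (axis j 1) (axis k \<i>) - ?B (axis j \<i>) (axis k 1))) / 4" for j k
    unfolding d_z_def dd by (simp add: algebra_simps add_divide_distrib diff_divide_distrib)
  have "i_ddbar h z v (\<i> *s v) = (\<Sum>j\<in>UNIV. \<Sum>k\<in>UNIV. 
     (Re (v $ j * cnj (v $ k)) * (?B (axis j 1) (axis k 1) + ?B (axis j \<i>) (axis k \<i>))
   - Im (v $ j * cnj (v $ k)) * (?B (axis j 1) (axis k \<i>) - ?B (axis j \<i>) (axis k 1))) / 2)"
    unfolding i_ddbar_def sum_distrib_left Re_sum *
  proof (intro sum.cong refl)
    fix j k
    have "v $ j * cnj ((\<i> *s v) $ k) - (\<i> *s v) $ j * cnj (v $ k) = -2 * \<i> * (v $ j * cnj (v $ k))"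
      by (simp add: algebra_simps)
    moreover have "Re (\<i> * ((of_real a + \<i> * of_real b) / 4 * (-2 * \<i> * w))) = (Re w * a - Im w * b) / 2" for a b w
      by (simp add: field_simps)
    ultimately show "Re (\<i> * ((of_real (?B (axis j 1) (axis k 1) + ?B (axis j \<i>) (axis k \<i>))
      + \<i> * of_real (?B (axis j 1) (axis k \<i>) - ?B (axis j \<i>) (axis k 1))) / 4 *
       (v $ j * cnj ((\<i> *s v) $ k) - (\<i> *s v) $ j * cnj (v $ k)))) = 
      (Re (v $ j * cnj (v $ k)) * (?B (axis j 1) (axis k 1) + ?B (axis j \<i>) (axis k \<i>))
   - Im (v $ j * cnj (v $ k)) * (?B (axis j 1) (axis k \<i>) - ?B (axis j \<i>) (axis k 1))) / 2"
      by (simp only:)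
  qed
  also have "\<dots> = (?B v v + ?B (\<i> *s v) (\<i> *s v)) / 2"
    unfolding bilinear_plus_J[OF dir2_bilinear[OF assms]] by (simp only: sum_divide_distrib)
  finally show ?thesis .
qed

lemma line_derivative:
  fixes h :: "'a::euclidean_space \<Rightarrow> real"
  assumes "h differentiable at (a + x *\<^sub>R v)"
  shows "((\<lambda>x. h (a + x *\<^sub>R v)) has_real_derivative frechet_derivative h (at (a + x *\<^sub>R v)) v) (at x)"
proof -
  have 1: "(h has_derivative frechet_derivative h (at (a + x *\<^sub>R v))) (at (a + x *\<^sub>R v))"
    using assms by (simp add: frechet_derivative_works)
  have 2: "((\<lambda>x. a + x *\<^sub>R v) has_derivative (\<lambda>x. x *\<^sub>R v)) (at x)"
    by (auto intro!: derivative_eq_intros)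
  have eq: "(\<lambda>t. frechet_derivative h (at (a + x *\<^sub>R v)) (t *\<^sub>R v)) = (*) (frechet_derivative h (at (a + x *\<^sub>R v)) v)"
    using linear_frechet_derivative[OF assms] by (intro ext) (simp only: linear_cmul real_scaleR_def mult.commute)
  show ?thesis
    unfolding has_field_derivative_def using has_derivative_compose[OF 2 1] unfolding eq .
qed

section \<open>Short polygons in a chart\<close>

abbreviation Jm :: "complex ^ 'n::finite \<Rightarrow> complex ^ 'n" where "Jm v \<equiv> \<i> *s v"

lemma Jm_add: "Jm (u + v) = Jm u + Jm v" and Jm_diff: "Jm (u - v) = Jm u - Jm v"
  and Jm_scaleR: "Jm (r *\<^sub>R v) = r *\<^sub>R Jm v" and Jm_minus: "Jm (- v) = - Jm v" and Jm_Jm: "Jm (Jm v) = - v"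
  by (simp_all add: vec_eq_iff algebra_simps)

lemma norm_Jm [simp]: "norm (Jm v) = norm v"
  by (simp add: norm_vec_def norm_mult)

lemma linear_Jm: "linear Jm"
  by (rule linearI) (simp_all add: Jm_add Jm_scaleR)

lemma continuous_on_Jm [continuous_intros]:
  "continuous_on S f \<Longrightarrow> continuous_on S (\<lambda>x. Jm (f x))"
  by (rule continuous_on_compose2[OF linear_continuous_on[OF linear_Jm[unfolded linear_conv_bounded_linear]]]) auto

text \<open>The vector x v + y J v is the complex multiple (x + i y) v, and the metric of a
  J-invariant form is Hermitian. Hence the speed in direction v determines the speed along every ray
  of the cone, and one function h suffices.\<close>

lemma hermitian_scale:
  assumes B: "bilinear B" and alt: "\<And>v. B v v = (0::real)" and J: "\<And>u v. B (Jm u) (Jm v) = B u v"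
  shows "B (x *\<^sub>R v + y *\<^sub>R Jm v) (Jm (x *\<^sub>R v + y *\<^sub>R Jm v)) = (x\<^sup>2 + y\<^sup>2) * B v (Jm v)"
proof -
  have 1: "B (Jm v) v = - B v (Jm v)"
  proof -
    have "B (v + Jm v) (v + Jm v) = 0" by (rule alt)
    then have "B v v + B v (Jm v) + (B (Jm v) v + B (Jm v) (Jm v)) = 0"
      by (simp only: bilinear_ladd[OF B] bilinear_radd[OF B] add_ac)
    then show ?thesis using alt[of v] alt[of "Jm v"] by linarith
  qed
  have 2: "Jm (x *\<^sub>R v + y *\<^sub>R Jm v) = x *\<^sub>R Jm v + (-y) *\<^sub>R v"
    by (simp add: Jm_add Jm_scaleR Jm_Jm)
  show ?thesis
    unfolding 2 bilinear_expand_add[OF B] by (simp add: 1 alt power2_eq_square algebra_simps)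
qed

definition segment_length ::
    "(complex ^ 'n::finite \<Rightarrow> complex ^ 'n \<Rightarrow> complex ^ 'n \<Rightarrow> real) \<Rightarrow> complex ^ 'n \<Rightarrow> complex ^ 'n \<Rightarrow> real" where
  "segment_length \<beta> a b = integral {0..1} (\<lambda>s. sqrt (\<beta> (a + s *\<^sub>R (b - a)) (b - a) (Jm (b - a))))"

lemma integral_flip_unit:
  fixes g :: "real \<Rightarrow> real"
  assumes "g integrable_on {0..1}"
  shows "integral {0..1} (\<lambda>s. g (1 - s)) = integral {0..1} g"
proof -
  have "(\<lambda>x::real. (1 / - 1) *\<^sub>R x + - ((1 / - 1) *\<^sub>R 1)) ` cbox 0 1 = {0..1}"
  proof (intro equalityI subsetI)
    fix x :: real assume "x \<in> {0..1}"
    then show "x \<in> (\<lambda>x. (1 / - 1) *\<^sub>R x + - ((1 / - 1) *\<^sub>R 1)) ` cbox 0 1"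
      by (intro image_eqI[of _ _ "1 - x"]) auto
  qed auto
  with has_integral_affinity[of g "integral {0..1} g" 0 1 "-1" 1] assms
  have "((\<lambda>s. g (1 - s)) has_integral integral {0..1} g) {0..1}"
    by (simp add: integrable_integral)
  then show ?thesis by (rule integral_unique)
qed

lemma affine_in_segment:
  fixes a b :: "'a::real_vector"
  assumes "s \<in> {0..1}"
  shows "a + s *\<^sub>R (b - a) \<in> closed_segment a b"
  using assms unfolding closed_segment_def by (auto simp: algebra_simps intro!: exI[of _ s])

text \<open>Estimates start at a vertex of a cone, so the second side of the polygon is measured
  from q and then traversed backwards.\<close>

lemma segment_length_commute:
  assumes bil: "\<And>z. z \<in> closed_segment a b \<Longrightarrow> bilinear (\<beta> z)"
    and cont: "continuous_on (closed_segment a b) (\<lambda>z. \<beta> z (a - b) (Jm (a - b)))"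
  shows "segment_length \<beta> a b = segment_length \<beta> b a"
proof -
  have "(\<lambda>s. sqrt (\<beta> (b + s *\<^sub>R (a - b)) (a - b) (Jm (a - b)))) integrable_on {0..1}"
    by (intro integrable_continuous_interval continuous_intros continuous_on_compose2[OF cont])
       (auto simp: closed_segment_commute[of a b] affine_in_segment)
  from integral_flip_unit[OF this]
  have "segment_length \<beta> b a = integral {0..1} (\<lambda>s. sqrt (\<beta> (b + (1 - s) *\<^sub>R (a - b)) (a - b) (Jm (a - b))))"
    unfolding segment_length_def by simp
  also have "\<dots> = segment_length \<beta> a b"
    unfolding segment_length_def
  proof (intro integral_cong arg_cong[where f = sqrt])
    fix s :: real assume "s \<in> {0..1}"
    then have "a + s *\<^sub>R (b - a) \<in> closed_segment a b" by (rule affine_in_segment)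
    note B = bil[OF this]
    have 1: "b + (1 - s) *\<^sub>R (a - b) = a + s *\<^sub>R (b - a)" "a - b = - (b - a)" by (simp_all add: algebra_simps)
    show "\<beta> (b + (1 - s) *\<^sub>R (a - b)) (a - b) (Jm (a - b)) = \<beta> (a + s *\<^sub>R (b - a)) (b - a) (Jm (b - a))"
      unfolding 1(1) unfolding 1(2) Jm_minus bilinear_lneg[OF B] bilinear_rneg[OF B] by simp
  qed
  finally show ?thesis by simp
qed

text \<open>The situation in one chart: \<beta> stands for the deformed form,
  \<open>\<beta>0\<close> for the background form and f for the potential. The background enters the
  estimates through its upper bound L only, and the Hoelder condition is Euclidean.\<close>

locale potential_form =
  fixes S :: "(complex ^ 'n::finite) set" and \<beta> \<beta>0 :: "complex ^ 'n \<Rightarrow> complex ^ 'n \<Rightarrow> complex ^ 'n \<Rightarrow> real"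
    and f :: "complex ^ 'n \<Rightarrow> real" and L K \<alpha> :: real
  assumes open_S: "open S"
    and f_smooth: "\<And>k. C_k_on k S f"
    and bil: "\<And>z. z \<in> S \<Longrightarrow> bilinear (\<beta> z)"
    and alt: "\<And>z v. z \<in> S \<Longrightarrow> \<beta> z v v = 0"
    and J_inv: "\<And>z u v. z \<in> S \<Longrightarrow> \<beta> z (Jm u) (Jm v) = \<beta> z u v"
    and nonneg: "\<And>z v. z \<in> S \<Longrightarrow> 0 \<le> \<beta> z v (Jm v)"
    and cont_\<beta>: "\<And>v. continuous_on S (\<lambda>z. \<beta> z v (Jm v))"
    and \<beta>_eq: "\<And>z v. z \<in> S \<Longrightarrow> \<beta> z v (Jm v) = \<beta>0 z v (Jm v) + i_ddbar f z v (Jm v)"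
    and \<beta>0_le: "\<And>z v. z \<in> S \<Longrightarrow> \<beta>0 z v (Jm v) \<le> L * (norm v)\<^sup>2"
    and holder: "\<And>z w. z \<in> S \<Longrightarrow> w \<in> S \<Longrightarrow> \<bar>f z - f w\<bar> \<le> K * norm (z - w) powr \<alpha>"
    and L: "0 < L" and K: "0 < K" and \<alpha>: "0 < \<alpha>" "\<alpha> \<le> 1"
begin

text \<open>The integrand is the speed in direction v, not in the direction (1 + i y) v of the ray;
  \<open>segment_length_ray\<close> accounts for the difference.\<close>

definition ray :: "complex ^ 'n \<Rightarrow> complex ^ 'n \<Rightarrow> real \<Rightarrow> real" where
  "ray p v y = integral {0..1/2} (\<lambda>x. sqrt (\<beta> (p + x *\<^sub>R v + (x * y) *\<^sub>R Jm v) v (Jm v)))"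

lemma cone_pt:
  assumes "x \<in> {0..1}" "y \<in> {-1/2..1/2}"
  shows "norm (x *\<^sub>R v + y *\<^sub>R Jm v) \<le> (x + \<bar>y\<bar>) * norm v" "(x + \<bar>y\<bar>) * norm v \<le> 3/2 * norm v"
proof -
  show "norm (x *\<^sub>R v + y *\<^sub>R Jm v) \<le> (x + \<bar>y\<bar>) * norm v"
    using assms norm_triangle_ineq[of "x *\<^sub>R v" "y *\<^sub>R Jm v"] by (simp add: algebra_simps)
  show "(x + \<bar>y\<bar>) * norm v \<le> 3/2 * norm v"
    using assms by (intro mult_right_mono) auto
qed

lemma xy_bound: "x \<in> {0..1} \<Longrightarrow> y \<in> {-1/2..1/2} \<Longrightarrow> x * y \<in> {-1/2..1/2::real}"
proof -
  assume "x \<in> {0..1}" "y \<in> {-1/2..1/2}"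
  then have "\<bar>x * y\<bar> \<le> 1 * (1/2)" unfolding abs_mult by (intro mult_mono) auto
  then show ?thesis by auto
qed

text \<open>The radius 3/2 |v| covers the whole region 0 <= x <= 1, |t| <= 1/2 on which the planar
  estimate works, not just the cone.\<close>

lemma cone_in_S:
  assumes "cball p (3/2 * norm v) \<subseteq> S" "x \<in> {0..1}" "y \<in> {-1/2..1/2}"
  shows "p + x *\<^sub>R v + y *\<^sub>R Jm v \<in> S"
proof -
  have "norm (x *\<^sub>R v + y *\<^sub>R Jm v) \<le> 3/2 * norm v"
    using cone_pt[OF assms(2,3), of v] by linarith
  then have "p + x *\<^sub>R v + y *\<^sub>R Jm v \<in> cball p (3/2 * norm v)"
    using norm_minus_cancel[of "x *\<^sub>R v + y *\<^sub>R Jm v"] by (simp add: dist_norm del: norm_minus_cancel)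
  with assms(1) show ?thesis by blast
qed

lemma ray_continuous:
  assumes "cball p (3/2 * norm v) \<subseteq> S"
  shows "continuous_on {-1/2..1/2} (ray p v)"
proof -
  have "continuous_on ({-1/2..1/2} \<times> cbox 0 (1/2)) (\<lambda>(y, x). sqrt (\<beta> (p + x *\<^sub>R v + (x * y) *\<^sub>R Jm v) v (Jm v)))"
    unfolding case_prod_beta
    by (intro continuous_intros continuous_on_compose2[OF cont_\<beta>[of v]])
       (auto intro!: cone_in_S[OF assms] xy_bound)
  then show ?thesis
    unfolding ray_def using integral_continuous_on_param[of "{-1/2..1/2::real}" 0 "1/2::real"
      "\<lambda>y x. sqrt (\<beta> (p + x *\<^sub>R v + (x * y) *\<^sub>R Jm v) v (Jm v))"] by simp
qed

text \<open>In the parameters x and t of the complex line all lengths are scaled by |v|. So the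
  background contributes L |v|^2 and the Hoelder constant becomes K |v|^\<alpha>; their sum is the M
  of the planar estimate.\<close>

lemma ray_average:
  assumes S: "cball p (3/2 * norm v) \<subseteq> S" and v: "v \<noteq> 0"
  shows "integral {-1/2..1/2} (ray p v) \<le> cone_const \<alpha> * sqrt (L * (norm v)\<^sup>2 + K * norm v powr \<alpha>)"
proof -
  define pt where "pt x t = p + x *\<^sub>R v + t *\<^sub>R Jm v" for x t
  have ptS: "pt x t \<in> S" if "x \<in> {0..1}" "t \<in> {-1/2..1/2}" for x t
    unfolding pt_def using cone_in_S[OF S] that by blast
  have D: "g differentiable at z" if "C_k_on (Suc k) S g" "z \<in> S" for g :: "complex ^ 'n \<Rightarrow> real" and k z
    using that by auto
  have D1: "C_k_on k S (\<lambda>y. frechet_derivative f (at y) w)" for k w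
    using f_smooth[of "Suc k"] by simp
  have D2: "continuous_on S (\<lambda>z. dir2 f z w w')" for w w'
    using f_smooth[of 2] unfolding dir2_def by (simp add: numeral_2_eq_2)
  have cpt: "continuous_on ({0..1} \<times> {-1/2..1/2}) (\<lambda>(x, t). g (pt x t))" if "continuous_on S g" for g :: "complex ^ 'n \<Rightarrow> real"
    unfolding case_prod_beta
    by (rule continuous_on_compose2[OF that]) (use ptS in \<open>auto simp: pt_def intro!: continuous_intros\<close>)
  have dx: "((\<lambda>x. g (pt x t)) has_real_derivative frechet_derivative g (at (pt x t)) v) (at x)"
    if "C_k_on 1 S g" "x \<in> {0..1}" "t \<in> {-1/2..1/2}" for g x t
    using line_derivative[of g "p + t *\<^sub>R Jm v" x v] D[of 0 g "pt x t"] that ptS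
    by (simp add: pt_def add_ac)
  have dt: "((\<lambda>t. g (pt x t)) has_real_derivative frechet_derivative g (at (pt x t)) (Jm v)) (at t)"
    if "C_k_on 1 S g" "x \<in> {0..1}" "t \<in> {-1/2..1/2}" for g x t
    using line_derivative[of g "p + x *\<^sub>R v" t "Jm v"] D[of 0 g "pt x t"] that ptS
    by (simp add: pt_def add_ac)
  have "integral {-1/2..1/2} (\<lambda>y. integral {0..1/2} (\<lambda>x. sqrt (\<beta> (pt x (x * y)) v (Jm v))))
     \<le> cone_const \<alpha> * sqrt (L * (norm v)\<^sup>2 + K * norm v powr \<alpha>)"
  proof (rule cone_average[where u = "\<lambda>x t. f (pt x t)"
        and ux = "\<lambda>x t. frechet_derivative f (at (pt x t)) v" and uxx = "\<lambda>x t. dir2 f (pt x t) v v"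
        and ut = "\<lambda>x t. frechet_derivative f (at (pt x t)) (Jm v)" and utt = "\<lambda>x t. dir2 f (pt x t) (Jm v) (Jm v)"])
    fix x t :: real assume xt: "x \<in> {0..1}" "t \<in> {-1/2..1/2}"
    note z = ptS[OF xt]
    show "((\<lambda>x. f (pt x t)) has_real_derivative frechet_derivative f (at (pt x t)) v) (at x)"
      "((\<lambda>t. f (pt x t)) has_real_derivative frechet_derivative f (at (pt x t)) (Jm v)) (at t)"
      using dx[OF f_smooth xt] dt[OF f_smooth xt] by auto
    show "((\<lambda>x. frechet_derivative f (at (pt x t)) v) has_real_derivative dir2 f (pt x t) v v) (at x)"
      "((\<lambda>t. frechet_derivative f (at (pt x t)) (Jm v)) has_real_derivative dir2 f (pt x t) (Jm v) (Jm v)) (at t)"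
      unfolding dir2_def using dx[OF D1 xt] dt[OF D1 xt] by auto
    show "0 \<le> \<beta> (pt x t) v (Jm v)" using nonneg z by auto
    have "\<beta>0 (pt x t) v (Jm v) \<le> L * (norm v)\<^sup>2 + K * norm v powr \<alpha>"
      using \<beta>0_le[OF z, of v] K by (simp add: add_increasing2)
    then show "\<beta> (pt x t) v (Jm v) \<le> L * (norm v)\<^sup>2 + K * norm v powr \<alpha> +
        (dir2 f (pt x t) v v + dir2 f (pt x t) (Jm v) (Jm v)) / 2"
      unfolding \<beta>_eq[OF z] i_ddbar_J[OF open_S f_smooth z] by simp
    have z0: "pt 0 0 \<in> S" by (rule ptS) auto
    have e: "pt x t - pt 0 0 = x *\<^sub>R v + t *\<^sub>R Jm v" by (simp add: pt_def)
    have "\<bar>f (pt x t) - f (pt 0 0)\<bar> \<le> K * norm (pt x t - pt 0 0) powr \<alpha>" by (rule holder[OF z z0])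
    also have "\<dots> \<le> K * ((x + \<bar>t\<bar>) * norm v) powr \<alpha>"
      unfolding e using cone_pt[OF xt, of v] K \<alpha> by (intro mult_left_mono powr_mono2) auto
    also have "\<dots> = (K * norm v powr \<alpha>) * (x + \<bar>t\<bar>) powr \<alpha>"
      using xt by (simp add: powr_mult mult_ac)
    also have "\<dots> \<le> (L * (norm v)\<^sup>2 + K * norm v powr \<alpha>) * (x + \<bar>t\<bar>) powr \<alpha>"
      using L by (intro mult_right_mono) auto
    finally show "\<bar>f (pt x t) - f (pt 0 0)\<bar> \<le> (L * (norm v)\<^sup>2 + K * norm v powr \<alpha>) * (x + \<bar>t\<bar>) powr \<alpha>" .
  next
    show "0 < L * (norm v)\<^sup>2 + K * norm v powr \<alpha>" using v L K by (simp add: add_pos_pos)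
  qed (use \<alpha> cpt[OF D2[of v v]] cpt[OF D2[of "Jm v" "Jm v"]] cpt[OF cont_\<beta>[of v]]
      cpt[OF C_k_on_cont[OF f_smooth open_S]] in auto)
  then show ?thesis by (simp add: ray_def[abs_def] pt_def)
qed

text \<open>The substitution x = s/2 contributes the 2. The velocity of the segment is (1 + i y)/2
  times v, so its speed carries the factor sqrt(1 + y^2)/2, which is at most 1 for |y| <=
  1/2.\<close>

lemma segment_length_ray:
  assumes S: "cball p (3/2 * norm v) \<subseteq> S" and y: "y \<in> {-1/2..1/2}"
  shows "segment_length \<beta> p (p + (1/2) *\<^sub>R v + (y/2) *\<^sub>R Jm v) \<le> 2 * ray p v y"
proof -
  let ?g = "\<lambda>x. sqrt (\<beta> (p + x *\<^sub>R v + (x * y) *\<^sub>R Jm v) v (Jm v))"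
  have S': "p + x *\<^sub>R v + (x * y) *\<^sub>R Jm v \<in> S" if "x \<in> {0..1/2}" for x
    using that y by (intro cone_in_S[OF S] xy_bound) auto
  have ig: "?g integrable_on {0..1/2}"
    by (intro integrable_continuous_interval continuous_intros continuous_on_compose2[OF cont_\<beta>[of v]])
       (use S' in auto)
  have "(?g has_integral ray p v y) (cbox 0 (1/2))"
    unfolding ray_def using integrable_integral[OF ig] by simp
  from has_integral_affinity[OF this, of "1/2" 0]
  have "((\<lambda>s. ?g (1/2 * s)) has_integral 2 * ray p v y) {0..1}"
    using image_mult_atLeastAtMost[of 2 0 "1/2::real"] by simp
  then have "((\<lambda>s. (sqrt (1 + y\<^sup>2)/2) * ?g (1/2 * s)) has_integral (sqrt (1 + y\<^sup>2)/2) * (2 * ray p v y)) {0..1}"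
    by (rule has_integral_mult_right)
  moreover have "sqrt (\<beta> (p + s *\<^sub>R d) d (Jm d)) = (sqrt (1 + y\<^sup>2)/2) * ?g (1/2 * s)"
    if s: "s \<in> {0..1}" and d: "d = (1/2) *\<^sub>R v + (y/2) *\<^sub>R Jm v" for s d
  proof -
    have e: "p + s *\<^sub>R d = p + (1/2 * s) *\<^sub>R v + (1/2 * s * y) *\<^sub>R Jm v"
      by (simp add: d algebra_simps)
    have z: "p + s *\<^sub>R d \<in> S" unfolding e using S'[of "1/2 * s"] s by auto
    have "\<beta> (p + s *\<^sub>R d) d (Jm d) = ((1/2)\<^sup>2 + (y/2)\<^sup>2) * \<beta> (p + s *\<^sub>R d) v (Jm v)"
      using hermitian_scale[OF bil[OF z] alt[OF z] J_inv[OF z], of "1/2" v "y/2"] by (simp add: d)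
    also have "(1/2)\<^sup>2 + (y/2)\<^sup>2 = (1 + y\<^sup>2) / 2\<^sup>2" by (simp add: power2_eq_square field_simps)
    finally have "sqrt (\<beta> (p + s *\<^sub>R d) d (Jm d)) = sqrt ((1 + y\<^sup>2) / 2\<^sup>2 * \<beta> (p + s *\<^sub>R d) v (Jm v))"
      by (simp only:)
    then show ?thesis unfolding e by (simp add: real_sqrt_mult real_sqrt_divide)
  qed
  ultimately have "segment_length \<beta> p (p + (1/2) *\<^sub>R v + (y/2) *\<^sub>R Jm v) = (sqrt (1 + y\<^sup>2)/2) * (2 * ray p v y)"
    unfolding segment_length_def
    by (intro integral_unique) (auto simp: add.assoc elim!: has_integral_eq[rotated])
  also have "\<dots> \<le> 1 * (2 * ray p v y)"
  proof (rule mult_right_mono)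
    have "y\<^sup>2 \<le> (1/2)\<^sup>2" using y by (intro abs_le_square_iff[THEN iffD1]) auto
    then have "1 + y\<^sup>2 \<le> 2\<^sup>2" by (simp add: power_divide)
    from real_sqrt_le_mono[OF this] show "sqrt (1 + y\<^sup>2)/2 \<le> 1" by simp
    show "0 \<le> 2 * ray p v y"
      unfolding ray_def using S' by (intro mult_nonneg_nonneg integral_nonneg ig) (auto intro!: nonneg)
  qed
  finally show ?thesis by simp
qed

text \<open>The apex of slope y over p in direction v is the apex of slope -y over q in direction
  -v. So the averages of both sides may be added, and one y is good for both. The 6 is the 2 of
  \<open>segment_length_ray\<close> times the 3 of the mean value argument.\<close>

lemma short_polygon:
  assumes S: "cball p (5/2 * norm (q - p)) \<subseteq> S" and pq: "p \<noteq> q"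
  obtains m where "norm (m - p) \<le> norm (q - p)"
    "segment_length \<beta> p m + segment_length \<beta> m q
      \<le> 6 * cone_const \<alpha> * sqrt (L * (norm (q - p))\<^sup>2 + K * norm (q - p) powr \<alpha>)"
proof -
  define v where "v = q - p"
  define B where "B = cone_const \<alpha> * sqrt (L * (norm v)\<^sup>2 + K * norm v powr \<alpha>)"
  have v: "v \<noteq> 0" using pq by (simp add: v_def)
  have "0 < L * (norm v)\<^sup>2 + K * norm v powr \<alpha>" using v L K by (simp add: add_pos_pos)
  then have B: "0 < B" unfolding B_def using cone_const_pos[OF \<alpha>(1)] by simp
  have Sp: "cball p (3/2 * norm v) \<subseteq> S" 
    by (rule order_trans[OF subset_cball S]) (simp add: v_def)
  \<comment> \<open>The region around q has radius 3/2 |v| and q lies at distance |v| from p; this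
    is where the 5/2 comes from.\<close>
  have Sq: "cball q (3/2 * norm (-v)) \<subseteq> S"
  proof -
    have "dist p z \<le> 5/2 * norm (q - p)" if "dist q z \<le> 3/2 * norm (q - p)" for z
      using dist_triangle[of p z q] that by (simp add: dist_norm[of p q] norm_minus_commute[of p q])
    then have "cball q (3/2 * norm (-v)) \<subseteq> cball p (5/2 * norm (q - p))"
      unfolding v_def norm_minus_cancel by (auto simp only: mem_cball)
    with S show ?thesis by blast
  qed
  define G where "G y = ray p v y + ray q (-v) (-y)" for y
  have c1: "continuous_on {-1/2..1/2} (ray p v)" by (rule ray_continuous[OF Sp])
  have c2: "continuous_on {-1/2..1/2} (\<lambda>y. ray q (-v) (-y))"
    by (rule continuous_on_compose2[OF ray_continuous[OF Sq]]) (auto intro!: continuous_intros)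
  have "integral {-1/2..1/2} G = integral {-1/2..1/2} (ray p v) + integral {-1/2..1/2} (\<lambda>y. ray q (-v) (-y))"
    unfolding G_def by (intro integral_add integrable_continuous_interval c1 c2)
  also have "integral {-1/2..1/2} (\<lambda>y. ray q (-v) (-y)) = integral {-1/2..1/2} (ray q (-v))"
    using Henstock_Kurzweil_Integration.integral_reflect_real[of "1/2" "-1/2" "ray q (-v)"] by simp
  also have "integral {-1/2..1/2} (ray p v) + \<dots> \<le> B + B"
    using ray_average[OF Sp v] ray_average[OF Sq] v by (simp add: B_def)
  finally have G: "integral {-1/2..1/2} G \<le> 2 * B" by simp
  \<comment> \<open>The mean over an interval of length 1 is at most 2 B, so a lower bound 3 B
    everywhere would contradict B > 0.\<close>
  have "\<exists>y\<in>{-1/2..1/2}. G y \<le> 3 * B"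
  proof (rule ccontr)
    assume "\<not> ?thesis"
    then have "integral {-1/2..1/2::real} (\<lambda>y. 3 * B) \<le> integral {-1/2..1/2} G"
      unfolding G_def by (intro integral_le integrable_continuous_interval continuous_on_add c1 c2)
        (auto simp: not_le intro: less_imp_le)
    with G B show False by simp
  qed
  then obtain y where y: "y \<in> {-1/2..1/2}" "G y \<le> 3 * B" by blast
  define m where "m = p + (1/2) *\<^sub>R v + (y/2) *\<^sub>R Jm v"
  have m2: "m = q + (1/2) *\<^sub>R (-v) + ((-y)/2) *\<^sub>R Jm (-v)"
  proof -
    have "(1/2) *\<^sub>R v + (1/2) *\<^sub>R v = v" by (simp only: scaleR_add_left[symmetric]) simp
    then have "(1/2) *\<^sub>R v = v + (1/2) *\<^sub>R (- v)" by (simp add: eq_diff_eq)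
    moreover have "q = p + v" by (simp add: v_def)
    moreover have "(-y/2) *\<^sub>R Jm (- v) = (y/2) *\<^sub>R Jm v" by (simp add: Jm_minus)
    ultimately show ?thesis unfolding m_def by (simp only: add.assoc)
  qed
  have mp: "norm (m - p) \<le> norm (q - p)"
  proof -
    have "norm (m - p) \<le> (1/2 + \<bar>y/2\<bar>) * norm v"
      using cone_pt(1)[of "1/2" "y/2" v] y by (simp add: m_def)
    also have "\<dots> \<le> 1 * norm v" using y by (intro mult_right_mono) auto
    finally show ?thesis by (simp add: v_def)
  qed
  have seg: "z \<in> S" if "z \<in> closed_segment m q" for z
  proof -
    have "m \<in> cball p (norm (q - p))" "q \<in> cball p (norm (q - p))"
      using mp by (auto simp: dist_norm norm_minus_commute)
    then have "closed_segment m q \<subseteq> cball p (norm (q - p))" by (intro closed_segment_subset) auto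
    also have "\<dots> \<subseteq> cball p (5/2 * norm (q - p))" by (intro subset_cball) (simp add: field_simps)
    finally show ?thesis using that S by blast
  qed
  have "segment_length \<beta> p m + segment_length \<beta> m q \<le> 2 * ray p v y + 2 * ray q (-v) (-y)"
  proof (rule add_mono)
    show "segment_length \<beta> p m \<le> 2 * ray p v y"
      unfolding m_def by (rule segment_length_ray[OF Sp y(1)])
    have "segment_length \<beta> m q = segment_length \<beta> q m"
      by (rule segment_length_commute[OF bil[OF seg] continuous_on_subset[OF cont_\<beta>]]) (use seg in auto)
    also have "\<dots> \<le> 2 * ray q (-v) (-y)"
      unfolding m2 by (rule segment_length_ray[OF Sq]) (use y in auto)
    finally show "segment_length \<beta> m q \<le> 2 * ray q (-v) (-y)" .
  qed
  also have "\<dots> \<le> 6 * B" using y(2) by (simp add: G_def)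
  finally show ?thesis using that mp unfolding B_def v_def by (simp add: mult.assoc)
qed

end

section \<open>Piecewise smooth curves on a complex manifold\<close>

lemma bilinear_basis_expand:
  fixes B :: "'a::euclidean_space \<Rightarrow> 'a \<Rightarrow> real"
  assumes "bilinear B"
  shows "B u v = (\<Sum>i\<in>Basis. \<Sum>j\<in>Basis. ((u \<bullet> i) * (v \<bullet> j)) * B i j)"
proof -
  have "B u v = B (\<Sum>i\<in>Basis. (u \<bullet> i) *\<^sub>R i) (\<Sum>j\<in>Basis. (v \<bullet> j) *\<^sub>R j)"
    by (simp add: euclidean_representation)
  also have "\<dots> = (\<Sum>i\<in>Basis. \<Sum>j\<in>Basis. B ((u \<bullet> i) *\<^sub>R i) ((v \<bullet> j) *\<^sub>R j))"
    by (simp add: bilinear_sum[OF assms] sum.cartesian_product)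
  also have "\<dots> = (\<Sum>i\<in>Basis. \<Sum>j\<in>Basis. ((u \<bullet> i) * (v \<bullet> j)) * B i j)"
    by (simp add: bilinear_lmul[OF assms] bilinear_rmul[OF assms] mult_ac)
  finally show ?thesis .
qed

lemma smooth_on_cong:
  assumes "\<And>x. x \<in> S \<Longrightarrow> f x = g x"
  shows "smooth_on S f \<longleftrightarrow> smooth_on S g"
  unfolding smooth_on_def using assms by (metis Int_iff)

lemma smooth_curve_on_cong:
  assumes "\<And>t. t \<in> S \<Longrightarrow> \<gamma> t = \<eta> t"
  shows "smooth_curve_on A S \<gamma> \<longleftrightarrow> smooth_curve_on A S \<eta>"
proof -
  have "{s \<in> S. \<gamma> s \<in> U} = {s \<in> S. \<eta> s \<in> U}" for U using assms by auto
  moreover have "smooth_on {s \<in> S. \<eta> s \<in> U} (h \<circ> \<gamma>) \<longleftrightarrow> smooth_on {s \<in> S. \<eta> s \<in> U} (h \<circ> \<eta>)"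
    for U and h :: "'a \<Rightarrow> complex ^ 'b"
    by (rule smooth_on_cong) (use assms in auto)
  ultimately show ?thesis
    unfolding smooth_curve_on_def using assms by simp
qed

text \<open>Arbitrary parameter intervals let curves be concatenated without reparametrization. With
  m = 0 the degenerate interval a = b is included.\<close>

definition pw_curve ::
    "'a topology \<Rightarrow> ('a, 'n::finite) chart set \<Rightarrow> real \<Rightarrow> real \<Rightarrow> (real \<Rightarrow> 'a) \<Rightarrow> bool" where
  "pw_curve X A a b \<gamma> \<longleftrightarrow> continuous_map (top_of_set {a..b}) X \<gamma> \<and>
     (\<exists>m (s :: nat \<Rightarrow> real). s 0 = a \<and> s m = b \<and>
        (\<forall>i<m. s i < s (Suc i) \<and> smooth_curve_on A {s i..s (Suc i)} \<gamma>))"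

lemma curve_joins_iff: "curve_joins X A p q \<gamma> \<longleftrightarrow> pw_curve X A 0 1 \<gamma> \<and> \<gamma> 0 = p \<and> \<gamma> 1 = q"
  unfolding curve_joins_def piecewise_smooth_curve_def pw_curve_def pathin_def by auto

lemma partition_mono:
  fixes s :: "nat \<Rightarrow> real"
  assumes "\<And>i. i < m \<Longrightarrow> s i < s (Suc i)" "i \<le> j" "j \<le> m"
  shows "s i \<le> s j"
  using assms(2,3)
proof (induction j rule: dec_induct)
  case (step j)
  then show ?case using assms(1)[of j] by fastforce
qed simp

lemma partition_cover:
  fixes s :: "nat \<Rightarrow> real"
  assumes "t \<in> {s 0..s m}" "t \<notin> s ` {..m}"
  shows "\<exists>i<m. s i < t \<and> t < s (Suc i)"
  using assms
proof (induction m)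
  case (Suc m)
  show ?case
  proof (cases "t \<le> s m")
    case True
    then obtain i where "i < m" "s i < t" "t < s (Suc i)" using Suc by (auto simp: atMost_Suc)
    then show ?thesis using less_SucI by blast
  next
    case False
    then show ?thesis using Suc.prems by (intro exI[of _ m]) (auto simp: atMost_Suc)
  qed
qed auto

lemma two_formD:
  assumes "smooth_two_form A \<omega>" "c \<in> A"
  shows two_form_bilinear: "z \<in> cimage c \<Longrightarrow> bilinear (\<omega> c z)"
    and two_form_alt: "z \<in> cimage c \<Longrightarrow> \<omega> c z v v = 0"
    and two_form_smooth: "smooth_on (cimage c) (\<lambda>z. \<omega> c z u v)"
proof -
  note H = assms(1)[unfolded smooth_two_form_def]
  note 1 = conjunct1[OF H] and 2 = conjunct1[OF conjunct2[OF H]]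
  show "z \<in> cimage c \<Longrightarrow> bilinear (\<omega> c z)" "z \<in> cimage c \<Longrightarrow> \<omega> c z v v = 0"
    using 1 assms(2) by blast+
  show "smooth_on (cimage c) (\<lambda>z. \<omega> c z u v)" using 2 assms(2) by blast
qed

section \<open>Charts, transition maps and the speed of a curve\<close>

locale cmanifold =
  fixes X :: "'a topology" and A :: "('a, 'n::finite) chart set"
  assumes mfd: "complex_manifold X A"
begin

lemma chart: assumes "c \<in> A"
  shows chart_open: "openin X (fst c)" and cimage_open: "open (cimage c)"
    and chart_homeo: "homeomorphic_map (subtopology X (fst c)) (top_of_set (cimage c)) (snd c)"
  using mfd assms unfolding complex_manifold_def is_chart_def by auto

lemma chart_sub: "c \<in> A \<Longrightarrow> fst c \<subseteq> topspace X"
  using chart_open openin_subset by blast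

lemma chart_inj: "c \<in> A \<Longrightarrow> inj_on (snd c) (fst c)"
  using homeomorphic_imp_injective_map[OF chart_homeo, of c] chart_sub[of c] by (simp add: Int_absorb1)

lemma cinv_chart [simp]: "c \<in> A \<Longrightarrow> p \<in> fst c \<Longrightarrow> cinv c (snd c p) = p"
  unfolding cinv_def using chart_inj by (rule inv_into_f_f)

lemma chart_cinv [simp]: "z \<in> cimage c \<Longrightarrow> snd c (cinv c z) = z"
  unfolding cinv_def cimage_def by (rule f_inv_into_f)

lemma cinv_in [simp]: "z \<in> cimage c \<Longrightarrow> cinv c z \<in> fst c"
  unfolding cinv_def cimage_def by (rule inv_into_into)

lemma chart_in [simp]: "p \<in> fst c \<Longrightarrow> snd c p \<in> cimage c"
  by (simp add: cimage_def)

lemma chart_ex: "p \<in> topspace X \<Longrightarrow> \<exists>c\<in>A. p \<in> fst c"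
  using mfd unfolding complex_manifold_def by blast

lemma chart_cont: "c \<in> A \<Longrightarrow> continuous_map (subtopology X (fst c)) euclidean (snd c)"
  using homeomorphic_imp_continuous_map[OF chart_homeo] continuous_map_in_subtopology by blast

lemma cinv_cont: assumes "c \<in> A" shows "continuous_map (top_of_set (cimage c)) X (cinv c)"
proof -
  obtain g where g: "homeomorphic_maps (subtopology X (fst c)) (top_of_set (cimage c)) (snd c) g"
    using chart_homeo[OF assms] homeomorphic_map_maps by blast
  have "g z = cinv c z" if "z \<in> cimage c" for z
  proof -
    have "snd c (g z) = z" "g z \<in> fst c"
      using g that chart_sub[OF assms] by (auto simp: homeomorphic_maps_def continuous_map_def)
    then show ?thesis using cinv_chart[OF assms, of "g z"] by simp
  qed
  moreover have "continuous_map (top_of_set (cimage c)) X g"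
    using g by (simp add: homeomorphic_maps_def continuous_map_in_subtopology)
  ultimately show ?thesis by (auto intro: continuous_map_eq)
qed

lemma chart_preimage_open:
  assumes "c \<in> A" "open U"
  shows "openin X {p \<in> fst c. snd c p \<in> U}"
proof -
  have "openin (subtopology X (fst c)) {p \<in> topspace (subtopology X (fst c)). snd c p \<in> U}"
    using openin_continuous_map_preimage[OF chart_cont[OF assms(1)]] assms(2) by simp
  moreover have "{p \<in> topspace (subtopology X (fst c)). snd c p \<in> U} = {p \<in> fst c. snd c p \<in> U}"
    using chart_sub[OF assms(1)] by auto
  ultimately show ?thesis using openin_trans_full[OF _ chart_open[OF assms(1)]] by metis
qed

lemma overlap_open:
  assumes "c \<in> A" "c' \<in> A" shows "open (snd c ` (fst c \<inter> fst c'))"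
proof -
  have "openin (subtopology X (fst c)) (fst c \<inter> fst c')"
    using chart_open assms by (simp add: openin_subtopology_Int2)
  then have "openin (top_of_set (cimage c)) (snd c ` (fst c \<inter> fst c'))"
    using homeomorphic_imp_open_map[OF chart_homeo[OF assms(1)]] by (simp add: open_map_def)
  then show ?thesis using cimage_open[OF assms(1)] openin_open_trans by blast
qed

lemma transition_smooth:
  assumes "c \<in> A" "c' \<in> A" "p \<in> fst c" "p \<in> fst c'"
  defines "T \<equiv> frechet_derivative (transition c c') (at (snd c p))"
  shows "(transition c c' has_derivative T) (at (snd c p))" "T (Jm v) = Jm (T v)"
proof -
  have h: "holomorphic_map_on (snd c ` (fst c \<inter> fst c')) (transition c c')"
    using mfd assms unfolding complex_manifold_def by blast
  then have "C_k_on 1 (snd c ` (fst c \<inter> fst c')) (transition c c')"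
    using smooth_on_open_iff[OF overlap_open[OF assms(1,2)]] unfolding holomorphic_map_on_def by blast
  then have "transition c c' differentiable at (snd c p)" using assms by auto
  then show "(transition c c' has_derivative T) (at (snd c p))"
    unfolding T_def by (simp add: frechet_derivative_works)
  show "T (Jm v) = Jm (T v)"
    using h assms unfolding holomorphic_map_on_def by blast
qed

lemma curve_in_chart_open:
  fixes a b :: real
  assumes "continuous_map (top_of_set {a..b}) X \<gamma>" "c \<in> A"
  shows "open {t \<in> {a<..<b}. \<gamma> t \<in> fst c}"
proof -
  have "openin (top_of_set {a..b}) {t \<in> {a..b}. \<gamma> t \<in> fst c}"
    using openin_continuous_map_preimage[OF assms(1) chart_open[OF assms(2)]] by simp
  from this[unfolded openin_open] obtain T where T: "open T \<and> {t \<in> {a..b}. \<gamma> t \<in> fst c} = {a..b} \<inter> T"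
    by (rule exE)
  have H: "t \<in> {t \<in> {a..b}. \<gamma> t \<in> fst c} \<longleftrightarrow> t \<in> {a..b} \<inter> T" for t
    by (simp only: T)
  have "\<gamma> t \<in> fst c \<longleftrightarrow> t \<in> T" if "t \<in> {a<..<b}" for t
    using that H[of t] by auto
  then have "{t \<in> {a<..<b}. \<gamma> t \<in> fst c} = {a<..<b} \<inter> T" by blast
  moreover have "open ({a<..<b} \<inter> T)" using T by (simp add: open_Int)
  ultimately show ?thesis by simp
qed

lemma chart_change_deriv:
  assumes \<gamma>: "continuous_map (top_of_set {a..b}) X \<gamma>" and t: "t \<in> {a<..<b}"
    and c: "c \<in> A" "\<gamma> t \<in> fst c" and c': "c' \<in> A" "\<gamma> t \<in> fst c'"
    and w: "((snd c \<circ> \<gamma>) has_vector_derivative w) (at t)"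
  shows "((snd c' \<circ> \<gamma>) has_vector_derivative frechet_derivative (transition c c') (at (snd c (\<gamma> t))) w) (at t)"
proof -
  let ?T = "frechet_derivative (transition c c') (at (snd c (\<gamma> t)))"
  have T: "(transition c c' has_derivative ?T) (at ((snd c \<circ> \<gamma>) t))"
    using transition_smooth(1) c c' by simp
  have lin: "linear ?T" using T has_derivative_linear by blast
  have "((\<lambda>s. transition c c' ((snd c \<circ> \<gamma>) s)) has_derivative (\<lambda>x. ?T (x *\<^sub>R w))) (at t)"
    using has_derivative_compose[OF w[unfolded has_vector_derivative_def] T] .
  moreover have "(\<lambda>x. ?T (x *\<^sub>R w)) = (\<lambda>x. x *\<^sub>R ?T w)" by (simp only: linear_cmul[OF lin])
  ultimately have "((\<lambda>s. transition c c' ((snd c \<circ> \<gamma>) s)) has_vector_derivative ?T w) (at t)"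
    unfolding has_vector_derivative_def by simp
  then show ?thesis
    by (rule has_vector_derivative_transform_within_open[OF _ curve_in_chart_open[OF \<gamma> c(1)]])
       (use t c in \<open>auto simp: transition_def\<close>)
qed

text \<open>The definition of \<open>speed\<close> picks some chart. The pullback rule of the form,
  together with complex linearity of the differential of a transition map, gives the same value in
  every chart.\<close>

lemma speed_eq:
  assumes \<omega>: "smooth_two_form A \<omega>"
    and \<gamma>: "continuous_map (top_of_set {a..b}) X \<gamma>" and t: "t \<in> {a<..<b}"
    and c: "c \<in> A" "\<gamma> t \<in> fst c"
    and w: "((snd c \<circ> \<gamma>) has_vector_derivative w) (at t)"
  shows "speed A \<omega> \<gamma> t = sqrt (\<omega> c (snd c (\<gamma> t)) w (Jm w))"
proof -
  define c' where "c' = (SOME c. c \<in> A \<and> \<gamma> t \<in> fst c)"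
  have c': "c' \<in> A" "\<gamma> t \<in> fst c'" using someI[of "\<lambda>c. c \<in> A \<and> \<gamma> t \<in> fst c" c] c by (auto simp: c'_def)
  let ?T = "frechet_derivative (transition c c') (at (snd c (\<gamma> t)))"
  have "vector_derivative (snd c' \<circ> \<gamma>) (at t) = ?T w"
    by (rule vector_derivative_at[OF chart_change_deriv[OF \<gamma> t c c' w]])
  then have "speed A \<omega> \<gamma> t = sqrt (\<omega> c' (snd c' (\<gamma> t)) (?T w) (Jm (?T w)))"
    unfolding speed_def Let_def c'_def[symmetric] by simp
  also have "Jm (?T w) = ?T (Jm w)" using transition_smooth(2)[OF c(1) c'(1) c(2) c'(2)] by simp
  also have "\<omega> c' (snd c' (\<gamma> t)) (?T w) (?T (Jm w)) = \<omega> c (snd c (\<gamma> t)) w (Jm w)"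
  proof -
    have "\<forall>c\<in>A. \<forall>c'\<in>A. \<forall>p\<in>fst c \<inter> fst c'. \<forall>u v. \<omega> c (snd c p) u v =
        \<omega> c' (snd c' p) (frechet_derivative (transition c c') (at (snd c p)) u)
                        (frechet_derivative (transition c c') (at (snd c p)) v)"
      using \<omega> unfolding smooth_two_form_def by (elim conjE)
    from this[rule_format, OF c(1) c'(1) IntI[OF c(2) c'(2)], of w "Jm w"] show ?thesis by (rule sym)
  qed
  finally show ?thesis .
qed

text \<open>Smoothness of a form is given for constant vectors only. Expansion in a basis reduces
  moving vectors to finitely many coefficients.\<close>

lemma two_form_continuous:
  assumes \<omega>: "smooth_two_form A \<omega>" and c: "c \<in> A"
    and f: "continuous_on T f" "\<And>t. t \<in> T \<Longrightarrow> f t \<in> cimage c" and g: "continuous_on T g" "continuous_on T h"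
  shows "continuous_on T (\<lambda>t. \<omega> c (f t) (g t) (h t))"
proof -
  have "continuous_on (cimage c) (\<lambda>z. \<omega> c z u v)" for u v
    using two_form_smooth[OF \<omega> c, of u v] unfolding smooth_on_open_iff[OF cimage_open[OF c]]
    by (metis C_k_on.simps(1))
  then have "continuous_on T (\<lambda>t. \<omega> c (f t) u v)" for u v
    by (rule continuous_on_compose2[OF _ f(1)]) (use f in auto)
  then have "continuous_on T (\<lambda>t. \<Sum>i\<in>Basis. \<Sum>j\<in>Basis. ((g t \<bullet> i) * (h t \<bullet> j)) * \<omega> c (f t) i j)"
    by (intro continuous_intros g)
  moreover have "\<omega> c (f t) (g t) (h t) = (\<Sum>i\<in>Basis. \<Sum>j\<in>Basis. ((g t \<bullet> i) * (h t \<bullet> j)) * \<omega> c (f t) i j)"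
    if "t \<in> T" for t
    by (rule bilinear_basis_expand[OF two_form_bilinear[OF \<omega> c f(2)[OF that]]])
  ultimately show ?thesis using continuous_on_cong by force
qed

text \<open>F is the local smooth extension of the curve in the chart. It has two-sided derivatives
  even at the ends a and b, where the curve itself may not.\<close>

lemma smooth_curve_local:
  assumes \<gamma>: "continuous_map (top_of_set {a..b}) X \<gamma>" and sm: "smooth_curve_on A {a..b} \<gamma>" and t: "t \<in> {a..b}"
  obtains c F d where "c \<in> A" "\<And>k. C_k_on k (ball t d) F" "0 < d"
    "\<And>s. s \<in> {a..b} \<inter> ball t d \<Longrightarrow> \<gamma> s \<in> fst c \<and> F s = snd c (\<gamma> s)"
proof -
  obtain c where c: "c \<in> A" "\<gamma> t \<in> fst c" "smooth_on {s \<in> {a..b}. \<gamma> s \<in> fst c} (snd c \<circ> \<gamma>)"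
    using sm t unfolding smooth_curve_on_def by blast
  then obtain U F where U: "open U" "t \<in> U" "\<forall>k. C_k_on k U F"
      "\<forall>s\<in>{s \<in> {a..b}. \<gamma> s \<in> fst c} \<inter> U. F s = (snd c \<circ> \<gamma>) s"
    using t unfolding smooth_on_def by blast
  have "openin (top_of_set {a..b}) {t \<in> {a..b}. \<gamma> t \<in> fst c}"
    using openin_continuous_map_preimage[OF \<gamma> chart_open[OF c(1)]] by simp
  from this[unfolded openin_open] obtain V where V: "open V \<and> {t \<in> {a..b}. \<gamma> t \<in> fst c} = {a..b} \<inter> V"
    by (rule exE)
  have V': "s \<in> {t \<in> {a..b}. \<gamma> t \<in> fst c} \<longleftrightarrow> s \<in> {a..b} \<inter> V" for s
    by (simp only: V)
  have "t \<in> U \<inter> V" using U(2) V'[of t] c t by simp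
  then obtain d where d: "0 < d" "ball t d \<subseteq> U \<inter> V" using U(1) V by (meson open_Int open_contains_ball)
  show ?thesis
  proof (rule that[OF c(1) _ d(1)])
    show "C_k_on k (ball t d) F" for k using U d C_k_on_subset by blast
    show "\<gamma> s \<in> fst c \<and> F s = snd c (\<gamma> s)" if "s \<in> {a..b} \<inter> ball t d" for s
    proof -
      have s: "s \<in> {a..b}" "s \<in> U" "s \<in> V" using that d by auto
      with V'[of s] have "\<gamma> s \<in> fst c" by simp
      with U(4) s show ?thesis by simp
    qed
  qed
qed

lemma smooth_real_deriv:
  fixes F :: "real \<Rightarrow> complex ^ 'n"
  assumes "\<And>k. C_k_on k (ball t d) F"
  shows "s \<in> ball t d \<Longrightarrow> (F has_vector_derivative frechet_derivative F (at s) 1) (at s)"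
    and "continuous_on (ball t d) F" "continuous_on (ball t d) (\<lambda>s. frechet_derivative F (at s) 1)"
proof -
  assume "s \<in> ball t d"
  then have "F differentiable at s" using assms[of 1] by simp
  then have D: "(F has_derivative frechet_derivative F (at s)) (at s)" by (simp add: frechet_derivative_works)
  have "frechet_derivative F (at s) x = x *\<^sub>R frechet_derivative F (at s) 1" for x
    using linear_cmul[OF has_derivative_linear[OF D], of x 1] by simp
  then show "(F has_vector_derivative frechet_derivative F (at s) 1) (at s)"
    unfolding has_vector_derivative_def using D by (metis (no_types, lifting) ext)
next
  show "continuous_on (ball t d) F" using assms[of 0] by simp
  show "continuous_on (ball t d) (\<lambda>s. frechet_derivative F (at s) 1)" using assms[of 1] by simp
qed

lemma smooth_curve_deriv:
  assumes \<gamma>: "continuous_map (top_of_set {a..b}) X \<gamma>" and sm: "smooth_curve_on A {a..b} \<gamma>"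
    and t: "t \<in> {a<..<b}" and c: "c \<in> A" "\<gamma> t \<in> fst c"
  shows "\<exists>w. ((snd c \<circ> \<gamma>) has_vector_derivative w) (at t)"
proof -
  have t': "t \<in> {a..b}" using t by simp
  obtain c' F d where F: "c' \<in> A" "\<And>k. C_k_on k (ball t d) F" "0 < d"
      "\<And>s. s \<in> {a..b} \<inter> ball t d \<Longrightarrow> \<gamma> s \<in> fst c' \<and> F s = snd c' (\<gamma> s)"
    by (rule smooth_curve_local[OF \<gamma> sm t'], rule that)
  have "((snd c' \<circ> \<gamma>) has_vector_derivative frechet_derivative F (at t) 1) (at t)"
    by (rule has_vector_derivative_transform_within_open[OF smooth_real_deriv(1)[OF F(2)], where S = "{a<..<b} \<inter> ball t d"])
       (use F t in auto)
  from chart_change_deriv[OF \<gamma> t F(1) _ c this] F t show ?thesis by auto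
qed

text \<open>Near each point the speed agrees, except possibly at the ends of a small interval, with
  a continuous function built from the local extension F. Bisection glues these intervals.\<close>

lemma smooth_curve_speed_integrable:
  assumes \<omega>: "smooth_two_form A \<omega>" and ab: "a \<le> b"
    and \<gamma>: "continuous_map (top_of_set {a..b}) X \<gamma>" and sm: "smooth_curve_on A {a..b} \<gamma>"
  shows "speed A \<omega> \<gamma> integrable_on {a..b}"
proof -
  define P where "P u v \<longleftrightarrow> u \<le> v \<longrightarrow> {u..v} \<subseteq> {a..b} \<longrightarrow> speed A \<omega> \<gamma> integrable_on {u..v}" for u v
  from ab have "P a b"
  proof (induction rule: Bolzano)
    case (trans u v w)
    then show ?case unfolding P_def
      by (auto intro!: Henstock_Kurzweil_Integration.integrable_combine[of u v w])
  next
    case (local t)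
    then have t: "t \<in> {a..b}" by simp
    obtain c F d where F: "c \<in> A" "\<And>k. C_k_on k (ball t d) F" "0 < d"
      "\<And>s. s \<in> {a..b} \<inter> ball t d \<Longrightarrow> \<gamma> s \<in> fst c \<and> F s = snd c (\<gamma> s)"
      by (rule smooth_curve_local[OF \<gamma> sm t], rule that)
    have "P u v" if uv: "u \<le> t" "t \<le> v" "v - u < d" for u v
      unfolding P_def
    proof (intro impI)
      assume sub: "{u..v} \<subseteq> {a..b}"
      let ?D = "\<lambda>s. frechet_derivative F (at s) 1"
      let ?g = "\<lambda>s. sqrt (\<omega> c (F s) (?D s) (Jm (?D s)))"
      have uvb: "{u..v} \<subseteq> ball t d" using uv by (auto simp: dist_real_def)
      have "continuous_on {u..v} ?g"
        using continuous_on_subset[OF smooth_real_deriv(2)[OF F(2)] uvb]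
          continuous_on_subset[OF smooth_real_deriv(3)[OF F(2)] uvb] F sub uvb
        by (intro continuous_intros two_form_continuous[OF \<omega> F(1)]) auto
      then have "?g integrable_on {u..v}" by (rule integrable_continuous_interval)
      then show "speed A \<omega> \<gamma> integrable_on {u..v}"
      proof (rule integrable_spike_finite[of "{u, v}", rotated 2])
        fix s assume s: "s \<in> {u..v} - {u, v}"
        have s': "s \<in> {a<..<b}" "s \<in> {a..b} \<inter> ball t d" 
        proof -
          have "u \<in> {a..b}" "v \<in> {a..b}" using sub uv by (auto simp: subset_iff)
          then show "s \<in> {a<..<b}" "s \<in> {a..b} \<inter> ball t d" using s uvb by auto
        qed
        have "((snd c \<circ> \<gamma>) has_vector_derivative ?D s) (at s)"
          by (rule has_vector_derivative_transform_within_open[OF smooth_real_deriv(1)[OF F(2)], where S = "{a<..<b} \<inter> ball t d"])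
             (use F s' in auto)
        from speed_eq[OF \<omega> \<gamma> s'(1) F(1) _ this] show "speed A \<omega> \<gamma> s = ?g s"
          using F(4)[OF s'(2)] by simp
      qed simp
    qed
    then show ?case using F(3) by blast
  qed
  then show ?thesis using ab unfolding P_def by auto
qed

end

section \<open>Lengths, concatenation and segments on the manifold\<close>

context cmanifold
begin

lemma pw_curve_cont_sub:
  assumes "pw_curve X A a b \<gamma>" "{u..v} \<subseteq> {a..b}"
  shows "continuous_map (top_of_set {u..v}) X \<gamma>"
  using assms continuous_map_from_subtopology_mono unfolding pw_curve_def by blast

lemma pw_curve_in_X:
  assumes "pw_curve X A a b \<gamma>" "t \<in> {a..b}" shows "\<gamma> t \<in> topspace X"
  using assms unfolding pw_curve_def continuous_map_def by auto

lemma pw_curve_le: assumes "pw_curve X A a b \<gamma>" shows "a \<le> b"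
proof -
  obtain m and s :: "nat \<Rightarrow> real" where "s 0 = a" "s m = b" "\<And>i. i < m \<Longrightarrow> s i < s (Suc i)"
    using assms unfolding pw_curve_def by blast
  then show ?thesis using partition_mono[of m s 0 m] by simp
qed

text \<open>The exceptional points are the break points, among them a and b. Between two of them
  smoothness yields a two-sided derivative.\<close>

lemma pw_curve_deriv:
  assumes \<gamma>: "pw_curve X A a b \<gamma>"
  obtains B where "finite B" "\<And>t c. t \<in> {a..b} - B \<Longrightarrow> c \<in> A \<Longrightarrow> \<gamma> t \<in> fst c \<Longrightarrow>
     t \<in> {a<..<b} \<and> (\<exists>w. ((snd c \<circ> \<gamma>) has_vector_derivative w) (at t))"
proof -
  obtain m and s :: "nat \<Rightarrow> real" where s: "s 0 = a" "s m = b"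
      "\<And>i. i < m \<Longrightarrow> s i < s (Suc i)" "\<And>i. i < m \<Longrightarrow> smooth_curve_on A {s i..s (Suc i)} \<gamma>"
    using \<gamma> unfolding pw_curve_def by blast
  show ?thesis
  proof (rule that[of "s ` {..m}"])
    fix t c assume t: "t \<in> {a..b} - s ` {..m}" and c: "c \<in> A" "\<gamma> t \<in> fst c"
    then obtain i where i: "i < m" "s i < t" "t < s (Suc i)" using partition_cover[of t s m] s by auto
    have ab: "a \<le> s i" "s (Suc i) \<le> b"
      using partition_mono[of m s 0 i] partition_mono[of m s "Suc i" m] s i by auto
    then have "{s i..s (Suc i)} \<subseteq> {a..b}" by auto
    from smooth_curve_deriv[OF pw_curve_cont_sub[OF \<gamma> this] s(4)[OF i(1)] _ c] i ab
    show "t \<in> {a<..<b} \<and> (\<exists>w. ((snd c \<circ> \<gamma>) has_vector_derivative w) (at t))" by auto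
  qed simp
qed

lemma pw_curve_speed_integrable:
  assumes \<omega>: "smooth_two_form A \<omega>" and \<gamma>: "pw_curve X A a b \<gamma>"
  shows "speed A \<omega> \<gamma> integrable_on {a..b}"
proof -
  obtain m and s :: "nat \<Rightarrow> real" where s: "s 0 = a" "s m = b"
      "\<And>i. i < m \<Longrightarrow> s i < s (Suc i)" "\<And>i. i < m \<Longrightarrow> smooth_curve_on A {s i..s (Suc i)} \<gamma>"
    using \<gamma> unfolding pw_curve_def by blast
  have "speed A \<omega> \<gamma> integrable_on {s 0..s j}" if "j \<le> m" for j
    using that
  proof (induction j)
    case 0
    then show ?case by (simp add: integrable_on_refl[of _ "s 0", simplified])
  next
    case (Suc j)
    have le: "s 0 \<le> s j" "s j \<le> s (Suc j)" using partition_mono[of m s 0 j] s(3)[of j] Suc.prems s by (auto simp: Suc_le_eq less_imp_le)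
    have sub: "{s j..s (Suc j)} \<subseteq> {a..b}"
      using partition_mono[of m s "Suc j" m] le s Suc by auto
    have 1: "speed A \<omega> \<gamma> integrable_on {s j..s (Suc j)}"
      by (rule smooth_curve_speed_integrable[OF \<omega> le(2) pw_curve_cont_sub[OF \<gamma> sub] s(4)]) (use Suc in simp)
    have 2: "speed A \<omega> \<gamma> integrable_on {s 0..s j}" using Suc by simp
    show ?case by (rule Henstock_Kurzweil_Integration.integrable_combine[OF le 2 1])
  qed
  from this[of m] s show ?thesis by simp
qed

text \<open>The velocity in the chart is bounded by the speed divided by lo, and integrates to the
  displacement. This estimate is what confines short curves to a chart.\<close>

lemma displacement_le_length:
  assumes \<omega>: "smooth_two_form A \<omega>" and \<gamma>: "pw_curve X A a b \<gamma>"
    and uv: "a \<le> u" "u \<le> v" "v \<le> b" and c: "c \<in> A"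
    and D: "\<And>s. s \<in> {u..v} \<Longrightarrow> \<gamma> s \<in> fst c \<and> snd c (\<gamma> s) \<in> D"
    and lo: "\<And>z w. z \<in> D \<Longrightarrow> lo * norm w \<le> sqrt (\<omega> c z w (Jm w))" and lo0: "0 < lo"
  shows "norm (snd c (\<gamma> v) - snd c (\<gamma> u)) \<le> integral {u..v} (speed A \<omega> \<gamma>) / lo"
proof -
  obtain B where B: "finite B" "\<And>t c. t \<in> {a..b} - B \<Longrightarrow> c \<in> A \<Longrightarrow> \<gamma> t \<in> fst c \<Longrightarrow>
     t \<in> {a<..<b} \<and> (\<exists>w. ((snd c \<circ> \<gamma>) has_vector_derivative w) (at t))"
    by (rule pw_curve_deriv[OF \<gamma>], rule that)
  let ?f = "snd c \<circ> \<gamma>"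
  \<comment> \<open>At break points the two-sided derivative may fail to exist, so the velocity gets
    the value 0 there.\<close>
  define g where "g t = (if t \<in> B then 0 else vector_derivative ?f (at t))" for t
  have sub: "{u..v} \<subseteq> {a..b}" using uv by auto
  have cont: "continuous_on {u..v} ?f"
  proof -
    have "continuous_map (top_of_set {u..v}) (subtopology X (fst c)) \<gamma>"
      using pw_curve_cont_sub[OF \<gamma> sub] D by (auto simp: continuous_map_in_subtopology)
    from continuous_map_compose[OF this chart_cont[OF c]] show ?thesis by simp
  qed
  have der: "(?f has_vector_derivative g t) (at t) \<and> t \<in> {a<..<b}" if "t \<in> {u<..<v} - B" for t
  proof -
    have "t \<in> {a..b} - B" "\<gamma> t \<in> fst c" using that sub D[of t] by auto
    from B(2)[OF this(1) c this(2)] show ?thesis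
      using that by (auto simp: g_def vector_derivative_works[symmetric] intro: differentiableI_vector)
  qed
  have "(g has_integral (?f v - ?f u)) {u..v}"
    by (rule fundamental_theorem_of_calculus_interior_strong[OF B(1) uv(2) _ cont]) (use der in auto)
  moreover have I: "speed A \<omega> \<gamma> integrable_on {u..v}"
    using integrable_on_subinterval[OF pw_curve_speed_integrable[OF \<omega> \<gamma>], of u v] sub by simp
  ultimately have "norm (?f v - ?f u) \<le> integral {u..v} (\<lambda>t. speed A \<omega> \<gamma> t / lo)"
  proof -
    assume g: "(g has_integral (?f v - ?f u)) {u..v}"
    define g' where "g' t = (if t \<in> {u,v} then 0 else g t)" for t
    have g': "(g' has_integral (?f v - ?f u)) {u..v}"
      by (rule has_integral_spike_finite[OF _ _ g, of "{u,v}"]) (auto simp: g'_def)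
    have sp: "norm (g' t) \<le> speed A \<omega> \<gamma> t / lo" if t: "t \<in> {u..v} - (B \<union> {u,v})" for t
    proof -
      have *: "(?f has_vector_derivative g t) (at t)" "t \<in> {a<..<b}" using der[of t] t by auto
      have "lo * norm (g t) \<le> speed A \<omega> \<gamma> t"
        using speed_eq[OF \<omega> _ *(2) c _ *(1)] lo[of "snd c (\<gamma> t)" "g t"] D[of t] t \<gamma>
        by (auto simp: pw_curve_def)
      then show ?thesis using lo0 t by (simp add: g'_def field_simps)
    qed
    define h where "h t = (if t \<in> B \<union> {u,v} then 0 else speed A \<omega> \<gamma> t / lo)" for t
    have I2: "(\<lambda>t. speed A \<omega> \<gamma> t / lo) integrable_on {u..v}" using I by (rule integrable_on_divide)
    have hI: "h integrable_on {u..v}"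
      by (rule integrable_spike_finite[OF _ _ I2, of "B \<union> {u,v}"]) (use B in \<open>auto simp: h_def\<close>)
    have "norm (integral {u..v} g') \<le> integral {u..v} h"
      by (rule integral_norm_bound_integral[OF has_integral_integrable[OF g'] hI])
         (use sp in \<open>auto simp: h_def g'_def g_def\<close>)
    also have "integral {u..v} h = integral {u..v} (\<lambda>t. speed A \<omega> \<gamma> t / lo)"
      by (rule integral_spike[of "B \<union> {u,v}"]) (use B in \<open>auto simp: h_def\<close>)
    finally show ?thesis using integral_unique[OF g'] by simp
  qed
  then show ?thesis by simp
qed

text \<open>Existence of a curve as a relation between its end points: concatenation becomes a
  composition rule that adds the bounds. The condition Q depends on the parameter because closeness
  to another curve is required at equal times.\<close>

definition path_ex ::
    "('a, 'n) two_form \<Rightarrow> (real \<Rightarrow> 'a \<Rightarrow> bool) \<Rightarrow> real \<Rightarrow> real \<Rightarrow> 'a \<Rightarrow> 'a \<Rightarrow> real \<Rightarrow> bool" where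
  "path_ex \<omega> Q a b p q L \<longleftrightarrow> (\<exists>\<gamma>. pw_curve X A a b \<gamma> \<and> \<gamma> a = p \<and> \<gamma> b = q \<and>
     integral {a..b} (speed A \<omega> \<gamma>) \<le> L \<and> (\<forall>t\<in>{a..b}. Q t (\<gamma> t)))"

lemma path_ex_mono:
  assumes "path_ex \<omega> Q a b p q L" "L \<le> L'" "\<And>t x. t \<in> {a..b} \<Longrightarrow> Q t x \<Longrightarrow> Q' t x"
  shows "path_ex \<omega> Q' a b p q L'"
proof -
  obtain \<gamma> where "pw_curve X A a b \<gamma>" "\<gamma> a = p" "\<gamma> b = q"
     "integral {a..b} (speed A \<omega> \<gamma>) \<le> L" "\<forall>t\<in>{a..b}. Q t (\<gamma> t)" using assms(1) unfolding path_ex_def by blast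
  then show ?thesis unfolding path_ex_def using assms(2,3) by (intro exI[of _ \<gamma>]) auto
qed

lemma speed_local:
  assumes "open U" "t \<in> U" "\<And>s. s \<in> U \<Longrightarrow> \<gamma> s = \<eta> s"
  shows "speed A \<omega> \<gamma> t = speed A \<omega> \<eta> t"
proof -
  have "eventually (\<lambda>s. (snd c \<circ> \<gamma>) s = (snd c \<circ> \<eta>) s) (nhds t)" for c :: "('a, 'n) chart"
    using assms unfolding eventually_nhds by auto
  then have "vector_derivative (snd c \<circ> \<gamma>) (at t) = vector_derivative (snd c \<circ> \<eta>) (at t)" for c :: "('a, 'n) chart"
    by (intro vector_derivative_cong_eq refl) simp_all
  moreover have "\<gamma> t = \<eta> t" using assms by blast
  ultimately show ?thesis unfolding speed_def by simp
qed

lemma pw_curve_join: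
  assumes 1: "pw_curve X A a b \<gamma>" and 2: "pw_curve X A b d \<eta>" and eq: "\<gamma> b = \<eta> b"
  shows "pw_curve X A a d (\<lambda>t. if t \<le> b then \<gamma> t else \<eta> t)" (is "pw_curve X A a d ?g")
proof -
  note le = pw_curve_le[OF 1] pw_curve_le[OF 2]
  have "continuous_map (top_of_set {a..d}) X ?g"
  proof (rule continuous_map_cases_le)
    have e1: "{t \<in> topspace (top_of_set {a..d}). t \<le> b} = {a..b}" and e2: "{t \<in> topspace (top_of_set {a..d}). b \<le> t} = {b..d}"
      using le by auto
    show "continuous_map (subtopology (top_of_set {a..d}) {t \<in> topspace (top_of_set {a..d}). t \<le> b}) X \<gamma>"
      "continuous_map (subtopology (top_of_set {a..d}) {t \<in> topspace (top_of_set {a..d}). b \<le> t}) X \<eta>"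
      unfolding e1 e2 using 1 2 le by (simp_all add: subtopology_subtopology pw_curve_def Int_absorb1)
  qed (use eq in auto)
  moreover
  obtain m1 and s1 :: "nat \<Rightarrow> real" where s1: "s1 0 = a" "s1 m1 = b"
      "\<And>i. i < m1 \<Longrightarrow> s1 i < s1 (Suc i) \<and> smooth_curve_on A {s1 i..s1 (Suc i)} \<gamma>"
    using 1 unfolding pw_curve_def by blast
  obtain m2 and s2 :: "nat \<Rightarrow> real" where s2: "s2 0 = b" "s2 m2 = d"
      "\<And>i. i < m2 \<Longrightarrow> s2 i < s2 (Suc i) \<and> smooth_curve_on A {s2 i..s2 (Suc i)} \<eta>"
    using 2 unfolding pw_curve_def by blast
  \<comment> \<open>At index m1 both partitions give b, so the formula with the shifted index is
    valid from m1 on.\<close>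
  define s where "s i = (if i \<le> m1 then s1 i else s2 (i - m1))" for i
  have "s i < s (Suc i) \<and> smooth_curve_on A {s i..s (Suc i)} ?g" if i: "i < m1 + m2" for i
  proof (cases "i < m1")
    case True
    then have e: "s i = s1 i" "s (Suc i) = s1 (Suc i)" by (auto simp: s_def)
    have "s1 (Suc i) \<le> b" using partition_mono[of m1 s1 "Suc i" m1] s1 True by auto
    then have "smooth_curve_on A {s1 i..s1 (Suc i)} ?g \<longleftrightarrow> smooth_curve_on A {s1 i..s1 (Suc i)} \<gamma>"
      by (intro smooth_curve_on_cong) auto
    then show ?thesis using s1(3)[OF True] e by simp
  next
    case False
    then have j: "i - m1 < m2" using i by simp
    have e: "s i = s2 (i - m1)" "s (Suc i) = s2 (Suc (i - m1))"
      using False s1 s2 by (auto simp: s_def Suc_diff_le)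
    have "b \<le> s2 (i - m1)" using partition_mono[of m2 s2 0 "i - m1"] s2 j by auto
    then have "smooth_curve_on A {s2 (i - m1)..s2 (Suc (i - m1))} ?g
        \<longleftrightarrow> smooth_curve_on A {s2 (i - m1)..s2 (Suc (i - m1))} \<eta>"
    proof (intro smooth_curve_on_cong)
      fix t assume "t \<in> {s2 (i - m1)..s2 (Suc (i - m1))}"
      then have "b \<le> t" using \<open>b \<le> s2 (i - m1)\<close> by simp
      then show "?g t = \<eta> t" using eq by (cases "t = b") auto
    qed
    then show ?thesis using s2(3)[OF j] e by simp
  qed
  moreover have "s 0 = a" "s (m1 + m2) = d" using s1 s2 by (auto simp: s_def)
  ultimately show ?thesis unfolding pw_curve_def by blast
qed

lemma path_ex_trans:
  assumes \<omega>: "smooth_two_form A \<omega>"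
    and 1: "path_ex \<omega> Q a b p q L" and 2: "path_ex \<omega> Q b d q r L'"
  shows "path_ex \<omega> Q a d p r (L + L')"
proof -
  obtain \<gamma> where \<gamma>: "pw_curve X A a b \<gamma>" "\<gamma> a = p" "\<gamma> b = q"
     "integral {a..b} (speed A \<omega> \<gamma>) \<le> L" "\<And>t. t\<in>{a..b} \<Longrightarrow> Q t (\<gamma> t)" using 1 unfolding path_ex_def by blast
  obtain \<eta> where \<eta>: "pw_curve X A b d \<eta>" "\<eta> b = q" "\<eta> d = r"
     "integral {b..d} (speed A \<omega> \<eta>) \<le> L'" "\<And>t. t\<in>{b..d} \<Longrightarrow> Q t (\<eta> t)" using 2 unfolding path_ex_def by blast
  let ?g = "\<lambda>t. if t \<le> b then \<gamma> t else \<eta> t"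
  note le = pw_curve_le[OF \<gamma>(1)] pw_curve_le[OF \<eta>(1)]
  have g: "pw_curve X A a d ?g" by (rule pw_curve_join[OF \<gamma>(1) \<eta>(1)]) (simp add: \<gamma> \<eta>)
  \<comment> \<open>The joined curve may have a corner at b; its speed there is spiked away in both
    integrals.\<close>
  have sg: "speed A \<omega> ?g t = speed A \<omega> \<gamma> t" if "t < b" for t
    by (rule speed_local[of "{..<b}"]) (use that in auto)
  have sh: "speed A \<omega> ?g t = speed A \<omega> \<eta> t" if "b < t" for t
    by (rule speed_local[of "{b<..}"]) (use that in auto)
  have "integral {a..d} (speed A \<omega> ?g) = integral {a..b} (speed A \<omega> ?g) + integral {b..d} (speed A \<omega> ?g)"
    using le pw_curve_speed_integrable[OF \<omega> g] by (simp add: Henstock_Kurzweil_Integration.integral_combine)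
  also have "integral {a..b} (speed A \<omega> ?g) = integral {a..b} (speed A \<omega> \<gamma>)"
    by (rule integral_spike[of "{b}"]) (use sg in auto)
  also have "integral {b..d} (speed A \<omega> ?g) = integral {b..d} (speed A \<omega> \<eta>)"
    by (rule integral_spike[of "{b}"]) (use sh in auto)
  finally have 1: "integral {a..d} (speed A \<omega> ?g) \<le> L + L'" using \<gamma> \<eta> by simp
  have 2: "?g a = p" using \<gamma>(2) le by simp
  have 3: "?g d = r" using \<gamma>(3) \<eta>(2,3) le by (cases "d = b") auto
  have 4: "\<forall>t\<in>{a..d}. Q t (?g t)" using \<gamma>(5) \<eta>(5) by auto
  show ?thesis unfolding path_ex_def by (rule exI[of _ ?g]) (intro conjI g 1 2 3 4)
qed

text \<open>The segment is run through at constant coordinate velocity over the given interval. The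
  factor r in the speed cancels the 1/r of the substitution, so the bound does not depend on the
  interval.\<close>

lemma path_ex_segment:
  assumes \<omega>: "smooth_two_form A \<omega>" and c: "c \<in> A" and ab: "a < b"
    and p: "p \<in> fst c" and q: "q \<in> fst c" and D: "closed_segment (snd c p) (snd c q) \<subseteq> D" "D \<subseteq> cimage c"
  shows "path_ex \<omega> (\<lambda>t x. x \<in> fst c \<and> snd c x \<in> D) a b p q (segment_length (\<omega> c) (snd c p) (snd c q))"
proof -
  define z d where "z = snd c p" and "d = snd c q - snd c p"
  define r where "r = 1 / (b - a)"
  define f where "f t = (z - (r * a) *\<^sub>R d) + t *\<^sub>R (r *\<^sub>R d)" for t
  have r: "0 < r" using ab by (simp add: r_def)
  have f_eq: "f t = z + (r * t + - (r * a)) *\<^sub>R d" for t by (simp add: f_def algebra_simps)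
  have unit: "r * t + - (r * a) \<in> {0..1}" if "t \<in> {a..b}" for t
  proof -
    have "r * t + - (r * a) = (t - a) / (b - a)" by (simp add: r_def diff_divide_distrib)
    then show ?thesis using that ab by simp
  qed
  have fD: "f t \<in> D" if "t \<in> {a..b}" for t
    using affine_in_segment[OF unit[OF that], of z "snd c q"] D(1)
    unfolding f_eq d_def z_def by blast
  have fc: "f t \<in> cimage c" if "t \<in> {a..b}" for t using fD[OF that] D(2) by blast
  have rab: "r * b + - (r * a) = 1" using ab by (simp add: r_def flip: diff_divide_distrib)
  let ?g = "cinv c \<circ> f"
  have cf: "continuous_on S f" for S unfolding f_def by (intro continuous_intros)
  have "continuous_map (top_of_set {a..b}) (top_of_set (cimage c)) f"
    using cf[of "{a..b}"] fc by (auto simp: continuous_map_in_subtopology)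
  from continuous_map_compose[OF this cinv_cont[OF c]]
  have cont: "continuous_map (top_of_set {a..b}) X ?g" .
  have sm: "smooth_curve_on A {a..b} ?g"
    unfolding smooth_curve_on_def
  proof
    fix t assume t: "t \<in> {a..b}"
    have "smooth_on {s \<in> {a..b}. ?g s \<in> fst c} f"
      unfolding f_def by (rule smooth_on_affine)
    then have "smooth_on {s \<in> {a..b}. ?g s \<in> fst c} (snd c \<circ> ?g)"
      by (rule smooth_on_cong[THEN iffD1, rotated]) (use fc in auto)
    then show "\<exists>c\<in>A. ?g t \<in> fst c \<and> smooth_on {s \<in> {a..b}. ?g s \<in> fst c} (snd c \<circ> ?g)"
      using c fc[OF t] by (intro bexI[of _ c]) auto
  qed
  have pw: "pw_curve X A a b ?g"
    unfolding pw_curve_def using cont sm ab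
    by (intro conjI exI[of _ 1] exI[of _ "\<lambda>i::nat. if i = 0 then a else b"]) auto
  let ?h = "\<lambda>s. sqrt (\<omega> c (z + s *\<^sub>R d) d (Jm d))"
  have zs: "z + s *\<^sub>R d \<in> cimage c" if "s \<in> {0..1}" for s
    using affine_in_segment[OF that, of z "snd c q"] D unfolding d_def z_def by blast
  have "continuous_on {0..1} ?h"
    by (intro continuous_intros two_form_continuous[OF \<omega> c]) (use zs in auto)
  then have "(?h has_integral segment_length (\<omega> c) z (snd c q)) (cbox 0 1)"
    unfolding segment_length_def d_def z_def
    by (simp add: integrable_integral integrable_continuous_interval)
  from has_integral_affinity[OF this, of r "- (r * a)"] r
  have "((\<lambda>t. ?h (r * t + - (r * a))) has_integral segment_length (\<omega> c) z (snd c q) / r)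
      ((\<lambda>x. (1/r) *\<^sub>R x + - ((1/r) *\<^sub>R (- (r * a)))) ` cbox 0 1)"
    by simp
  also have "(\<lambda>x. (1/r) *\<^sub>R x + - ((1/r) *\<^sub>R (- (r * a)))) ` cbox 0 1 = {a..b}"
  proof -
    have "(\<lambda>x. (1/r) *\<^sub>R x + - ((1/r) *\<^sub>R (- (r * a)))) = (\<lambda>x. (b - a) * x + a)"
      using r ab by (auto simp: r_def field_simps)
    moreover have "(\<lambda>x. (b - a) * x + a) ` cbox 0 1 = {a..b}"
      using ab image_affinity_atLeastAtMost[of "b - a" a 0 1] by simp
    ultimately show ?thesis by (simp only:)
  qed
  finally have "((\<lambda>t. r * ?h (r * t + - (r * a))) has_integral r * (segment_length (\<omega> c) z (snd c q) / r)) {a..b}"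
    by (rule has_integral_mult_right)
  then have hi: "((\<lambda>t. r * ?h (r * t + - (r * a))) has_integral segment_length (\<omega> c) z (snd c q)) {a..b}"
    using r by simp
  have sp: "speed A \<omega> ?g t = r * ?h (r * t + - (r * a))" if t: "t \<in> {a..b} - {a,b}" for t
  proof -
    have t': "t \<in> {a<..<b}" "t \<in> {a..b}" using t by auto
    have "(f has_vector_derivative r *\<^sub>R d) (at t)"
      unfolding f_def by (auto intro!: derivative_eq_intros)
    then have "((snd c \<circ> ?g) has_vector_derivative r *\<^sub>R d) (at t)"
      by (rule has_vector_derivative_transform_within_open[where S = "{a<..<b}"]) (use fc t' in auto)
    from speed_eq[OF \<omega> cont t'(1) c _ this]
    have "speed A \<omega> ?g t = sqrt (\<omega> c (f t) (r *\<^sub>R d) (Jm (r *\<^sub>R d)))" using fc[OF t'(2)] by simp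
    also have "\<omega> c (f t) (r *\<^sub>R d) (Jm (r *\<^sub>R d)) = r\<^sup>2 * \<omega> c (f t) d (Jm d)"
      using two_form_bilinear[OF \<omega> c fc[OF t'(2)]]
      by (simp add: Jm_scaleR bilinear_lmul bilinear_rmul power2_eq_square)
    also have "sqrt (r\<^sup>2 * \<omega> c (f t) d (Jm d)) = r * ?h (r * t + - (r * a))"
      unfolding f_eq using r by (simp add: real_sqrt_mult)
    finally show ?thesis .
  qed
  have "(speed A \<omega> ?g has_integral segment_length (\<omega> c) z (snd c q)) {a..b}"
    by (rule has_integral_spike_finite[of "{a, b}", OF _ sp hi]) auto
  then have "integral {a..b} (speed A \<omega> ?g) \<le> segment_length (\<omega> c) z (snd c q)"
    by (simp add: integral_unique)
  moreover have "f a = snd c p" "f b = snd c q" unfolding f_eq using rab by (simp_all add: z_def d_def)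
  then have "?g a = p" "?g b = q" using p q c by auto
  moreover have "?g t \<in> fst c \<and> snd c (?g t) \<in> D" if "t \<in> {a..b}" for t
    using fD[OF that] fc[OF that] by simp
  ultimately show ?thesis unfolding path_ex_def z_def
    using pw by (intro exI[of _ ?g]) simp
qed

end

section \<open>Uniform charts on a compact manifold\<close>

text \<open>A finite subcover in the form of an induction principle. It serves for the uniform chart
  size and for the bounded diameter.\<close>

lemma compact_space_induct:
  assumes X: "compact_space X"
    and loc: "\<And>p. p \<in> topspace X \<Longrightarrow> \<exists>N. openin X N \<and> p \<in> N \<and> P N"
    and un: "\<And>M N. P M \<Longrightarrow> P N \<Longrightarrow> P (M \<union> N)" and emp: "P {}"
    and mono: "\<And>M N. P M \<Longrightarrow> N \<subseteq> M \<Longrightarrow> P N"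
  shows "P (topspace X)"
proof -
  let ?U = "{N. openin X N \<and> P N}"
  have "topspace X \<subseteq> \<Union>?U" using loc by blast
  then obtain F where F: "finite F" "F \<subseteq> ?U" "topspace X \<subseteq> \<Union>F"
    using X unfolding compact_space_alt by (metis (no_types, lifting) mem_Collect_eq)
  from F(1,2) have "P (\<Union>F)"
    by (induction F rule: finite_induct) (auto simp: emp intro: un)
  then show ?thesis using F(3) mono by blast
qed

section \<open>Positive forms: distances, uniform charts and diameter\<close>

context cmanifold
begin

text \<open>The part of the Kaehler condition on which lengths and distances rely.\<close>

definition riemannian :: "('a, 'n) two_form \<Rightarrow> bool" where
  "riemannian \<omega> \<longleftrightarrow> smooth_two_form A \<omega> \<and> (\<forall>c\<in>A. \<forall>z\<in>cimage c. \<forall>v. v \<noteq> 0 \<longrightarrow> \<omega> c z v (Jm v) > 0)"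

lemma kahler_riemannian: "kahler_form A \<omega> \<Longrightarrow> riemannian \<omega>"
  unfolding kahler_form_def riemannian_def by blast

lemma riemannian_nonneg:
  assumes "riemannian \<omega>" "c \<in> A" "z \<in> cimage c" shows "0 \<le> \<omega> c z v (Jm v)"
proof (cases "v = 0")
  case True
  have "bilinear (\<omega> c z)" using assms two_form_bilinear unfolding riemannian_def by blast
  then show ?thesis using True by (simp add: bilinear_lzero)
next
  case False
  then show ?thesis using assms unfolding riemannian_def by (auto intro: less_imp_le)
qed

lemma speed_nonneg:
  assumes \<omega>: "riemannian \<omega>" and \<gamma>: "\<gamma> t \<in> topspace X"
  shows "0 \<le> speed A \<omega> \<gamma> t"
proof -
  define c where "c = (SOME c. c \<in> A \<and> \<gamma> t \<in> fst c)"
  obtain c' where "c' \<in> A \<and> \<gamma> t \<in> fst c'" using chart_ex[OF \<gamma>] by blast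
  from someI[of "\<lambda>c. c \<in> A \<and> \<gamma> t \<in> fst c", OF this]
  have c: "c \<in> A" "\<gamma> t \<in> fst c" unfolding c_def by blast+
  then show ?thesis
    unfolding speed_def Let_def c_def[symmetric] using riemannian_nonneg[OF \<omega>] by simp
qed

lemma length_nonneg:
  assumes \<omega>: "riemannian \<omega>" and \<gamma>: "pw_curve X A a b \<gamma>" and uv: "a \<le> u" "v \<le> b"
  shows "speed A \<omega> \<gamma> integrable_on {u..v}" "0 \<le> integral {u..v} (speed A \<omega> \<gamma>)"
proof -
  have "speed A \<omega> \<gamma> integrable_on {a..b}"
    using \<omega> \<gamma> pw_curve_speed_integrable unfolding riemannian_def by blast
  then show i: "speed A \<omega> \<gamma> integrable_on {u..v}"
    by (rule integrable_on_subinterval) (use uv in auto)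
  show "0 \<le> integral {u..v} (speed A \<omega> \<gamma>)"
    by (rule integral_nonneg[OF i]) (use uv pw_curve_in_X[OF \<gamma>] speed_nonneg[OF \<omega>] in auto)
qed

lemma curve_length_nonneg:
  "riemannian \<omega> \<Longrightarrow> curve_joins X A p q \<gamma> \<Longrightarrow> 0 \<le> curve_length A \<omega> \<gamma>"
  unfolding curve_joins_iff curve_length_def using length_nonneg(2)[of \<omega> 0 1 \<gamma> 0 1] by simp

lemma riem_dist_le:
  assumes "riemannian \<omega>" "curve_joins X A p q \<gamma>"
  shows "riem_dist X A \<omega> p q \<le> curve_length A \<omega> \<gamma>"
  unfolding riem_dist_def
  by (rule cINF_lower) (use assms curve_length_nonneg in \<open>auto intro!: bdd_belowI2[of _ 0]\<close>)

text \<open>The curve in the hypothesis only witnesses that the infimum is taken over a nonempty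
  set; over the empty set its value would carry no information.\<close>

lemma riem_dist_nonneg:
  assumes "riemannian \<omega>" "curve_joins X A p q \<gamma>"
  shows "0 \<le> riem_dist X A \<omega> p q"
  unfolding riem_dist_def
  by (rule cINF_greatest) (use assms curve_length_nonneg in auto)

lemma path_ex_curve:
  assumes "path_ex \<omega> Q 0 1 p q L"
  obtains \<gamma> where "curve_joins X A p q \<gamma>" "curve_length A \<omega> \<gamma> \<le> L" "\<And>t. t \<in> {0..1} \<Longrightarrow> Q t (\<gamma> t)"
  using assms unfolding path_ex_def curve_joins_iff curve_length_def by blast

lemma riem_dist_le_path:
  assumes "riemannian \<omega>" "path_ex \<omega> Q 0 1 p q L"
  shows "0 \<le> riem_dist X A \<omega> p q" "riem_dist X A \<omega> p q \<le> L"
  using path_ex_curve[OF assms(2)] riem_dist_le[OF assms(1)] riem_dist_nonneg[OF assms(1)]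
  by (meson order_trans)+

lemma path_ex_const:
  assumes \<omega>: "smooth_two_form A \<omega>" and p: "p \<in> topspace X" and ab: "a < b"
  shows "path_ex \<omega> (\<lambda>t x. x = p) a b p p 0"
proof -
  obtain c where c: "c \<in> A" "p \<in> fst c" using chart_ex[OF p] by blast
  have z: "snd c p \<in> cimage c" using c by simp
  have "segment_length (\<omega> c) (snd c p) (snd c p) = 0"
    unfolding segment_length_def using two_form_bilinear[OF \<omega> c(1) z] by (simp add: bilinear_lzero)
  then show ?thesis
    using path_ex_segment[OF \<omega> c(1) ab c(2) c(2), of "{snd c p}"] z c
    by (auto elim!: path_ex_mono dest: inj_onD[OF chart_inj])
qed

text \<open>One constant serves as radius of the chart ball and, with its inverse, as bound of the metric.
  The condition weakens as the constant decreases, which makes it accessible to the compactness argument.\<close>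

definition admissible :: "('a, 'n) two_form \<Rightarrow> real \<Rightarrow> ('a, 'n) chart \<Rightarrow> 'a \<Rightarrow> bool" where
  "admissible \<omega> e c p \<longleftrightarrow> c \<in> A \<and> p \<in> fst c \<and> cball (snd c p) e \<subseteq> cimage c \<and>
     (\<forall>z\<in>cball (snd c p) e. \<forall>v. e * norm v \<le> sqrt (\<omega> c z v (Jm v)) \<and> sqrt (\<omega> c z v (Jm v)) \<le> norm v / e)"

text \<open>By homogeneity it is enough to bound a continuous positive function on the compact
  product of the ball and the unit sphere.\<close>

lemma compact_bounds:
  assumes \<omega>: "riemannian \<omega>" and c: "c \<in> A" and R: "cball z0 R \<subseteq> cimage c" "0 < R"
  obtains lo hi where "0 < lo" "0 < hi"
    "\<And>z v. z \<in> cball z0 R \<Longrightarrow> lo * norm v \<le> sqrt (\<omega> c z v (Jm v)) \<and> sqrt (\<omega> c z v (Jm v)) \<le> hi * norm v"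
proof -
  let ?S = "cball z0 R \<times> sphere (0::complex ^ 'n) 1"
  let ?G = "\<lambda>x. sqrt (\<omega> c (fst x) (snd x) (Jm (snd x)))"
  have sm: "smooth_two_form A \<omega>" using \<omega> by (simp add: riemannian_def)
  have cS: "compact ?S" by (intro compact_Times) auto
  obtain u :: "complex ^ 'n" where "norm u = 1" using vector_choose_size[of 1] by auto
  then have ne: "?S \<noteq> {}" using R by (auto simp: dist_norm)
  have cont: "continuous_on ?S ?G"
    by (intro continuous_intros two_form_continuous[OF sm c]) (use R in auto)
  obtain x where x: "x \<in> ?S" "\<And>y. y \<in> ?S \<Longrightarrow> ?G x \<le> ?G y"
    using continuous_attains_inf[OF cS ne cont] by blast
  obtain x' where x': "x' \<in> ?S" "\<And>y. y \<in> ?S \<Longrightarrow> ?G y \<le> ?G x'"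
    using continuous_attains_sup[OF cS ne cont] by blast
  have pos: "0 < ?G y" if "y \<in> ?S" for y
  proof -
    have "fst y \<in> cimage c" "snd y \<noteq> 0" using that R by auto
    then show ?thesis using \<omega> c unfolding riemannian_def by simp
  qed
  show ?thesis
  proof (rule that[of "?G x" "?G x'"])
    show "0 < ?G x" "0 < ?G x'" using pos x x' by blast+
    fix z v :: "complex ^ 'n" assume z: "z \<in> cball z0 R"
    have B: "bilinear (\<omega> c z)" using two_form_bilinear[OF sm c] z R by blast
    show "?G x * norm v \<le> sqrt (\<omega> c z v (Jm v)) \<and> sqrt (\<omega> c z v (Jm v)) \<le> ?G x' * norm v"
    proof (cases "v = 0")
      case True
      then show ?thesis by (simp add: bilinear_lzero[OF B])
    next
      case False
      define u where "u = (1 / norm v) *\<^sub>R v"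
      have u: "norm u = 1" "v = norm v *\<^sub>R u" using False by (simp_all add: u_def)
      have "\<omega> c z v (Jm v) = (norm v)\<^sup>2 * \<omega> c z u (Jm u)"
        by (subst (1 2) u(2)) (simp add: Jm_scaleR bilinear_lmul[OF B] bilinear_rmul[OF B] power2_eq_square)
      then have e: "sqrt (\<omega> c z v (Jm v)) = norm v * ?G (z, u)" by (simp add: real_sqrt_mult)
      have "(z, u) \<in> ?S" using z u by simp
      from x(2)[OF this] x'(2)[OF this] show ?thesis
        unfolding e by (simp add: mult.commute mult_left_mono)
    qed
  qed
qed

text \<open>One chart ball of radius R around p serves all q within R/2, so the property is locally
  uniform; two constants are merged by taking their minimum.\<close>

lemma admissible_exists:
  assumes X: "compact_space X" and \<omega>: "riemannian \<omega>"
  obtains e where "0 < e" "e \<le> 1" "\<And>p. p \<in> topspace X \<Longrightarrow> \<exists>c. admissible \<omega> e c p"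
proof -
  define P where "P N \<longleftrightarrow> (\<exists>e>0. e \<le> 1 \<and> (\<forall>p\<in>N. \<exists>c. admissible \<omega> e c p))" for N
  have weaken: "admissible \<omega> e' c p" if "admissible \<omega> e c p" "0 < e'" "e' \<le> e" for e e' c p
    unfolding admissible_def
  proof (intro conjI ballI allI)
    show "c \<in> A" "p \<in> fst c" using that(1) by (auto simp: admissible_def)
    have sub: "cball (snd c p) e' \<subseteq> cball (snd c p) e" using that by (intro subset_cball)
    then show "cball (snd c p) e' \<subseteq> cimage c" using that(1) unfolding admissible_def by blast
    fix z v :: "complex ^ 'n" assume "z \<in> cball (snd c p) e'"
    then have "e * norm v \<le> sqrt (\<omega> c z v (Jm v))" "sqrt (\<omega> c z v (Jm v)) \<le> norm v / e"
      using sub that(1) unfolding admissible_def by blast+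
    moreover have "e' * norm v \<le> e * norm v" using that by (intro mult_right_mono) auto
    moreover have "norm v / e \<le> norm v / e'" using that by (intro divide_left_mono) auto
    ultimately show "e' * norm v \<le> sqrt (\<omega> c z v (Jm v))" "sqrt (\<omega> c z v (Jm v)) \<le> norm v / e'" by linarith+
  qed
  have "P (topspace X)"
  proof (rule compact_space_induct[OF X])
    fix p assume "p \<in> topspace X"
    then obtain c where c: "c \<in> A" "p \<in> fst c" using chart_ex by blast
    obtain R where R: "0 < R" "cball (snd c p) R \<subseteq> cimage c"
      using cimage_open[OF c(1)] chart_in[OF c(2)] open_contains_cball by blast
    obtain lo hi where b: "0 < lo" "0 < hi"
      "\<And>z (v :: complex ^ 'n). z \<in> cball (snd c p) R \<Longrightarrow> lo * norm v \<le> sqrt (\<omega> c z v (Jm v)) \<and> sqrt (\<omega> c z v (Jm v)) \<le> hi * norm v"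
      using compact_bounds[OF \<omega> c(1) R(2,1)] by metis
    \<comment> \<open>R/2 keeps the ball around a nearby q inside the ball around p; lo and 1/hi
      adapt e to the two metric bounds.\<close>
    define e where "e = min (min 1 (R/2)) (min lo (1/hi))"
    have e: "0 < e" "e \<le> 1" "e \<le> R/2" "e \<le> lo" "e \<le> 1/hi" using R b by (auto simp: e_def)
    define N where "N = {q \<in> fst c. snd c q \<in> ball (snd c p) (R/2)}"
    have "admissible \<omega> e c q" if "q \<in> N" for q
      unfolding admissible_def
    proof (intro conjI ballI allI)
      show "c \<in> A" "q \<in> fst c" using c that by (auto simp: N_def)
      have sub: "z \<in> cball (snd c p) R" if "z \<in> cball (snd c q) e" for z
        using dist_triangle[of "snd c p" z "snd c q"] that \<open>q \<in> N\<close> e(3) by (auto simp: N_def)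
      then show "cball (snd c q) e \<subseteq> cimage c" using R by blast
      fix z v :: "complex ^ 'n" assume z: "z \<in> cball (snd c q) e"
      have "e * norm v \<le> lo * norm v" using e by (intro mult_right_mono) auto
      moreover have "hi * norm v \<le> norm v / e"
      proof -
        have "hi \<le> 1 / e" using e b by (simp add: field_simps)
        from mult_right_mono[OF this, of "norm v"] show ?thesis by simp
      qed
      ultimately show "e * norm v \<le> sqrt (\<omega> c z v (Jm v))" "sqrt (\<omega> c z v (Jm v)) \<le> norm v / e"
        using b(3)[OF sub[OF z], of v] by linarith+
    qed
    then have "P N" unfolding P_def using e by blast
    moreover have "openin X N" unfolding N_def by (rule chart_preimage_open[OF c(1)]) simp
    moreover have "p \<in> N" using c R by (simp add: N_def)
    ultimately show "\<exists>N. openin X N \<and> p \<in> N \<and> P N" by blast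
  next
    fix M N assume "P M" "P N"
    then obtain e1 e2 where e: "0 < e1" "e1 \<le> 1" "\<forall>p\<in>M. \<exists>c. admissible \<omega> e1 c p"
      "0 < e2" "e2 \<le> 1" "\<forall>p\<in>N. \<exists>c. admissible \<omega> e2 c p" unfolding P_def by blast
    show "P (M \<union> N)" unfolding P_def
    proof (intro exI[of _ "min e1 e2"] conjI ballI)
      fix p assume "p \<in> M \<union> N"
      then show "\<exists>c. admissible \<omega> (min e1 e2) c p"
        using e weaken[of e1 _ p "min e1 e2"] weaken[of e2 _ p "min e1 e2"] by fastforce
    qed (use e in auto)
  next
    show "P {}" unfolding P_def by (intro exI[of _ 1]) auto
  next
    fix M N assume "P M" "N \<subseteq> M" then show "P N" unfolding P_def by blast
  qed
  then show ?thesis using that unfolding P_def by blast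
qed

lemma admissible_segment_length:
  assumes \<omega>: "riemannian \<omega>" and e: "admissible \<omega> e c p" "0 < e"
    and zw: "z \<in> cball (snd c p) e" "w \<in> cball (snd c p) e"
  shows "segment_length (\<omega> c) z w \<le> norm (w - z) / e"
proof -
  have c: "c \<in> A" and sub: "cball (snd c p) e \<subseteq> cimage c" using e by (auto simp: admissible_def)
  have s: "z + s *\<^sub>R (w - z) \<in> cball (snd c p) e" if "s \<in> {0..1}" for s
    using affine_in_segment[OF that, of z w] closed_segment_subset[OF zw convex_cball] by blast
  have "segment_length (\<omega> c) z w \<le> integral {0..1} (\<lambda>s::real. norm (w - z) / e)"
    unfolding segment_length_def
  proof (rule integral_le)
    show "(\<lambda>s. sqrt (\<omega> c (z + s *\<^sub>R (w - z)) (w - z) (Jm (w - z)))) integrable_on {0..1}"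
      using \<omega> s sub unfolding riemannian_def
      by (intro integrable_continuous_interval continuous_intros two_form_continuous[OF _ c]) auto
    show "sqrt (\<omega> c (z + s *\<^sub>R (w - z)) (w - z) (Jm (w - z))) \<le> norm (w - z) / e" if "s \<in> {0..1}" for s
      using e(1) s[OF that] unfolding admissible_def by blast
  qed (rule integrable_const_ivl)
  then show ?thesis by simp
qed

lemma admissible_path:
  assumes \<omega>: "riemannian \<omega>" and e: "admissible \<omega> e c p" "0 < e" and ab: "a < b"
    and x: "x \<in> fst c" "snd c x \<in> cball (snd c p) e" and y: "y \<in> fst c" "snd c y \<in> cball (snd c p) e"
  shows "path_ex \<omega> (\<lambda>t x. True) a b x y (norm (snd c y - snd c x) / e)"
proof -
  have c: "c \<in> A" "cball (snd c p) e \<subseteq> cimage c" "smooth_two_form A \<omega>" using e \<omega> by (auto simp: admissible_def riemannian_def)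
  have "path_ex \<omega> (\<lambda>t z. z \<in> fst c \<and> snd c z \<in> cball (snd c p) e) a b x y (segment_length (\<omega> c) (snd c x) (snd c y))"
    by (rule path_ex_segment[OF c(3,1) ab x(1) y(1) closed_segment_subset[OF x(2) y(2) convex_cball] c(2)])
  then show ?thesis
    by (rule path_ex_mono) (use admissible_segment_length[OF \<omega> e x(2) y(2)] in auto)
qed

text \<open>As long as the curve stays in the open chart ball N of radius e, its displacement is at
  most L/e, which is less than e. So it lies in the smaller ball K and cannot approach the rim. K is
  closed in X, being compact in a Hausdorff space; this excludes that the curve jumps out of the
  chart in the limit.\<close>

lemma stays_in_chart:
  assumes \<omega>: "riemannian \<omega>" and e: "admissible \<omega> e c p" "0 < e"
    and \<gamma>: "pw_curve X A a b \<gamma>" and uv: "a \<le> u" "u \<le> v" "v \<le> b" and p: "\<gamma> u = p"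
    and L: "integral {u..v} (speed A \<omega> \<gamma>) \<le> L" "L < e * e" and t: "t \<in> {u..v}"
  shows "\<gamma> t \<in> fst c" "norm (snd c (\<gamma> t) - snd c p) \<le> L / e"
proof -
  have sm: "smooth_two_form A \<omega>" using \<omega> by (simp add: riemannian_def)
  have c: "c \<in> A" "p \<in> fst c" "cball (snd c p) e \<subseteq> cimage c"
    and lo: "\<And>z w. z \<in> ball (snd c p) e \<Longrightarrow> e * norm w \<le> sqrt (\<omega> c z w (Jm w))"
    using e by (auto simp: admissible_def)
  have Le: "L / e < e" using L(2) e(2) by (simp add: field_simps)
  define N where "N = {x \<in> fst c. snd c x \<in> ball (snd c p) e}"
  define K where "K = cinv c ` cball (snd c p) (L/e)"
  have subK: "cball (snd c p) (L/e) \<subseteq> cimage c" using c(3) subset_cball[of "L/e" e "snd c p"] Le by fastforce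
  have K_iff: "x \<in> K \<longleftrightarrow> x \<in> fst c \<and> snd c x \<in> cball (snd c p) (L/e)" for x
  proof
    assume "x \<in> K"
    then obtain z where "z \<in> cball (snd c p) (L/e)" "x = cinv c z" unfolding K_def by blast
    then show "x \<in> fst c \<and> snd c x \<in> cball (snd c p) (L/e)" using subK by auto
  next
    assume "x \<in> fst c \<and> snd c x \<in> cball (snd c p) (L/e)"
    then show "x \<in> K" unfolding K_def using cinv_chart[OF c(1), of x] by (metis image_eqI)
  qed
  have KN: "K \<subseteq> N" using Le by (auto simp: K_iff N_def)
  have "compactin (top_of_set (cimage c)) (cball (snd c p) (L/e))"
    using subK by (simp add: compactin_subtopology)
  from image_compactin[OF this cinv_cont[OF c(1)]] have "compactin X K" by (simp add: K_def)
  then have closedK: "closedin X K"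
    using mfd compactin_imp_closedin unfolding complex_manifold_def by blast
  have openN: "openin X N" unfolding N_def by (rule chart_preimage_open[OF c(1)]) simp
  have cont: "continuous_map (top_of_set {u..v}) X \<gamma>" by (rule pw_curve_cont_sub[OF \<gamma>]) (use uv in auto)
  have inK: "\<gamma> s \<in> K" if s: "s \<in> {u..v}" "\<And>r. r \<in> {u..s} \<Longrightarrow> \<gamma> r \<in> N" for s
  proof -
    have "norm (snd c (\<gamma> s) - snd c (\<gamma> u)) \<le> integral {u..s} (speed A \<omega> \<gamma>) / e"
      by (rule displacement_le_length[where D = "ball (snd c p) e", OF sm \<gamma> uv(1) _ _ c(1) _ lo e(2)]) (use s uv in \<open>auto simp: N_def\<close>)
    also have "integral {u..s} (speed A \<omega> \<gamma>) \<le> integral {u..v} (speed A \<omega> \<gamma>)"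
    proof -
      have "integral {u..s} (speed A \<omega> \<gamma>) + integral {s..v} (speed A \<omega> \<gamma>) = integral {u..v} (speed A \<omega> \<gamma>)"
        using s length_nonneg(1)[OF \<omega> \<gamma> uv(1,3)] by (intro Henstock_Kurzweil_Integration.integral_combine) auto
      moreover have "0 \<le> integral {s..v} (speed A \<omega> \<gamma>)" using length_nonneg(2)[OF \<omega> \<gamma>, of s v] s uv by auto
      ultimately show ?thesis by simp
    qed
    also have "\<dots> \<le> L" by (rule L(1))
    finally have "norm (snd c (\<gamma> s) - snd c p) \<le> L / e" using e(2) p by (simp add: divide_right_mono)
    moreover have "\<gamma> s \<in> fst c" using s(2)[of s] s(1) by (auto simp: N_def)
    ultimately show ?thesis by (simp add: K_iff dist_norm norm_minus_commute)
  qed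
  have allN: "\<gamma> s \<in> N" if "s \<in> {u..v}" for s
  proof (rule ccontr)
    assume not: "\<gamma> s \<notin> N"
    define E where "E = {r \<in> {u..v}. \<gamma> r \<notin> N}"
    \<comment> \<open>At the first exit time r the curve would still be in the smaller compact set K.\<close>
    have "closedin (top_of_set {u..v}) {r \<in> topspace (top_of_set {u..v}). \<gamma> r \<in> topspace X - N}"
      by (rule closedin_continuous_map_preimage[OF cont]) (use openN in auto)
    moreover have "{r \<in> topspace (top_of_set {u..v}). \<gamma> r \<in> topspace X - N} = E"
      using pw_curve_in_X[OF \<gamma>] uv by (auto simp: E_def)
    ultimately have "closed E" using closedin_closed_trans[of "{u..v}" E] by simp
    moreover have E: "E \<noteq> {}" "bdd_below E" using not that by (auto simp: E_def intro!: bdd_belowI[of _ u])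
    ultimately have inf: "Inf E \<in> E" by (rule closed_contains_Inf[rotated 2])
    define r where "r = Inf E"
    have r: "r \<in> {u..v}" "\<gamma> r \<notin> N" using inf by (auto simp: E_def r_def)
    have before: "\<gamma> s \<in> N" if "s \<in> {u..<r}" for s
      using that r cInf_lower[OF _ E(2), of s] by (force simp: E_def r_def)
    have "u \<noteq> r" using r p c e(2) by (auto simp: N_def)
    then have "u < r" using r by simp
    have "closedin (top_of_set {u..v}) {s \<in> topspace (top_of_set {u..v}). \<gamma> s \<in> K}"
      by (rule closedin_continuous_map_preimage[OF cont closedK])
    then have "closed {s \<in> {u..v}. \<gamma> s \<in> K}" using closedin_closed_trans[of "{u..v}"] by simp
    moreover have "{u..<r} \<subseteq> {s \<in> {u..v}. \<gamma> s \<in> K}"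
      using inK before r by auto
    ultimately have "closure {u..<r} \<subseteq> {s \<in> {u..v}. \<gamma> s \<in> K}" by (rule closure_minimal[rotated])
    moreover have "r \<in> closure {u..<r}" using \<open>u < r\<close> by simp
    ultimately have "\<gamma> r \<in> K" by blast
    then show False using KN r by blast
  qed
  have "\<gamma> t \<in> K" using t by (intro inK allN) auto
  then show "\<gamma> t \<in> fst c" "norm (snd c (\<gamma> t) - snd c p) \<le> L / e"
    by (auto simp: K_iff dist_norm norm_minus_commute)
qed

text \<open>The set of points at finite distance from p0 is open and closed because chart balls have
  bounded diameter, hence it is everything by connectedness. Compactness makes the bound
  uniform.\<close>

lemma bounded_diameter:
  assumes X: "compact_space X" "connected_space X" and \<omega>: "riemannian \<omega>"
  obtains D where "0 < D" "\<And>p q. p \<in> topspace X \<Longrightarrow> q \<in> topspace X \<Longrightarrow> path_ex \<omega> (\<lambda>t x. True) 0 1 p q D"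
proof (cases "topspace X = {}")
  case True
  then show ?thesis using that[of 1] by simp
next
  case False
  then obtain p0 where p0: "p0 \<in> topspace X" by blast
  have sm: "smooth_two_form A \<omega>" using \<omega> by (simp add: riemannian_def)
  obtain e where e: "0 < e" "\<And>p. p \<in> topspace X \<Longrightarrow> \<exists>c. admissible \<omega> e c p" using admissible_exists[OF X(1) \<omega>] by metis
  \<comment> \<open>All parameter intervals are quantified, so that two curves can be concatenated
    on the halves of any interval.\<close>
  define R where "R p q L \<longleftrightarrow> (\<forall>a b. a < b \<longrightarrow> path_ex \<omega> (\<lambda>t x. True) a b p q L)" for p q L
  have R_trans: "R p r (L + L')" if "R p q L" "R q r L'" for p q r L L'
    unfolding R_def
  proof (intro allI impI)
    fix a b :: real assume "a < b"
    then have "path_ex \<omega> (\<lambda>t x. True) a ((a+b)/2) p q L" "path_ex \<omega> (\<lambda>t x. True) ((a+b)/2) b q r L'"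
      using that unfolding R_def by auto
    then show "path_ex \<omega> (\<lambda>t x. True) a b p r (L + L')" by (rule path_ex_trans[OF sm])
  qed
  have R_mono: "R p q L'" if "R p q L" "L \<le> L'" for p q L L'
    unfolding R_def
  proof (intro allI impI)
    fix a b :: real assume "a < b"
    with that(1) have "path_ex \<omega> (\<lambda>t x. True) a b p q L" unfolding R_def by blast
    then show "path_ex \<omega> (\<lambda>t x. True) a b p q L'" by (rule path_ex_mono[OF _ that(2)])
  qed
  \<comment> \<open>Two points of a chart ball of radius e are at most 2 e apart in coordinates, and
    the metric is at most norm / e; hence the 2.\<close>
  have nb: "\<exists>N. openin X N \<and> p \<in> N \<and> (\<forall>x\<in>N. \<forall>y\<in>N. R x y 2)" if p: "p \<in> topspace X" for p
  proof -
    obtain c where c: "admissible \<omega> e c p" using e(2)[OF p] by blast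
    define N where "N = {x \<in> fst c. snd c x \<in> ball (snd c p) e}"
    have cc: "c \<in> A" "p \<in> fst c" using c by (auto simp: admissible_def)
    have "R x y 2" if "x \<in> N" "y \<in> N" for x y
      unfolding R_def
    proof (intro allI impI)
      fix a b :: real assume ab: "a < b"
      have "norm (snd c y - snd c x) \<le> 2 * e"
        using dist_triangle3[of "snd c y" "snd c x" "snd c p"] that
        by (auto simp: N_def dist_norm[of "snd c y", symmetric])
      then have "norm (snd c y - snd c x) / e \<le> 2" using e by (simp add: field_simps)
      with admissible_path[OF \<omega> c e(1) ab, of x y] that show "path_ex \<omega> (\<lambda>t x. True) a b x y 2"
        by (auto simp: N_def intro: path_ex_mono)
    qed
    moreover have "openin X N" unfolding N_def by (rule chart_preimage_open[OF cc(1)]) simp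
    moreover have "p \<in> N" using cc e by (simp add: N_def)
    ultimately show ?thesis by blast
  qed
  \<comment> \<open>Curves from p0 to q and back are both recorded, which takes the place of
    reversing a curve.\<close>
  define E where "E = {q \<in> topspace X. \<exists>L. R p0 q L \<and> R q p0 L}"
  have ext: "R p0 y (L + 2) \<and> R y p0 (L + 2)" if "R p0 x L" "R x p0 L" "R x y 2" "R y x 2" for x y L
    using R_trans[OF that(1,3)] R_trans[OF that(4,2)] by (simp add: add.commute)
  have "openin X E"
  proof (subst openin_subopen, intro ballI)
    fix x assume "x \<in> E"
    then obtain L where x: "x \<in> topspace X" "R p0 x L" "R x p0 L" unfolding E_def by blast
    obtain N where N: "openin X N" "x \<in> N" "\<forall>x\<in>N. \<forall>y\<in>N. R x y 2" using nb[OF x(1)] by blast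
    have "N \<subseteq> E" using ext[OF x(2,3)] N openin_subset[OF N(1)] unfolding E_def by blast
    then show "\<exists>T. openin X T \<and> x \<in> T \<and> T \<subseteq> E" using N by blast
  qed
  moreover have "openin X (topspace X - E)"
  proof (subst openin_subopen, intro ballI)
    fix x assume x: "x \<in> topspace X - E"
    obtain N where N: "openin X N" "x \<in> N" "\<forall>x\<in>N. \<forall>y\<in>N. R x y 2" using nb x by blast
    have "y \<notin> E" if "y \<in> N" for y
    proof
      assume "y \<in> E"
      then obtain L where "R p0 y L" "R y p0 L" unfolding E_def by blast
      from ext[OF this, of x] N that x show False unfolding E_def by blast
    qed
    then have "N \<subseteq> topspace X - E" using openin_subset[OF N(1)] by blast
    then show "\<exists>T. openin X T \<and> x \<in> T \<and> T \<subseteq> topspace X - E" using N by blast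
  qed
  then have "closedin X E" unfolding closedin_def E_def by auto
  moreover have "p0 \<in> E"
  proof -
    have "R p0 p0 2" using nb[OF p0] by blast
    then show ?thesis using p0 unfolding E_def by blast
  qed
  ultimately have E: "E = topspace X" using X(2) unfolding connected_space_clopen_in by blast
  define P where "P N \<longleftrightarrow> (\<exists>L. \<forall>q\<in>N. R p0 q L \<and> R q p0 L)" for N
  have "P (topspace X)"
  proof (rule compact_space_induct[OF X(1)])
    fix x assume x: "x \<in> topspace X"
    then obtain L where L: "R p0 x L" "R x p0 L" using E unfolding E_def by blast
    obtain N where N: "openin X N" "x \<in> N" "\<forall>x\<in>N. \<forall>y\<in>N. R x y 2" using nb[OF x(1)] by blast
    then have "P N" unfolding P_def using ext[OF L] by blast
    then show "\<exists>N. openin X N \<and> x \<in> N \<and> P N" using N by blast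
  next
    fix M N assume "P M" "P N"
    then obtain L L' where "\<forall>q\<in>M. R p0 q L \<and> R q p0 L" "\<forall>q\<in>N. R p0 q L' \<and> R q p0 L'"
      unfolding P_def by blast
    then show "P (M \<union> N)" unfolding P_def
      by (intro exI[of _ "max L L'"]) (auto intro: R_mono)
  qed (auto simp: P_def)
  then obtain L where L: "\<And>q. q \<in> topspace X \<Longrightarrow> R p0 q L \<and> R q p0 L" unfolding P_def by blast
  show ?thesis
  proof (rule that[of "max 1 (L + L)"])
    fix p q assume "p \<in> topspace X" "q \<in> topspace X"
    then have "R p q (L + L)" using L R_trans by blast
    then have "R p q (max 1 (L + L))" by (rule R_mono) simp
    then show "path_ex \<omega> (\<lambda>t x. True) 0 1 p q (max 1 (L + L))" unfolding R_def by simp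
  qed simp
qed

text \<open>A curve of sufficiently small length from p remains in a chart around p and moves little
  in coordinates, so it cannot end at a different point.\<close>

lemma riem_dist_pos:
  assumes X: "compact_space X" and \<omega>: "riemannian \<omega>" and pq: "p \<in> topspace X" "p \<noteq> q"
    and ex: "curve_joins X A p q \<gamma>0"
  shows "0 < riem_dist X A \<omega> p q"
proof (rule ccontr)
  assume "\<not> ?thesis"
  then have d0: "riem_dist X A \<omega> p q = 0" using riem_dist_nonneg[OF \<omega> ex] by simp
  obtain e c where e: "0 < e" "admissible \<omega> e c p" using admissible_exists[OF X \<omega>] pq by metis
  have c: "c \<in> A" "p \<in> fst c" using e by (auto simp: admissible_def)
  \<comment> \<open>A length below e * e keeps the curve in the chart, and one below e |q - p| is
    too short to reach q there. Outside the chart q has no coordinates and the first condition alone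
    gives the contradiction.\<close>
  define x where "x = (if q \<in> fst c then min (e * e / 2) (e * norm (snd c q - snd c p) / 2) else e * e / 2)"
  have n: "0 < e * norm (snd c q - snd c p)" if "q \<in> fst c"
  proof -
    have "snd c q - snd c p \<noteq> 0" using pq(2) inj_onD[OF chart_inj[OF c(1)], of q p] c(2) that by auto
    then show ?thesis using e(1) by simp
  qed
  have ee: "0 < e * e" using e by simp
  have x: "0 < x" "x < e * e" using n ee by (auto simp: x_def)
  have "(INF \<gamma> \<in> {\<gamma>. curve_joins X A p q \<gamma>}. curve_length A \<omega> \<gamma>) < x"
    using d0 x by (simp add: riem_dist_def)
  then obtain \<gamma> where \<gamma>: "curve_joins X A p q \<gamma>" "curve_length A \<omega> \<gamma> < x"
    using ex by (subst (asm) cINF_less_iff) (auto intro!: bdd_belowI2[of _ 0] curve_length_nonneg[OF \<omega>])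
  have 1: "pw_curve X A 0 1 \<gamma>" "\<gamma> 0 = p" "\<gamma> 1 = q" "integral {0..1} (speed A \<omega> \<gamma>) \<le> x"
    using \<gamma> by (auto simp: curve_joins_iff curve_length_def)
  have "q \<in> fst c" "norm (snd c q - snd c p) \<le> x / e"
    using stays_in_chart[OF \<omega> e(2,1) 1(1) _ _ _ 1(2,4) x(2), of 1] 1(3) by auto
  moreover from this have "x / e < norm (snd c q - snd c p)"
  proof -
    have "x \<le> e * norm (snd c q - snd c p) / 2" using \<open>q \<in> fst c\<close> by (simp add: x_def)
    then have "x < e * norm (snd c q - snd c p)" using n[OF \<open>q \<in> fst c\<close>] by linarith
    then show ?thesis using e(1) by (simp add: field_simps)
  qed
  ultimately show False by simp
qed

end

section \<open>Replacing a curve by short polygons\<close>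

text \<open>The constant of \<open>short_polygon\<close> for a chart of size e: there L = 1/e^2, and
  the Hoelder constant in coordinates is K (1/e)^\<alpha>.\<close>

definition path_const :: "real \<Rightarrow> real \<Rightarrow> real \<Rightarrow> real" where
  "path_const e K \<alpha> = 6 * cone_const \<alpha> * sqrt (1 / e\<^sup>2 + K * (1 / e) powr \<alpha>)"

lemma path_const_pos: "0 < e \<Longrightarrow> 0 < K \<Longrightarrow> 0 < \<alpha> \<Longrightarrow> 0 < path_const e K \<alpha>"
  unfolding path_const_def using cone_const_pos[of \<alpha>] by (simp add: add_pos_pos)

context cmanifold
begin

text \<open>\<open>short_polygon\<close> carried over to an admissible chart. The Riemannian
  distance is at most the coordinate distance divided by e, which turns the Hoelder condition on X
  into a Euclidean one. The polygon stays as close to p as q is.\<close>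

lemma potential_path:
  assumes \<omega>: "kahler_form A \<omega>" and \<phi>: "smooth_function A \<phi>"
    and \<omega>\<phi>: "kahler_form A (kahler_deform \<omega> \<phi>)"
    and holder: "\<And>p q. p \<in> topspace X \<Longrightarrow> q \<in> topspace X \<Longrightarrow> \<bar>\<phi> p - \<phi> q\<bar> \<le> K * riem_dist X A \<omega> p q powr \<alpha>"
    and K: "0 < K" and \<alpha>: "0 < \<alpha>" "\<alpha> \<le> 1"
    and e: "admissible \<omega> e c p" "0 < e" "e \<le> 1" and ab: "a < b"
    and q: "q \<in> fst c" "5/2 * norm (snd c q - snd c p) < e"
  shows "path_ex (kahler_deform \<omega> \<phi>) (\<lambda>t x. x \<in> fst c \<and> norm (snd c x - snd c p) \<le> norm (snd c q - snd c p))
     a b p q (path_const e K \<alpha> * norm (snd c q - snd c p) powr (\<alpha>/2))"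
proof -
  let ?\<omega>' = "kahler_deform \<omega> \<phi>"
  have c: "c \<in> A" "p \<in> fst c" "cball (snd c p) e \<subseteq> cimage c" using e by (auto simp: admissible_def)
  have sm: "smooth_two_form A \<omega>" "smooth_two_form A ?\<omega>'" using \<omega> \<omega>\<phi> by (auto simp: kahler_form_def)
  note R = kahler_riemannian[OF \<omega>] kahler_riemannian[OF \<omega>\<phi>]
  let ?B = "ball (snd c p) e"
  have sub: "z \<in> cball (snd c p) e" "z \<in> cimage c" if "z \<in> ?B" for z using that c(3) by auto
  define d where "d = norm (snd c q - snd c p)"
  have d0: "0 \<le> d" by (simp add: d_def)
  show ?thesis
  proof (cases "p = q")
    case True
    have "path_ex ?\<omega>' (\<lambda>t x. x = p) a b p p 0"
      by (rule path_ex_const[OF sm(2) _ ab]) (use c chart_sub in blast)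
    then show ?thesis using True c by (auto elim!: path_ex_mono)
  next
    case False
    have ne: "snd c p \<noteq> snd c q" using False inj_onD[OF chart_inj[OF c(1)] _ c(2) q(1)] by blast
    interpret potential_form ?B "?\<omega>' c" "\<omega> c" "\<phi> \<circ> cinv c" "1 / e\<^sup>2" "K * (1/e) powr \<alpha>" \<alpha>
    proof
      show "open ?B" by simp
      have "smooth_on (cimage c) (\<phi> \<circ> cinv c)" using \<phi> c unfolding smooth_function_def by blast
      then show "C_k_on k ?B (\<phi> \<circ> cinv c)" for k
        using smooth_on_open_iff[OF cimage_open[OF c(1)]] C_k_on_subset sub(2) by blast
      show "bilinear (?\<omega>' c z)" "?\<omega>' c z v v = 0" if "z \<in> ?B" for z v
        using two_form_bilinear[OF sm(2) c(1)] two_form_alt[OF sm(2) c(1)] sub(2)[OF that] by auto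
      show "?\<omega>' c z (Jm u) (Jm v) = ?\<omega>' c z u v" if "z \<in> ?B" for z u v
        using \<omega>\<phi> c(1) sub(2)[OF that] unfolding kahler_form_def by blast
      show "0 \<le> ?\<omega>' c z v (Jm v)" if "z \<in> ?B" for z v
        by (rule riemannian_nonneg[OF R(2) c(1) sub(2)[OF that]])
      show "continuous_on ?B (\<lambda>z. ?\<omega>' c z v (Jm v))" for v
        by (rule two_form_continuous[OF sm(2) c(1)]) (use sub in auto)
      show "?\<omega>' c z v (Jm v) = \<omega> c z v (Jm v) + i_ddbar (\<phi> \<circ> cinv c) z v (Jm v)" for z v
        by (simp add: kahler_deform_def)
      show "\<omega> c z v (Jm v) \<le> 1 / e\<^sup>2 * (norm v)\<^sup>2" if "z \<in> ?B" for z v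
      proof -
        have "sqrt (\<omega> c z v (Jm v)) \<le> norm v / e" using e(1) sub(1)[OF that] unfolding admissible_def by blast
        from sqrt_le_D[OF this] show ?thesis by (simp add: power_divide)
      qed
      show "\<bar>(\<phi> \<circ> cinv c) z - (\<phi> \<circ> cinv c) w\<bar> \<le> K * (1/e) powr \<alpha> * norm (z - w) powr \<alpha>"
        if z: "z \<in> ?B" and w: "w \<in> ?B" for z w
      proof -
        note zc = sub(2)[OF z] and wc = sub(2)[OF w]
        have "path_ex \<omega> (\<lambda>t x. True) 0 1 (cinv c z) (cinv c w) (norm (w - z) / e)"
          using admissible_path[OF R(1) e(1,2), of 0 1 "cinv c z" "cinv c w"] zc wc sub(1)[OF z] sub(1)[OF w] by simp
        note rd = riem_dist_le_path[OF R(1) this]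
        have "\<bar>\<phi> (cinv c z) - \<phi> (cinv c w)\<bar> \<le> K * riem_dist X A \<omega> (cinv c z) (cinv c w) powr \<alpha>"
          by (rule holder) (use cinv_in[OF zc] cinv_in[OF wc] chart_sub[OF c(1)] in blast)+
        also have "\<dots> \<le> K * (norm (w - z) / e) powr \<alpha>"
          using rd K \<alpha> by (intro mult_left_mono powr_mono2) auto
        also have "\<dots> = K * (1/e) powr \<alpha> * norm (z - w) powr \<alpha>"
          using e by (simp add: powr_divide norm_minus_commute)
        finally show ?thesis by simp
      qed
    qed (use e K \<alpha> in auto)
    have S: "cball (snd c p) (5/2 * norm (snd c q - snd c p)) \<subseteq> ?B" using q(2) by auto
    obtain m where m: "norm (m - snd c p) \<le> d"
      "segment_length (?\<omega>' c) (snd c p) m + segment_length (?\<omega>' c) m (snd c q)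
        \<le> 6 * cone_const \<alpha> * sqrt (1 / e\<^sup>2 * d\<^sup>2 + K * (1/e) powr \<alpha> * d powr \<alpha>)"
      by (rule short_polygon[OF S ne]) (auto simp: d_def)
    have "5/2 * d < e" using q by (simp add: d_def)
    then have de: "d < e" "d \<le> 1" using d0 e by auto
    let ?D = "cball (snd c p) d"
    have D: "?D \<subseteq> cimage c" using c(3) de by (auto simp: subset_iff)
    have mD: "m \<in> ?D" using m by (simp add: dist_norm norm_minus_commute)
    have pD: "snd c p \<in> ?D" "snd c q \<in> ?D" using d0 by (auto simp: d_def dist_norm norm_minus_commute)
    have mc: "cinv c m \<in> fst c" "snd c (cinv c m) = m" using mD D by auto
    have mid: "a < (a+b)/2" "(a+b)/2 < b" using ab by auto
    have "path_ex ?\<omega>' (\<lambda>t x. x \<in> fst c \<and> snd c x \<in> ?D) a ((a+b)/2) p (cinv c m) (segment_length (?\<omega>' c) (snd c p) m)"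
      using path_ex_segment[OF sm(2) c(1) mid(1) c(2) mc(1) _ D] closed_segment_subset[OF pD(1) mD convex_cball] mc(2) by simp
    moreover have "path_ex ?\<omega>' (\<lambda>t x. x \<in> fst c \<and> snd c x \<in> ?D) ((a+b)/2) b (cinv c m) q (segment_length (?\<omega>' c) m (snd c q))"
      using path_ex_segment[OF sm(2) c(1) mid(2) mc(1) q(1) _ D] closed_segment_subset[OF mD pD(2) convex_cball] mc(2) by simp
    ultimately have "path_ex ?\<omega>' (\<lambda>t x. x \<in> fst c \<and> snd c x \<in> ?D) a b p q
        (segment_length (?\<omega>' c) (snd c p) m + segment_length (?\<omega>' c) m (snd c q))"
      by (rule path_ex_trans[OF sm(2)])
    moreover have "segment_length (?\<omega>' c) (snd c p) m + segment_length (?\<omega>' c) m (snd c q) \<le> path_const e K \<alpha> * d powr (\<alpha>/2)"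
    proof -
      \<comment> \<open>Since d <= 1, the background term d^2 is dominated by d^\<alpha>; both terms
        then share the root d^(\<alpha>/2).\<close>
      have "0 < d" using ne by (simp add: d_def)
      have "d\<^sup>2 = d powr 2" using \<open>0 < d\<close> by (simp add: powr_numeral)
      also have "\<dots> \<le> d powr \<alpha>" using \<open>0 < d\<close> de \<alpha> by (intro powr_mono') auto
      finally have "1 / e\<^sup>2 * d\<^sup>2 + K * (1/e) powr \<alpha> * d powr \<alpha> \<le> 1 / e\<^sup>2 * d powr \<alpha> + K * (1/e) powr \<alpha> * d powr \<alpha>"
        using e by (simp add: divide_right_mono)
      also have "\<dots> = (1 / e\<^sup>2 + K * (1/e) powr \<alpha>) * (d powr (\<alpha>/2))\<^sup>2"
        using \<open>0 < d\<close> by (simp add: algebra_simps power2_eq_square flip: powr_add)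
      finally have "sqrt (1 / e\<^sup>2 * d\<^sup>2 + K * (1/e) powr \<alpha> * d powr \<alpha>) \<le> sqrt (1 / e\<^sup>2 + K * (1/e) powr \<alpha>) * d powr (\<alpha>/2)"
        using real_sqrt_le_mono by (fastforce simp: real_sqrt_mult)
      then have "6 * cone_const \<alpha> * sqrt (1 / e\<^sup>2 * d\<^sup>2 + K * (1/e) powr \<alpha> * d powr \<alpha>)
          \<le> 6 * cone_const \<alpha> * (sqrt (1 / e\<^sup>2 + K * (1/e) powr \<alpha>) * d powr (\<alpha>/2))"
        using cone_const_pos[OF \<alpha>(1)] by (intro mult_left_mono) auto
      then show ?thesis using m(2) by (simp add: path_const_def mult.assoc)
    qed
    ultimately show ?thesis
      unfolding d_def by (rule path_ex_mono) (auto simp: dist_norm norm_minus_commute)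
  qed
qed

text \<open>Arc length is continuous in the parameter, so the intermediate value theorem supplies
  the division points. It may be constant on intervals, hence the points are not unique, but
  different values of arc length force them to be strictly increasing.\<close>

lemma length_partition:
  assumes \<omega>: "riemannian \<omega>" and \<gamma>: "pw_curve X A 0 1 \<gamma>"
    and l: "integral {0..1} (speed A \<omega> \<gamma>) = l" "0 < l" and N: "0 < N"
  obtains T :: "nat \<Rightarrow> real" where "T 0 = 0" "T N = 1"
    "\<And>i. i < N \<Longrightarrow> 0 \<le> T i \<and> T i < T (Suc i) \<and> T (Suc i) \<le> 1"
    "\<And>i. i < N \<Longrightarrow> integral {T i..T (Suc i)} (speed A \<omega> \<gamma>) = l / N"
proof -
  define F where "F t = integral {0..t} (speed A \<omega> \<gamma>)" for t
  have int: "speed A \<omega> \<gamma> integrable_on {0..1}" by (rule length_nonneg(1)[OF \<omega> \<gamma>]) auto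
  have cF: "continuous_on {0..1} F"
    unfolding F_def by (rule indefinite_integral_continuous_1[OF int])
  have F01: "F 0 = 0" "F 1 = l" using l by (auto simp: F_def)
  have diff: "F t - F s = integral {s..t} (speed A \<omega> \<gamma>)" if "0 \<le> s" "s \<le> t" "t \<le> 1" for s t
  proof -
    have "speed A \<omega> \<gamma> integrable_on {0..t}" by (rule length_nonneg(1)[OF \<omega> \<gamma>]) (use that in auto)
    from Henstock_Kurzweil_Integration.integral_combine[OF that(1,2) this] show ?thesis by (simp add: F_def)
  qed
  have mono: "F s \<le> F t" if "0 \<le> s" "s \<le> t" "t \<le> 1" for s t
    using diff[OF that] length_nonneg(2)[OF \<omega> \<gamma> that(1,3)] by simp
  \<comment> \<open>The curve may stand still near its ends, so the first and last division points
    are fixed explicitly as 0 and 1.\<close>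
  have ex: "\<exists>t. 0 \<le> t \<and> t \<le> 1 \<and> F t = real i * l / real N \<and> (i = 0 \<longrightarrow> t = 0) \<and> (i = N \<longrightarrow> t = 1)" if "i \<le> N" for i
  proof -
    have b: "0 \<le> real i * l / real N" "real i * l / real N \<le> l"
      using that l N by (auto simp: field_simps)
    consider "i = 0" | "i = N" | "i \<noteq> 0" "i \<noteq> N" by blast
    then show ?thesis
    proof cases
      case 1
      then show ?thesis using F01 N by (intro exI[of _ 0]) auto
    next
      case 2
      then show ?thesis using F01 N by (intro exI[of _ 1]) auto
    next
      case 3
      then show ?thesis using IVT'[of F 0 "real i * l / real N" 1, OF _ _ _ cF] F01 b by auto
    qed
  qed
  define T where "T i = (SOME t. 0 \<le> t \<and> t \<le> 1 \<and> F t = real i * l / real N \<and> (i = 0 \<longrightarrow> t = 0) \<and> (i = N \<longrightarrow> t = 1))" for i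
  have T: "0 \<le> T i \<and> T i \<le> 1 \<and> F (T i) = real i * l / real N \<and> (i = 0 \<longrightarrow> T i = 0) \<and> (i = N \<longrightarrow> T i = 1)"
    if "i \<le> N" for i
    unfolding T_def by (rule someI_ex[OF ex[OF that]])
  have step: "T i < T (Suc i)" "integral {T i..T (Suc i)} (speed A \<omega> \<gamma>) = l / N" if i: "i < N" for i
  proof -
    note Ti = T[of i] T[of "Suc i"]
    have "F (T (Suc i)) - F (T i) = l / N" using Ti i by (simp add: algebra_simps add_divide_distrib)
    moreover have "0 < l / N" using l N by simp
    ultimately have lt: "F (T i) < F (T (Suc i))" by simp
    show "T i < T (Suc i)"
    proof (rule ccontr)
      assume "\<not> ?thesis"
      then have "F (T (Suc i)) \<le> F (T i)" using Ti i by (intro mono) auto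
      with lt show False by simp
    qed
    then show "integral {T i..T (Suc i)} (speed A \<omega> \<gamma>) = l / N"
      using diff[of "T i" "T (Suc i)"] Ti i \<open>F (T (Suc i)) - F (T i) = l / N\<close> by auto
  qed
  show ?thesis
    by (rule that[of T]) (use T step in \<open>auto simp: Suc_le_eq\<close>)
qed

text \<open>Every arc is so short that it and its polygon lie in one chart around the initial point
  of the arc, within a small coordinate distance of that point. Comparing both with this point keeps
  them \<epsilon>-close at equal times.\<close>

lemma polygonal_replacement:
  assumes \<omega>: "kahler_form A \<omega>" and \<phi>: "smooth_function A \<phi>"
    and \<omega>\<phi>: "kahler_form A (kahler_deform \<omega> \<phi>)"
    and holder: "\<And>p q. p \<in> topspace X \<Longrightarrow> q \<in> topspace X \<Longrightarrow> \<bar>\<phi> p - \<phi> q\<bar> \<le> K * riem_dist X A \<omega> p q powr \<alpha>"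
    and K: "0 < K" and \<alpha>: "0 < \<alpha>" "\<alpha> \<le> 1"
    and e: "\<And>p. p \<in> topspace X \<Longrightarrow> \<exists>c. admissible \<omega> e c p" "0 < e" "e \<le> 1"
    and \<epsilon>: "0 < \<epsilon>" "\<epsilon> \<le> 1/4"
    and \<gamma>: "pw_curve X A 0 1 \<gamma>" and l: "integral {0..1} (speed A \<omega> \<gamma>) = l" "0 < l" "l \<le> M"
  defines "C \<equiv> (M + 1) * (8 / e^3) * path_const e K \<alpha> * (1/e) powr (\<alpha>/2)"
  shows "path_ex (kahler_deform \<omega> \<phi>) (\<lambda>t x. riem_dist X A \<omega> (\<gamma> t) x < \<epsilon>) 0 1 (\<gamma> 0) (\<gamma> 1)
     (C / \<epsilon> * l powr (\<alpha>/2))"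
proof -
  let ?\<omega>' = "kahler_deform \<omega> \<phi>" and ?Q = "\<lambda>t x. riem_dist X A \<omega> (\<gamma> t) x < \<epsilon>"
  define P where "P = path_const e K \<alpha>"
  have P: "0 < P" unfolding P_def by (rule path_const_pos[OF e(2) K \<alpha>(1)])
  have sm: "smooth_two_form A ?\<omega>'" using \<omega>\<phi> by (auto simp: kahler_form_def)
  note R = kahler_riemannian[OF \<omega>]
  \<comment> \<open>An arc of length \<delta> has displacement at most \<delta>/e = e^2
    \<epsilon>/8. Curve and polygon are thus at most e^2 \<epsilon>/4 apart in coordinates, and at
    most e \<epsilon>/4 in distance: one factor e pays for each conversion.\<close>
  define \<delta> where "\<delta> = e^3 / 8 * \<epsilon>"
  have \<delta>: "0 < \<delta>" using e \<epsilon> by (simp add: \<delta>_def)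
  have e3: "e^3 \<le> 1" "e^3 = e * e * e" using e power_le_one[of e 3] by (simp_all add: power3_eq_cube)
  have \<delta>1: "\<delta> \<le> 1" using mult_mono[of "e^3/8" 1 \<epsilon> 1] e3(1) e \<epsilon> by (simp add: \<delta>_def)
  define N where "N = nat \<lceil>l / \<delta>\<rceil>"
  have ld: "0 < l / \<delta>" using l \<delta> by simp
  have N: "0 < N" "l / \<delta> \<le> real N" "real N \<le> l / \<delta> + 1"
    using ld unfolding N_def by (auto simp: real_nat_ceiling_ge) (linarith+)?
  have lN: "l / N \<le> \<delta>" "0 < l / N" "l / N \<le> l" using N l \<delta> by (auto simp: field_simps)
  have \<delta>e: "\<delta> / e = e * e * \<epsilon> / 8" using e by (simp add: \<delta>_def e3(2))
  have ee: "e * e * \<epsilon> \<le> e * 1 * (1/4)" using e \<epsilon> by (intro mult_mono) auto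
  have \<delta>ee: "\<delta> < e * e"
  proof -
    have "\<delta> = (e * e) * (e * \<epsilon> / 8)" by (simp add: \<delta>_def e3(2))
    also have "\<dots> < (e * e) * 1"
      using mult_mono[of e 1 \<epsilon> "1/4"] e \<epsilon> by (intro mult_strict_left_mono) auto
    finally show ?thesis by simp
  qed
  obtain T :: "nat \<Rightarrow> real" where T: "T 0 = 0" "T N = 1"
    "\<And>i. i < N \<Longrightarrow> 0 \<le> T i \<and> T i < T (Suc i) \<and> T (Suc i) \<le> 1"
    "\<And>i. i < N \<Longrightarrow> integral {T i..T (Suc i)} (speed A \<omega> \<gamma>) = l / N"
    using length_partition[OF R \<gamma> l(1,2) N(1)] by blast
  \<comment> \<open>Each polygon is charged with the whole length l instead of l / N, so that the
    total is the number of arcs times a fixed multiple of l^(\<alpha>/2).\<close>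
  define B where "B = P * (l / e) powr (\<alpha>/2)"
  have piece: "path_ex ?\<omega>' ?Q (T i) (T (Suc i)) (\<gamma> (T i)) (\<gamma> (T (Suc i))) B" if i: "i < N" for i
  proof -
    note Ti = T(3)[OF i]
    have "\<gamma> (T i) \<in> topspace X" by (rule pw_curve_in_X[OF \<gamma>]) (use Ti in auto)
    then obtain c where c: "admissible \<omega> e c (\<gamma> (T i))" using e by blast
    define p q where "p = \<gamma> (T i)" and "q = \<gamma> (T (Suc i))"
    have st: "\<gamma> t \<in> fst c" "norm (snd c (\<gamma> t) - snd c p) \<le> (l / N) / e" if "t \<in> {T i..T (Suc i)}" for t
      using stays_in_chart[OF R c e(2) \<gamma> _ _ _ refl, of "T (Suc i)" "l / N" t] T(4)[OF i] Ti that lN \<delta>ee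
      by (auto simp: p_def)
    have lNe: "(l / N) / e \<le> e * e * \<epsilon> / 8" using divide_right_mono[OF lN(1), of e] e \<delta>e by simp
    have q: "q \<in> fst c" "norm (snd c q - snd c p) \<le> (l / N) / e"
      using st[of "T (Suc i)"] Ti by (auto simp: q_def)
    have "5/2 * norm (snd c q - snd c p) < e" using q(2) lNe ee e(2) by linarith
    from potential_path[OF \<omega> \<phi> \<omega>\<phi> holder K \<alpha> c[folded p_def] e(2,3) _ q(1) this, of "T i" "T (Suc i)"] Ti
    have "path_ex ?\<omega>' (\<lambda>t x. x \<in> fst c \<and> norm (snd c x - snd c p) \<le> norm (snd c q - snd c p))
       (T i) (T (Suc i)) p q (P * norm (snd c q - snd c p) powr (\<alpha>/2))" by (simp add: P_def)
    then have "path_ex ?\<omega>' ?Q (T i) (T (Suc i)) p q B"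
    proof (rule path_ex_mono)
      have "(l / N) / e \<le> l / e" using lN e by (intro divide_right_mono) auto
      then have "norm (snd c q - snd c p) powr (\<alpha>/2) \<le> (l / e) powr (\<alpha>/2)"
        using q \<alpha> by (intro powr_mono2) auto
      then show "P * norm (snd c q - snd c p) powr (\<alpha>/2) \<le> B" unfolding B_def using P by simp
      fix t x assume t: "t \<in> {T i..T (Suc i)}" and x: "x \<in> fst c \<and> norm (snd c x - snd c p) \<le> norm (snd c q - snd c p)"
      have ball: "snd c (\<gamma> t) \<in> cball (snd c p) e" "snd c x \<in> cball (snd c p) e"
      proof -
        have "norm (snd c (\<gamma> t) - snd c p) \<le> e" "norm (snd c x - snd c p) \<le> e"
          using st(2)[OF t] x q(2) lNe ee e(2) by linarith+
        then show "snd c (\<gamma> t) \<in> cball (snd c p) e" "snd c x \<in> cball (snd c p) e"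
          by (simp_all add: dist_norm norm_minus_commute[of "snd c p"])
      qed
      have "riem_dist X A \<omega> (\<gamma> t) x \<le> norm (snd c x - snd c (\<gamma> t)) / e"
        using riem_dist_le_path(2)[OF R admissible_path[OF R c[folded p_def] e(2) _ st(1)[OF t] ball(1) _ ball(2)]] x by simp
      also have "norm (snd c x - snd c (\<gamma> t)) \<le> norm (snd c x - snd c p) + norm (snd c (\<gamma> t) - snd c p)"
        by (metis dist_norm dist_triangle2)
      also have "\<dots> \<le> e * e * \<epsilon> / 4" using st(2)[OF t] x q(2) lNe by linarith
      also have "e * e * \<epsilon> / 4 / e = e * (\<epsilon> / 4)" using e by simp
      also have "\<dots> \<le> 1 * (\<epsilon> / 4)" using e \<epsilon> by (intro mult_right_mono) auto
      also have "\<dots> < \<epsilon>" using \<epsilon> by simp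
      finally show "riem_dist X A \<omega> (\<gamma> t) x < \<epsilon>" using e by (simp add: divide_right_mono)
    qed
    then show ?thesis by (simp add: p_def q_def)
  qed
  have all: "path_ex ?\<omega>' ?Q 0 (T (Suc k)) (\<gamma> 0) (\<gamma> (T (Suc k))) (real (Suc k) * B)" if "k < N" for k
    using that
  proof (induction k)
    case 0
    then show ?case using piece[of 0] T(1) by simp
  next
    case (Suc k)
    then have "path_ex ?\<omega>' ?Q 0 (T (Suc k)) (\<gamma> 0) (\<gamma> (T (Suc k))) (real (Suc k) * B)" by simp
    from path_ex_trans[OF sm this piece[OF Suc.prems]] show ?case by (simp add: algebra_simps)
  qed
  have "path_ex ?\<omega>' ?Q 0 1 (\<gamma> 0) (\<gamma> 1) (real N * B)"
    using all[of "N - 1"] N(1) T(2) by simp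
  moreover have "real N * B \<le> C / \<epsilon> * l powr (\<alpha>/2)"
  proof -
    \<comment> \<open>Rounding up costs one additional arc, and 1 <= 1/\<delta> absorbs it into the
      factor M + 1.\<close>
    have "real N \<le> (M + 1) / \<delta>"
    proof -
      have "real N \<le> l / \<delta> + 1 / \<delta>" using N(3) \<delta> \<delta>1 by (simp add: field_simps)
      also have "\<dots> \<le> M / \<delta> + 1 / \<delta>" using l \<delta> by (simp add: divide_right_mono)
      finally show ?thesis by (simp add: add_divide_distrib)
    qed
    then have "real N * B \<le> (M + 1) / \<delta> * B" using P l e unfolding B_def by (intro mult_right_mono) auto
    also have "\<dots> = C / \<epsilon> * l powr (\<alpha>/2)"
      using e \<epsilon> l unfolding C_def P_def[symmetric] B_def \<delta>_def by (simp add: powr_divide mult_ac)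
    finally show ?thesis .
  qed
  ultimately show ?thesis by (rule path_ex_mono)
qed

end

section \<open>Choice of the constant and of the first curve\<close>

theorem theorem3:
  fixes X :: "'a topology"
    and A :: "('a, 'n::finite) chart set"
    and \<omega>0 :: "('a, 'n) two_form"
    and K \<alpha> :: real
  assumes "complex_manifold X A"
    and "compact_space X"
    and "connected_space X"
    and "kahler_form A \<omega>0"
    and "0 < K"
    and "0 < \<alpha>" "\<alpha> \<le> 1"
  shows "\<exists>C>0. \<forall>\<phi> :: 'a \<Rightarrow> real.
    smooth_function A \<phi> \<longrightarrow>
    kahler_form A (kahler_deform \<omega>0 \<phi>) \<longrightarrow>
    (\<forall>p\<in>topspace X. \<forall>q\<in>topspace X. \<bar>\<phi> p - \<phi> q\<bar> \<le> K * riem_dist X A \<omega>0 p q powr \<alpha>) \<longrightarrow>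
    (\<forall>\<epsilon>. 0 < \<epsilon> \<and> \<epsilon> \<le> 1/4 \<longrightarrow>
      (\<forall>p\<in>topspace X. \<forall>q\<in>topspace X. \<exists>\<gamma> \<eta>.
        curve_joins X A p q \<gamma> \<and> curve_joins X A p q \<eta> \<and>
        riem_dist X A \<omega>0 p q \<le> curve_length A \<omega>0 \<gamma> \<and>
        curve_length A \<omega>0 \<gamma> \<le> C * riem_dist X A \<omega>0 p q \<and>
        (\<forall>t\<in>{0..1}. riem_dist X A \<omega>0 (\<gamma> t) (\<eta> t) < \<epsilon>) \<and>
        curve_length A (kahler_deform \<omega>0 \<phi>) \<eta> \<le> C / \<epsilon> * curve_length A \<omega>0 \<gamma> powr (\<alpha>/2) \<and>
        riem_dist X A (kahler_deform \<omega>0 \<phi>) p q \<le> curve_length A (kahler_deform \<omega>0 \<phi>) \<eta> \<and>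
        curve_length A (kahler_deform \<omega>0 \<phi>) \<eta> \<le> C / \<epsilon> * riem_dist X A \<omega>0 p q powr (\<alpha>/2)))"
proof -
  interpret cmanifold X A by unfold_locales (rule assms)
  note \<omega> = assms(4) and K = assms(5) and \<alpha> = assms(6,7)
  note R = kahler_riemannian[OF \<omega>]
  have sm: "smooth_two_form A \<omega>0" using \<omega> by (simp add: kahler_form_def)
  \<comment> \<open>The chart size e and the diameter bound D are taken from
    \<open>\<omega>0\<close> before \<phi> is introduced; this makes C independent of
    \<phi>.\<close>
  obtain e where e: "0 < e" "e \<le> 1" "\<And>p. p \<in> topspace X \<Longrightarrow> \<exists>c. admissible \<omega>0 e c p"
    using admissible_exists[OF assms(2) R] by blast
  obtain D where D: "0 < D" "\<And>p q. p \<in> topspace X \<Longrightarrow> q \<in> topspace X \<Longrightarrow> path_ex \<omega>0 (\<lambda>t x. True) 0 1 p q D"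
    using bounded_diameter[OF assms(2,3) R] by blast
  \<comment> \<open>The first curve will have length below twice the distance of its end points,
    hence at most 2 D.\<close>
  define C0 where "C0 = (2 * D + 1) * (8 / e^3) * path_const e K \<alpha> * (1/e) powr (\<alpha>/2)"
  have C0: "0 < C0" unfolding C0_def using D e path_const_pos[OF e(1) K \<alpha>(1)] by simp
  \<comment> \<open>The summand 2 covers the comparison of the first curve with the distance d; 2 C0
    covers (2 d)^(\<alpha>/2) <= 2 d^(\<alpha>/2).\<close>
  define C where "C = 2 * C0 + 2"
  have C: "0 < C" "2 \<le> C" "C0 \<le> C" "2 * C0 \<le> C" using C0 by (auto simp: C_def)
  show ?thesis
  proof (intro exI[of _ C] conjI allI impI ballI C(1))
    fix \<phi> :: "'a \<Rightarrow> real" and \<epsilon> :: real and p q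
    assume \<phi>: "smooth_function A \<phi>" "kahler_form A (kahler_deform \<omega>0 \<phi>)"
      and holder: "\<forall>p\<in>topspace X. \<forall>q\<in>topspace X. \<bar>\<phi> p - \<phi> q\<bar> \<le> K * riem_dist X A \<omega>0 p q powr \<alpha>"
      and \<epsilon>: "0 < \<epsilon> \<and> \<epsilon> \<le> 1/4" and p: "p \<in> topspace X" and q: "q \<in> topspace X"
    let ?\<omega>' = "kahler_deform \<omega>0 \<phi>" and ?d = "riem_dist X A \<omega>0 p q"
    note R' = kahler_riemannian[OF \<phi>(2)]
    have sm': "smooth_two_form A ?\<omega>'" using \<phi> by (simp add: kahler_form_def)
    have C\<epsilon>: "0 \<le> C / \<epsilon>" using C \<epsilon> by simp
    note dD = riem_dist_le_path[OF R D(2)[OF p q]]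
    obtain \<gamma>0 where \<gamma>0: "curve_joins X A p q \<gamma>0" by (rule path_ex_curve[OF D(2)[OF p q]], rule that)
    show "\<exists>\<gamma> \<eta>.
        curve_joins X A p q \<gamma> \<and> curve_joins X A p q \<eta> \<and>
        ?d \<le> curve_length A \<omega>0 \<gamma> \<and>
        curve_length A \<omega>0 \<gamma> \<le> C * ?d \<and>
        (\<forall>t\<in>{0..1}. riem_dist X A \<omega>0 (\<gamma> t) (\<eta> t) < \<epsilon>) \<and>
        curve_length A ?\<omega>' \<eta> \<le> C / \<epsilon> * curve_length A \<omega>0 \<gamma> powr (\<alpha>/2) \<and>
        riem_dist X A ?\<omega>' p q \<le> curve_length A ?\<omega>' \<eta> \<and>
        curve_length A ?\<omega>' \<eta> \<le> C / \<epsilon> * ?d powr (\<alpha>/2)"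
    \<comment> \<open>For p = q the distance is 0, so no length below twice the distance is
      possible; constant curves satisfy all the bounds.\<close>
    proof (cases "p = q")
      case True
      have const: "path_ex w (\<lambda>t x. x = p) 0 1 p p 0" if "smooth_two_form A w" for w
        by (rule path_ex_const[OF that p]) simp
      obtain \<gamma> where \<gamma>: "curve_joins X A p p \<gamma>" "curve_length A \<omega>0 \<gamma> \<le> 0" "\<And>t. t \<in> {0..1} \<Longrightarrow> \<gamma> t = p"
        by (rule path_ex_curve[OF const[OF sm]], rule that)
      obtain \<eta> where \<eta>: "curve_joins X A p p \<eta>" "curve_length A ?\<omega>' \<eta> \<le> 0" "\<And>t. t \<in> {0..1} \<Longrightarrow> \<eta> t = p"
        by (rule path_ex_curve[OF const[OF sm']], rule that)
      have d: "riem_dist X A \<omega>0 p p \<le> 0" by (rule riem_dist_le_path(2)[OF R const[OF sm]])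
      have nn: "0 \<le> C / \<epsilon> * x powr (\<alpha>/2)" for x by (rule mult_nonneg_nonneg[OF C\<epsilon>]) simp
      show ?thesis
      proof (rule exI[of _ \<gamma>], rule exI[of _ \<eta>], intro conjI ballI)
        show "?d \<le> curve_length A \<omega>0 \<gamma>" using riem_dist_le[OF R \<gamma>(1)] True by simp
        show "curve_length A \<omega>0 \<gamma> \<le> C * ?d"
          using \<gamma>(2) dD(1) C by (meson mult_nonneg_nonneg less_imp_le order_trans)
        show "riem_dist X A \<omega>0 (\<gamma> t) (\<eta> t) < \<epsilon>" if "t \<in> {0..1}" for t
          using \<gamma>(3)[OF that] \<eta>(3)[OF that] d \<epsilon> by simp
        show "riem_dist X A ?\<omega>' p q \<le> curve_length A ?\<omega>' \<eta>" using riem_dist_le[OF R' \<eta>(1)] True by simp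
        show "curve_length A ?\<omega>' \<eta> \<le> C / \<epsilon> * curve_length A \<omega>0 \<gamma> powr (\<alpha>/2)"
          "curve_length A ?\<omega>' \<eta> \<le> C / \<epsilon> * ?d powr (\<alpha>/2)"
          using \<eta>(2) nn order_trans by blast+
      qed (use \<gamma> \<eta> True in auto)
    next
      case False
      have d: "0 < ?d" by (rule riem_dist_pos[OF assms(2) R p False \<gamma>0])
      \<comment> \<open>Because the distance is positive, its double exceeds the infimum strictly
        and some curve lies below it; no minimizing geodesic has to be produced.\<close>
      have "(INF \<gamma> \<in> {\<gamma>. curve_joins X A p q \<gamma>}. curve_length A \<omega>0 \<gamma>) < 2 * ?d"
        using d by (simp add: riem_dist_def)
      then obtain \<gamma> where \<gamma>: "curve_joins X A p q \<gamma>" "curve_length A \<omega>0 \<gamma> < 2 * ?d"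
        using \<gamma>0 by (subst (asm) cINF_less_iff) (auto intro!: bdd_belowI2[of _ 0] curve_length_nonneg[OF R])
      define l where "l = curve_length A \<omega>0 \<gamma>"
      have l: "?d \<le> l" "l \<le> 2 * ?d" "0 < l" "l \<le> 2 * D"
        using riem_dist_le[OF R \<gamma>(1)] \<gamma>(2) d dD(2) by (auto simp: l_def)
      have g: "pw_curve X A 0 1 \<gamma>" "\<gamma> 0 = p" "\<gamma> 1 = q" "integral {0..1} (speed A \<omega>0 \<gamma>) = l"
        using \<gamma>(1) by (auto simp: curve_joins_iff l_def curve_length_def)
      have path: "path_ex ?\<omega>' (\<lambda>t x. riem_dist X A \<omega>0 (\<gamma> t) x < \<epsilon>) 0 1 (\<gamma> 0) (\<gamma> 1) (C0 / \<epsilon> * l powr (\<alpha>/2))"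
        unfolding C0_def
        by (rule polygonal_replacement[OF \<omega> \<phi> _ K \<alpha> e(3,1,2) _ _ g(1,4) l(3,4)]) (use holder \<epsilon> in auto)
      obtain \<eta> where \<eta>: "curve_joins X A p q \<eta>" "curve_length A ?\<omega>' \<eta> \<le> C0 / \<epsilon> * l powr (\<alpha>/2)"
          "\<And>t. t \<in> {0..1} \<Longrightarrow> riem_dist X A \<omega>0 (\<gamma> t) (\<eta> t) < \<epsilon>"
        by (rule path_ex_curve[OF path[unfolded g(2,3)]], rule that)
      have 1: "C0 / \<epsilon> * l powr (\<alpha>/2) \<le> C / \<epsilon> * l powr (\<alpha>/2)"
        using C \<epsilon> by (intro mult_right_mono divide_right_mono) auto
      have "l powr (\<alpha>/2) \<le> (2 * ?d) powr (\<alpha>/2)" using l \<alpha> by (intro powr_mono2) auto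
      also have "\<dots> = 2 powr (\<alpha>/2) * ?d powr (\<alpha>/2)" using d by (simp add: powr_mult)
      also have "\<dots> \<le> 2 powr 1 * ?d powr (\<alpha>/2)" using \<alpha> by (intro mult_right_mono powr_mono) auto
      finally have "C0 / \<epsilon> * l powr (\<alpha>/2) \<le> C0 / \<epsilon> * (2 * ?d powr (\<alpha>/2))"
        using C0 \<epsilon> by (intro mult_left_mono) auto
      also have "\<dots> = (2 * C0) / \<epsilon> * ?d powr (\<alpha>/2)" by simp
      also have "\<dots> \<le> C / \<epsilon> * ?d powr (\<alpha>/2)"
        using C \<epsilon> by (intro mult_right_mono divide_right_mono) auto
      finally have 2: "C0 / \<epsilon> * l powr (\<alpha>/2) \<le> C / \<epsilon> * ?d powr (\<alpha>/2)" .
      show ?thesis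
      proof (rule exI[of _ \<gamma>], rule exI[of _ \<eta>], intro conjI ballI)
        have "2 * ?d \<le> C * ?d" using C d by (intro mult_right_mono) auto
        then show "curve_length A \<omega>0 \<gamma> \<le> C * ?d" using l(2) unfolding l_def by linarith
        show "?d \<le> curve_length A \<omega>0 \<gamma>" using l(1) by (simp add: l_def)
        show "curve_length A ?\<omega>' \<eta> \<le> C / \<epsilon> * curve_length A \<omega>0 \<gamma> powr (\<alpha>/2)"
          "curve_length A ?\<omega>' \<eta> \<le> C / \<epsilon> * ?d powr (\<alpha>/2)"
          using \<eta>(2) 1 2 unfolding l_def by linarith+
      qed (use \<gamma>(1) \<eta>(1,3) riem_dist_le[OF R' \<eta>(1)] in auto)
    qed
  qed
qed

end
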